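(* Let $u\ge1$ be an integer, let $E\in E(u)$ be a linear expanding map of $\mathbb{T}^u$ that is a multiple of the identity, let $\lambda\in(|\det E|^{-1},1)$ and let $C:\mathbb{R}\to\mathbb{R}$, $C(y)=\lambda y$. Then there exist an integer $s$ and functions $\phi_k\in C^\infty(\mathbb{T}^u,\mathbb{R})$, $k=1,\dots,s$, such that for every $f\in C^2(\mathbb{T}^u,\mathbb{R})$ the set of $\mathbf{t}=(t_1,\dots,t_s)\in\mathbb{R}^s$ for which the SRB measure $\mu_{T_{\mathbf t}}$ of $$T_{\mathbf t}(x,y)=\Big(E(x),\ \lambda y+f(x)+\sum_{k=1}^s t_k\phi_k(x)\Big)$$ is absolutely continuous with respect to the volume of $\mathbb{T}^u\times\mathbb{R}$ has full Lebesgue measure in $\mathbb{R}^s$.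
   Context: $\mathbb{T}^u=\mathbb{R}^u/\mathbb{Z}^u$. $E(u)$ is the set of linear expanding maps of $\mathbb{T}^u$: maps induced by a linear map (same letter) $E:\mathbb{R}^u\to\mathbb{R}^u$ with $E(\mathbb{Z}^u)\subset\mathbb{Z}^u$ and $\|E^{-1}\|<1$ (operator norm). A map $T(x,y)=(E(x),\lambda y+g(x))$ on $\mathbb{T}^u\times\mathbb{R}$ with $g\in C^2(\mathbb{T}^u,\mathbb{R})$ has a unique SRB measure $\mu_T$: the unique $T$-invariant Borel probability measure such that $\frac1n\sum_{k=0}^{n-1}\delta_{T^k(z)}\to\mu_T$ weakly for volume-almost every $z$. The volume is the product of normalized Lebesgue measure on $\mathbb{T}^u$ and Lebesgue measure on $\mathbb{R}$. *)

theory Defs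
  imports "HOL-Probability.Probability"
begin

section \<open>The torus\<close>

definition int_vectors :: "(real^'n) set"
  where "int_vectors = {v. \<forall>i. v $ i \<in> \<int>}"

quotient_type 'n torus = "real^'n" / "\<lambda>x y. x - y \<in> (int_vectors :: (real^'n) set)"
proof (rule equivpI)
  show "reflp (\<lambda>x y. x - y \<in> (int_vectors :: (real^'n) set))"
    by (auto simp: reflp_def int_vectors_def)
  show "symp (\<lambda>x y. x - y \<in> (int_vectors :: (real^'n) set))"
    by (auto simp: symp_def int_vectors_def) (metis Ints_minus minus_diff_eq)
  show "transp (\<lambda>x y. x - y \<in> (int_vectors :: (real^'n) set))"
    by (auto simp: transp_def int_vectors_def) (metis Ints_add diff_add_cancel add_diff_eq)
qed

lemma abs_torus_eq_iff: "abs_torus x = abs_torus y \<longleftrightarrow> x - y \<in> int_vectors"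
  using torus.abs_eq_iff by blast

lemma abs_rep_torus [simp]: "abs_torus (rep_torus p) = p"
  by (rule Quotient3_abs_rep[OF Quotient3_torus])

instantiation torus :: (finite) topological_space
begin

definition open_torus :: "'a torus set \<Rightarrow> bool"
  where "open_torus U \<longleftrightarrow> open (abs_torus -` U)"

instance
  by standard (auto simp: open_torus_def vimage_Union)

end

lemma continuous_on_abs_torus: "continuous_on UNIV (abs_torus :: real^'n \<Rightarrow> 'n torus)"
  by (simp add: continuous_on_open_vimage open_torus_def)

lemma open_map_abs_torus:
  fixes U :: "(real^'n) set"
  assumes "open U"
  shows "open (abs_torus ` U)"
proof -
  have "abs_torus -` (abs_torus ` U) = (\<Union>v\<in>int_vectors. (+) v ` U)"
  proof safe
    fix x y :: "real^'n" assume "abs_torus x = abs_torus y" "y \<in> U"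
    then show "x \<in> (\<Union>v\<in>int_vectors. (+) v ` U)"
      by (intro UN_I[of "x - y"]) (auto simp: abs_torus_eq_iff)
  next
    fix v y :: "real^'n" assume "v \<in> int_vectors" "y \<in> U"
    then show "v + y \<in> abs_torus -` (abs_torus ` U)"
      by (auto simp: abs_torus_eq_iff intro!: rev_image_eqI[of y])
  qed
  then show ?thesis
    using assms by (auto simp: open_torus_def intro!: open_UN open_translation)
qed

instance torus :: (finite) second_countable_topology
proof
  obtain B :: "(real^'a) set set" where B: "countable B" "topological_basis B"
    using ex_countable_basis by blast
  have "topological_basis ((`) abs_torus ` B :: 'a torus set set)"
  proof (rule topological_basisI)
    fix V :: "'a torus set" assume "V \<in> (`) abs_torus ` B"
    then show "open V"
      using B(2) by (auto intro: open_map_abs_torus topological_basis_open)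
  next
    fix V :: "'a torus set" and p assume "open V" "p \<in> V"
    then have "open (abs_torus -` V)" "rep_torus p \<in> abs_torus -` V"
      by (auto simp: open_torus_def)
    then obtain W where "W \<in> B" "rep_torus p \<in> W" "W \<subseteq> abs_torus -` V"
      using B(2) topological_basisE by blast
    then show "\<exists>W\<in>(`) abs_torus ` B. p \<in> W \<and> W \<subseteq> V"
      by (intro bexI[of _ "abs_torus ` W"]) (auto intro: rev_image_eqI[of "rep_torus p"])
  qed
  then show "\<exists>B :: 'a torus set set. countable B \<and> open = generate_topology B"
    using B(1) by (metis countable_image topological_basis_imp_subbasis)
qed

definition torus_measure :: "'n::finite torus measure"
  where "torus_measure =
    distr (restrict_space lborel {x :: real^'n. \<forall>i. 0 \<le> x $ i \<and> x $ i < 1}) borel abs_torus"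

definition volume_measure :: "('n::finite torus \<times> real) measure"
  where "volume_measure = torus_measure \<Otimes>\<^sub>M lborel"

lemma sets_volume_measure [simp]:
  "sets (volume_measure :: ('n::finite torus \<times> real) measure) = sets borel"
proof -
  have "sets (volume_measure :: ('n torus \<times> real) measure) = sets (borel \<Otimes>\<^sub>M borel)"
    unfolding volume_measure_def by (intro sets_pair_measure_cong) (auto simp: torus_measure_def)
  also have "(borel \<Otimes>\<^sub>M borel :: ('n torus \<times> real) measure) = borel"
    by (rule borel_prod)
  finally show ?thesis .
qed

section \<open>Functions of class $C^k$\<close>

primrec Ck_differentiable :: "nat \<Rightarrow> ('a::real_normed_vector \<Rightarrow> real) \<Rightarrow> bool"
  where
    "Ck_differentiable 0 f \<longleftrightarrow> continuous_on UNIV f"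
  | "Ck_differentiable (Suc k) f \<longleftrightarrow> (\<forall>x. f differentiable (at x)) \<and>
       (\<forall>v. Ck_differentiable k (\<lambda>x. frechet_derivative f (at x) v))"

definition Ck_torus :: "nat \<Rightarrow> ('n::finite torus \<Rightarrow> real) \<Rightarrow> bool"
  where "Ck_torus k g \<longleftrightarrow> Ck_differentiable k (\<lambda>x. g (abs_torus x))"

definition smooth_torus :: "('n::finite torus \<Rightarrow> real) \<Rightarrow> bool"
  where "smooth_torus g \<longleftrightarrow> (\<forall>k. Ck_torus k g)"

section \<open>Linear expanding maps and skew products\<close>

definition linear_expanding :: "(real^'n \<Rightarrow> real^'n) \<Rightarrow> bool"
  where "linear_expanding E \<longleftrightarrow>
    linear E \<and> E ` int_vectors \<subseteq> int_vectors \<and> bij E \<and> onorm (inv E) < 1"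

text \<open>The choice of the representative is immaterial for \<open>E\<close> as above, see
  \<open>torus_map_abs_torus\<close>.\<close>

definition torus_map :: "(real^'n \<Rightarrow> real^'n) \<Rightarrow> 'n torus \<Rightarrow> 'n torus"
  where "torus_map E p = abs_torus (E (rep_torus p))"

lemma torus_map_abs_torus:
  assumes "linear_expanding E"
  shows "torus_map E (abs_torus x) = abs_torus (E x)"
proof -
  have "rep_torus (abs_torus x) - x \<in> int_vectors"
    by (simp flip: abs_torus_eq_iff)
  then have "E (rep_torus (abs_torus x)) - E x \<in> int_vectors"
    using assms by (auto simp: linear_expanding_def simp flip: linear_diff)
  then show ?thesis
    by (simp add: torus_map_def abs_torus_eq_iff)
qed

definition skew_product ::
    "(real^'n \<Rightarrow> real^'n) \<Rightarrow> (real \<Rightarrow> real) \<Rightarrow> ('n torus \<Rightarrow> real) \<Rightarrow> 'n torus \<times> real \<Rightarrow> 'n torus \<times> real"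
  where "skew_product E C g = (\<lambda>(x, y). (torus_map E x, C y + g x))"

section \<open>SRB measures\<close>

definition weakly_converges ::
    "(nat \<Rightarrow> 'a::topological_space measure) \<Rightarrow> 'a measure \<Rightarrow> bool"
  where "weakly_converges M N \<longleftrightarrow>
    (\<forall>h :: 'a \<Rightarrow> real. continuous_on UNIV h \<and> bounded (range h) \<longrightarrow>
      (\<lambda>n. integral\<^sup>L (M n) h) \<longlonglongrightarrow> integral\<^sup>L N h)"

text \<open>The measure $\frac1n \sum_{k<n} \delta_{T^k z}$ (and the zero measure for $n = 0$).\<close>

definition empirical_measure ::
    "('a::topological_space \<Rightarrow> 'a) \<Rightarrow> 'a \<Rightarrow> nat \<Rightarrow> 'a measure"
  where "empirical_measure T z n =
    distr (uniform_count_measure {..<n}) borel (\<lambda>k. (T ^^ k) z)"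

lemma integral_empirical_measure:
  fixes h :: "'a::topological_space \<Rightarrow> real"
  assumes "h \<in> borel_measurable borel"
  shows "integral\<^sup>L (empirical_measure T z n) h = (\<Sum>k<n. h ((T ^^ k) z)) / real n"
proof -
  have "(\<lambda>k. (T ^^ k) z) \<in> uniform_count_measure {..<n} \<rightarrow>\<^sub>M borel"
    by (auto simp: measurable_def space_uniform_count_measure sets_uniform_count_measure)
  then have "integral\<^sup>L (empirical_measure T z n) h
      = (\<integral>k. h ((T ^^ k) z) \<partial>uniform_count_measure {..<n})"
    unfolding empirical_measure_def by (intro integral_distr assms)
  also have "\<dots> = (\<Sum>k<n. h ((T ^^ k) z) / real n)"
    unfolding uniform_count_measure_def
    by (subst lebesgue_integral_point_measure_finite) auto
  finally show ?thesis
    by (simp add: sum_divide_distrib)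
qed

definition is_SRB_measure ::
    "('n::finite torus \<times> real \<Rightarrow> 'n torus \<times> real) \<Rightarrow> ('n torus \<times> real) measure \<Rightarrow> bool"
  where "is_SRB_measure T \<mu> \<longleftrightarrow>
    prob_space \<mu> \<and> sets \<mu> = sets borel \<and>
    T \<in> \<mu> \<rightarrow>\<^sub>M \<mu> \<and> distr \<mu> \<mu> T = \<mu> \<and>
    (AE z in volume_measure. weakly_converges (empirical_measure T z) \<mu>)"

definition SRB_measure ::
    "('n::finite torus \<times> real \<Rightarrow> 'n torus \<times> real) \<Rightarrow> ('n torus \<times> real) measure"
  where "SRB_measure T = (THE \<mu>. is_SRB_measure T \<mu>)"

end

theory Submission
  imports Defs
begin

text \<open>Write \<open>c\<close> for the integer with \<open>E x = c x\<close>, put \<open>N = \<bar>c\<bar> ^ n\<close> for the degree of \<open>E\<close> on the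
\<open>n\<close>-dimensional torus, and call a sequence \<open>x_1, x_2, \<dots>\<close> with \<open>E x_(k+1) = x_k\<close> and \<open>E x_1 = x\<close> a
preorbit of \<open>x\<close>. Choosing each preimage uniformly among the \<open>N\<close> possible ones makes the preorbit random.
The SRB measure is the law of \<open>(x, S)\<close> where \<open>x\<close> is uniform and \<open>S = (\<Sum>k. lam ^ k * g x_(k+1))\<close> is
summed along a random preorbit of \<open>x\<close> (\<open>SRB_measure_eq_solenoid\<close>). Indeed the fibre coordinate of an
orbit forgets its initial value, so its Birkhoff averages are those of \<open>E\<close> up to a small error, and
\<open>E\<close> equidistributes almost every point (\<open>torus_mult_equidistributes\<close>). Here correlations of Lipschitz
functions decay exponentially, so the averages converge along the squares and hence altogether.

For the absolute continuity let \<open>S_t\<close> belong to \<open>g = f + (\<Sum>k. t k * \<phi> k)\<close>, which makes \<open>S_t\<close> an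
affine function of the parameter \<open>t\<close>. Two preorbits of \<open>x\<close> that first differ at step \<open>n + 1\<close> have
\<open>S_t - S_t' = a + (\<Sum>k. t k * \<Delta> k)\<close> with \<open>\<Delta>\<close> of size at least a constant times \<open>lam ^ n\<close>, provided
that the finitely many functions \<open>\<phi> k\<close> separate all pairs of preorbits that differ at the first step,
uniformly (\<open>transversality\<close>). Hence the parameters in a bounded box for which
\<open>\<bar>S_t - S_t'\<bar> \<le> r\<close> have measure at most a constant times \<open>r * lam ^ (- n)\<close>. Since two independent
preorbits agree for \<open>n\<close> steps with probability \<open>N ^ (- n)\<close> and \<open>lam * N > 1\<close>, the average over
\<open>t\<close> of the probability that \<open>\<bar>S_t - S_t'\<bar> \<le> r\<close> is at most a constant times \<open>r\<close>
(\<open>energy_parameter_integral\<close>). By the lemma of Fatou, for almost every \<open>t\<close> this probability divided by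
\<open>r\<close> stays bounded along a sequence \<open>r \<longlonglongrightarrow> 0\<close>; it is, up to a constant, a bound on the square
of the \<open>L2\<close> norm of the smoothed densities, so the law has no mass on null sets
(\<open>absolutely_continuous_of_energy\<close>).

The separating functions come from compactness. For a single pair of preorbits that differ at the first
step, one of the two first points, say \<open>p\<close>, is not periodic. Then \<open>p\<close> occurs in its own preorbit only
at the first step, where it has weight \<open>1\<close>, and in the other preorbit at most once, at a later step,
where it has weight at most \<open>lam < 1\<close>. So a smooth bump concentrated at \<open>p\<close> has different sums along
the two preorbits, and finitely many bumps serve all pairs of the compact space of pairs.\<close>

section \<open>The torus as a compact metric space\<close>

lemma torus_cover: "\<exists>x. p = abs_torus x"
  by (metis abs_rep_torus)

lemma int_vectors_add: "v \<in> int_vectors \<Longrightarrow> w \<in> int_vectors \<Longrightarrow> v + w \<in> int_vectors"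
  and int_vectors_diff: "v \<in> int_vectors \<Longrightarrow> w \<in> int_vectors \<Longrightarrow> v - w \<in> int_vectors"
  and int_vectors_minus: "v \<in> int_vectors \<Longrightarrow> - v \<in> int_vectors"
  and int_vectors_zero: "0 \<in> int_vectors"
  and int_vectors_scale: "v \<in> int_vectors \<Longrightarrow> of_int c *\<^sub>R v \<in> int_vectors"
  by (auto simp: int_vectors_def)

lemma closed_int_vectors: "closed (int_vectors :: (real^'n) set)"
proof -
  have "closed {v :: real^'n. v $ i \<in> \<int>}" for i
  proof -
    have "closed ((\<lambda>v :: real^'n. v $ i) -` \<int>)"
      by (intro continuous_closed_vimage closed_Ints) (auto intro!: continuous_intros)
    then show ?thesis by (simp add: vimage_def)
  qed
  moreover have "int_vectors = (\<Inter>i. {v :: real^'n. v $ i \<in> \<int>})"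
    by (auto simp: int_vectors_def)
  ultimately show ?thesis by (metis (no_types, lifting) closed_INT)
qed

text \<open>The metric makes the distance to a closed set available, from which continuous functions on the
torus and on its product with the line are built. The triangle inequality holds because any two points
have lifts that realise their distances to a common lift of a third point.\<close>

instantiation torus :: (finite) metric_space
begin

definition dist_torus :: "'a torus \<Rightarrow> 'a torus \<Rightarrow> real"
  where "dist_torus p q = infdist (rep_torus p - rep_torus q) int_vectors"

definition uniformity_torus :: "('a torus \<times> 'a torus) filter"
  where "uniformity_torus = (INF e\<in>{0 <..}. principal {(x, y). dist x y < e})"

lemma infdist_shift_int:
  fixes x :: "real^'a"
  assumes "v \<in> int_vectors"
  shows "infdist (x + v) int_vectors \<le> infdist x int_vectors"
proof -
  have ne: "(int_vectors :: (real^'a) set) \<noteq> {}" using int_vectors_zero by blast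
  obtain w where w: "w \<in> int_vectors" "infdist x int_vectors = dist x w"
    using infdist_attains_inf[OF closed_int_vectors ne] by metis
  have "infdist (x + v) int_vectors \<le> dist (x + v) (w + v)"
    by (intro infdist_le int_vectors_add w assms)
  then show ?thesis using w by simp
qed

lemma dist_abs_torus:
  fixes x y :: "real^'a"
  shows "dist (abs_torus x) (abs_torus y) = infdist (x - y) int_vectors"
proof -
  have r: "rep_torus (abs_torus z) - z \<in> int_vectors" for z :: "real^'a"
    by (simp flip: abs_torus_eq_iff)
  define v where "v = (rep_torus (abs_torus x) - x) - (rep_torus (abs_torus y) - y)"
  have v: "v \<in> int_vectors" unfolding v_def by (intro int_vectors_diff r)
  have "rep_torus (abs_torus x) - rep_torus (abs_torus y) = (x - y) + v"
    by (simp add: v_def)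
  moreover have "infdist ((x - y) + v) int_vectors = infdist (x - y) int_vectors"
    using infdist_shift_int[OF v, of "x - y"] infdist_shift_int[OF int_vectors_minus[OF v], of "(x - y) + v"]
    by simp
  ultimately show ?thesis by (simp add: dist_torus_def)
qed

lemma dist_abs_torus_le: "dist (abs_torus x) (abs_torus y) \<le> dist x y"
  using infdist_le[OF int_vectors_zero, of "x - y"] by (simp add: dist_abs_torus dist_norm)

lemma dist_abs_torus_attained:
  fixes x y :: "real^'a"
  obtains z where "abs_torus z = abs_torus y" "dist x z = dist (abs_torus x) (abs_torus y)"
proof -
  have ne: "(int_vectors :: (real^'a) set) \<noteq> {}" using int_vectors_zero by blast
  obtain w where w: "w \<in> int_vectors" "infdist (x - y) int_vectors = dist (x - y) w"
    using infdist_attains_inf[OF closed_int_vectors ne] by metis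
  show thesis
  proof
    show "abs_torus (y + w) = abs_torus y" using w by (simp add: abs_torus_eq_iff)
    show "dist x (y + w) = dist (abs_torus x) (abs_torus y)"
      using w by (simp add: dist_abs_torus dist_norm algebra_simps)
  qed
qed

instance
proof
  show "uniformity = (INF e\<in>{0 <..}. principal {(x :: 'a torus, y). dist x y < e})"
    by (rule uniformity_torus_def)
next
  fix p q :: "'a torus"
  obtain x y where xy: "p = abs_torus x" "q = abs_torus y" using torus_cover by metis
  have ne: "(int_vectors :: (real^'a) set) \<noteq> {}" using int_vectors_zero by blast
  show "dist p q = 0 \<longleftrightarrow> p = q"
    using in_closed_iff_infdist_zero[OF closed_int_vectors ne, of "x - y"]
    by (simp add: xy dist_abs_torus abs_torus_eq_iff)
next
  fix p q r :: "'a torus"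
  obtain x where x: "r = abs_torus x" using torus_cover by metis
  obtain y0 z0 where "p = abs_torus y0" "q = abs_torus z0" using torus_cover by metis
  then obtain y z where yz: "p = abs_torus y" "dist x y = dist r p" "q = abs_torus z" "dist x z = dist r q"
    using dist_abs_torus_attained[of y0 x] dist_abs_torus_attained[of z0 x] x by metis
  have s: "dist a b = dist b a" for a b :: "'a torus"
  proof -
    obtain x y where xy: "a = abs_torus x" "b = abs_torus y" using torus_cover by metis
    obtain z where z: "abs_torus z = abs_torus y" "dist x z = dist (abs_torus x) (abs_torus y)"
      by (rule dist_abs_torus_attained)
    obtain z' where z': "abs_torus z' = abs_torus x" "dist y z' = dist (abs_torus y) (abs_torus x)"
      by (rule dist_abs_torus_attained)
    have "dist b a \<le> dist a b" using dist_abs_torus_le[of z x] z xy by (simp add: dist_commute)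
    moreover have "dist a b \<le> dist b a" using dist_abs_torus_le[of z' y] z' xy by (simp add: dist_commute)
    ultimately show ?thesis by simp
  qed
  have "dist p q \<le> dist y z" using yz dist_abs_torus_le by metis
  also have "\<dots> \<le> dist y x + dist z x" by (rule dist_triangle2)
  also have "\<dots> = dist p r + dist q r" using yz by (simp add: dist_commute s)
  finally show "dist p q \<le> dist p r + dist q r" .
next
  fix U :: "'a torus set"
  have "open U \<longleftrightarrow> (\<forall>p\<in>U. \<exists>e>0. \<forall>q. dist p q < e \<longrightarrow> q \<in> U)"
  proof (intro iffI ballI)
    fix p assume U: "open U" and p: "p \<in> U"
    obtain x where x: "p = abs_torus x" using torus_cover by metis
    have "open (abs_torus -` U)" using U by (simp add: open_torus_def)
    then obtain e where e: "e > 0" "\<And>y. dist y x < e \<Longrightarrow> abs_torus y \<in> U"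
      using p x unfolding open_dist by (metis vimageD vimageI)
    have "q \<in> U" if "dist p q < e" for q
    proof -
      obtain y0 where "q = abs_torus y0" using torus_cover by metis
      then obtain y where "q = abs_torus y" "dist x y = dist p q"
        using dist_abs_torus_attained[of y0 x] x by metis
      with e that show ?thesis by (simp add: dist_commute)
    qed
    with e show "\<exists>e>0. \<forall>q. dist p q < e \<longrightarrow> q \<in> U" by blast
  next
    assume H: "\<forall>p\<in>U. \<exists>e>0. \<forall>q. dist p q < e \<longrightarrow> q \<in> U"
    have "\<exists>e>0. \<forall>y. dist y x < e \<longrightarrow> abs_torus y \<in> U" if xU: "abs_torus x \<in> U" for x :: "real^'a"
    proof -
      obtain e where e: "e>0" "\<And>q. dist (abs_torus x) q < e \<Longrightarrow> q \<in> U" using bspec[OF H xU] by auto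
      have "abs_torus y \<in> U" if "dist y x < e" for y
      proof (rule e(2))
        show "dist (abs_torus x) (abs_torus y) < e"
          using dist_abs_torus_le[of x y] that by (simp add: dist_commute[of x y])
      qed
      then show ?thesis using e(1) by blast
    qed
    then show "open U" by (simp add: open_torus_def open_dist)
  qed
  moreover have "(\<exists>e>0. \<forall>q. dist p q < e \<longrightarrow> q \<in> U) \<longleftrightarrow> (\<forall>\<^sub>F (x', y) in uniformity. x' = p \<longrightarrow> y \<in> U)" for p
  proof -
    have "(\<forall>\<^sub>F (x', y) in uniformity. x' = p \<longrightarrow> y \<in> U) \<longleftrightarrow>
       (\<exists>e\<in>{0<..}. \<forall>xy\<in>{(x :: 'a torus, y). dist x y < e}. case xy of (x', y) \<Rightarrow> x' = p \<longrightarrow> y \<in> U)"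
      unfolding uniformity_torus_def
      by (subst eventually_INF_base)
        (auto simp: eventually_principal subset_eq intro: bexI[of _ "min _ _"])
    also have "\<dots> \<longleftrightarrow> (\<exists>e>0. \<forall>q. dist p q < e \<longrightarrow> q \<in> U)"
      by (auto simp: Bex_def)
    finally show ?thesis by simp
  qed
  ultimately show "open U \<longleftrightarrow> (\<forall>x\<in>U. \<forall>\<^sub>F (x', y) in uniformity. x' = x \<longrightarrow> y \<in> U)"
    by simp
qed

end

lemma continuous_on_torusI:
  fixes F :: "'n::finite torus \<Rightarrow> 'b::topological_space"
  assumes "continuous_on UNIV (\<lambda>x. F (abs_torus x))"
  shows "continuous_on UNIV F"
  unfolding continuous_on_open_vimage[OF open_UNIV]
proof (intro allI impI)
  fix B :: "'b set" assume "open B"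
  then have "open ((\<lambda>x. F (abs_torus x)) -` B)"
    using assms by (simp add: continuous_on_open_vimage)
  then show "open (F -` B \<inter> UNIV)"
    by (simp add: open_torus_def vimage_def)
qed

lemma abs_torus_cbox:
  fixes p :: "'n::finite torus"
  shows "\<exists>x. (\<forall>i. 0 \<le> x $ i \<and> x $ i < 1) \<and> p = abs_torus x"
proof -
  obtain y where y: "p = abs_torus y" using torus_cover by metis
  define x :: "real^'n" where "x = (\<chi> i. frac (y $ i))"
  have "x - y \<in> int_vectors" by (auto simp: x_def int_vectors_def frac_def)
  then have "p = abs_torus x" by (simp add: y abs_torus_eq_iff flip: abs_torus_eq_iff)
  then show ?thesis by (intro exI[of _ x]) (auto simp: x_def frac_lt_1)
qed

lemma compact_torus: "compact (UNIV :: 'n::finite torus set)"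
proof -
  have "compact (abs_torus ` cbox 0 (1 :: real^'n))"
    by (intro compact_continuous_image compact_cbox continuous_on_subset[OF continuous_on_abs_torus]) auto
  moreover have "abs_torus ` cbox 0 (1 :: real^'n) = UNIV"
  proof (intro set_eqI iffI UNIV_I)
    fix p :: "'n torus"
    obtain x where "\<forall>i. 0 \<le> x $ i \<and> x $ i < 1" "p = abs_torus x" using abs_torus_cbox by blast
    then show "p \<in> abs_torus ` cbox 0 (1 :: real^'n)"
      by (auto simp: mem_box_cart less_imp_le)
  qed
  ultimately show ?thesis by simp
qed

section \<open>Bounded continuous test functions on metric spaces\<close>

text \<open>The case distinction is needed because \<open>infdist\<close> to the empty set is \<open>0\<close> by convention.\<close>

definition open_ramp :: "'a::metric_space set \<Rightarrow> nat \<Rightarrow> 'a \<Rightarrow> real"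
  where "open_ramp U j p = (if U = UNIV then 1 else min 1 (real j * infdist p (- U)))"

lemma open_ramp_bounds: "0 \<le> open_ramp U j p" "open_ramp U j p \<le> 1"
  by (simp_all add: open_ramp_def infdist_nonneg)

lemma open_ramp_lipschitz:
  "\<bar>open_ramp U j p - open_ramp U j q\<bar> \<le> real j * dist p q"
proof (cases "U = UNIV")
  case False
  have "\<bar>infdist p (- U) - infdist q (- U)\<bar> \<le> dist p q"
    by (rule infdist_triangle_abs)
  then have "\<bar>real j * infdist p (- U) - real j * infdist q (- U)\<bar> \<le> real j * dist p q"
    by (simp add: abs_mult mult_left_mono flip: right_diff_distrib)
  then show ?thesis using False by (auto simp: open_ramp_def min_def)
qed (simp add: open_ramp_def)

lemma lipschitz_continuous:
  fixes f :: "'a::metric_space \<Rightarrow> real"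
  assumes "\<And>p q. \<bar>f p - f q\<bar> \<le> K * dist p q"
  shows "continuous_on UNIV f"
proof -
  have "\<bar>f p - f q\<bar> \<le> max K 0 * dist p q" for p q
    using assms[of p q] by (rule order_trans) (auto intro: mult_right_mono)
  then have "(max K 0)-lipschitz_on UNIV f"
    by (intro lipschitz_onI) (auto simp: dist_real_def)
  then show ?thesis by (rule lipschitz_on_continuous_on)
qed

lemma continuous_open_ramp: "continuous_on UNIV (open_ramp U j)"
  by (rule lipschitz_continuous[OF open_ramp_lipschitz])

lemma open_ramp_outside: "p \<notin> U \<Longrightarrow> open_ramp U j p = 0"
  by (auto simp: open_ramp_def)

lemma open_ramp_tendsto:
  assumes "open U"
  shows "(\<lambda>j. open_ramp U j p) \<longlonglongrightarrow> indicator U p"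
proof (cases "p \<in> U \<and> U \<noteq> UNIV")
  case True
  then have ne: "- U \<noteq> {}" by auto
  have "infdist p (- U) > 0"
    using in_closed_iff_infdist_zero[of "- U" p] ne True assms infdist_nonneg[of p "-U"]
    by (auto simp: closed_Compl less_le)
  then obtain J :: nat where J: "1 < real J * infdist p (- U)"
    using reals_Archimedean3 by blast
  have "open_ramp U j p = 1" if "j \<ge> J" for j
  proof -
    have "1 < real j * infdist p (- U)"
      using J that infdist_nonneg[of p "-U"] by (meson less_le_trans mult_right_mono of_nat_mono)
    then show ?thesis by (simp add: open_ramp_def)
  qed
  then have "eventually (\<lambda>j. open_ramp U j p = 1) sequentially"
    using eventually_sequentially by blast
  then show ?thesis using True by (simp add: tendsto_eventually)
next
  case False
  then show ?thesis
    by (cases "U = UNIV") (auto simp: open_ramp_outside open_ramp_def)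
qed

text \<open>Ramps increase to the indicator of an open set, and the open sets form an intersection-stable
generator of the Borel sets.\<close>

lemma measure_eq_by_continuous:
  fixes M N :: "'a::metric_space measure"
  assumes M: "prob_space M" "sets M = sets borel"
    and N: "prob_space N" "sets N = sets borel"
    and eq: "\<And>h :: 'a \<Rightarrow> real. continuous_on UNIV h \<Longrightarrow> bounded (range h) \<Longrightarrow>
      integral\<^sup>L M h = integral\<^sup>L N h"
  shows "M = N"
proof -
  have spM: "space M = UNIV" and spN: "space N = UNIV"
    using sets_eq_imp_space_eq[OF M(2)] sets_eq_imp_space_eq[OF N(2)] by simp_all
  have lim: "(\<lambda>j. integral\<^sup>L Q (open_ramp U j)) \<longlonglongrightarrow> measure Q U"
    if Q: "prob_space Q" "sets Q = sets borel" and U: "open U" for U :: "'a set" and Q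
  proof -
    interpret Q: prob_space Q by fact
    have meas: "open_ramp U j \<in> borel_measurable Q" for j
      using borel_measurable_continuous_onI[OF continuous_open_ramp] by (simp cong: measurable_cong_sets add: Q)
    have "(\<lambda>j. integral\<^sup>L Q (open_ramp U j)) \<longlonglongrightarrow> integral\<^sup>L Q (indicator U)"
    proof (rule integral_dominated_convergence[where w = "\<lambda>_. 1"])
      show "(indicator U :: 'a \<Rightarrow> real) \<in> borel_measurable Q" using U by (intro borel_measurable_indicator) (simp add: Q)
    qed (auto intro: open_ramp_tendsto U simp: meas open_ramp_bounds)
    then show ?thesis using U by (simp add: Q)
  qed
  have openeq: "emeasure M U = emeasure N U" if U: "open U" for U
  proof -
    have "bounded (range (open_ramp U j))" for j
      by (rule boundedI[where B = 1]) (auto simp: open_ramp_bounds abs_le_iff intro: order_trans[OF _ open_ramp_bounds(1)])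
    then have "integral\<^sup>L M (open_ramp U j) = integral\<^sup>L N (open_ramp U j)" for j
      by (intro eq continuous_open_ramp)
    then have "measure M U = measure N U"
      using lim[OF M U] lim[OF N U] LIMSEQ_unique by fastforce
    then show ?thesis
      using prob_space.finite_measure[OF M(1)] prob_space.finite_measure[OF N(1)]
      by (simp add: finite_measure.emeasure_eq_measure)
  qed
  show ?thesis
  proof (rule measure_eqI_generator_eq[where E = "{U. open U}" and A = "\<lambda>_. UNIV" and \<Omega> = UNIV])
    show "emeasure M UNIV \<noteq> \<infinity>" using M prob_space.emeasure_space_1 spM by fastforce
  qed (auto simp: openeq M N borel_def Int_stable_def)
qed


text \<open>Finite maxima turn pointwise suprema of countable families into limits of increasing sequences
without leaving a countable set.\<close>

definition max_combs :: "('a \<Rightarrow> real) set \<Rightarrow> ('a \<Rightarrow> real) set"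
  where "max_combs G = {\<lambda>p. Max ((\<lambda>g. g p) ` S) | S. finite S \<and> S \<noteq> {} \<and> S \<subseteq> G}"

lemma countable_max_combs:
  assumes "countable G"
  shows "countable (max_combs G)"
proof -
  have "max_combs G \<subseteq> (\<lambda>S p. Max ((\<lambda>g. g p) ` S)) ` {S. finite S \<and> S \<subseteq> G}"
    by (auto simp: max_combs_def)
  then show ?thesis
    using countable_Collect_finite_subset[OF assms] by (meson countable_image countable_subset)
qed

lemma max_combs_lipschitz:
  assumes S: "finite S" "S \<noteq> {}"
    and L: "\<And>g. g \<in> S \<Longrightarrow> \<exists>K. \<forall>p q. \<bar>g p - g q\<bar> \<le> K * dist p q"
  shows "\<exists>K. \<forall>p q :: 'a::metric_space. \<bar>Max ((\<lambda>g. g p) ` S) - Max ((\<lambda>g. g q) ` S)\<bar> \<le> K * dist p q"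
proof -
  obtain K where K: "\<And>g p q. g \<in> S \<Longrightarrow> \<bar>g p - g q\<bar> \<le> K g * dist p q"
    using L by metis
  have "Max ((\<lambda>g. g p) ` S) \<le> Max ((\<lambda>g. g q) ` S) + (\<Sum>g\<in>S. \<bar>K g\<bar>) * dist p q" for p q
  proof (rule Max.boundedI)
    fix a assume "a \<in> (\<lambda>g. g p) ` S"
    then obtain g where g: "g \<in> S" "a = g p" by auto
    have "g p \<le> g q + K g * dist p q" using K[OF g(1), of p q] by (auto simp: abs_le_iff)
    also have "K g * dist p q \<le> (\<Sum>g\<in>S. \<bar>K g\<bar>) * dist p q"
      using member_le_sum[OF g(1), of "\<lambda>g. \<bar>K g\<bar>"] S by (intro mult_right_mono) auto
    also have "g q \<le> Max ((\<lambda>g. g q) ` S)" using S g by auto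
    finally show "a \<le> Max ((\<lambda>g. g q) ` S) + (\<Sum>g\<in>S. \<bar>K g\<bar>) * dist p q" using g by simp
  qed (use S in auto)
  then show ?thesis
    by (intro exI[of _ "\<Sum>g\<in>S. \<bar>K g\<bar>"] allI abs_leI) (smt (verit) dist_commute)+
qed

text \<open>A nonnegative continuous function is the supremum of the rational multiples of ramps over basic open
sets that lie below it.\<close>

lemma continuous_as_max_limit:
  fixes H :: "'a::{metric_space,second_countable_topology} \<Rightarrow> real"
  assumes B: "topological_basis B" "countable B"
    and H: "continuous_on UNIV H" "\<And>p. 0 \<le> H p"
  obtains h where
    "\<And>i. h i \<in> max_combs ((\<lambda>(q, U, j) p. q * open_ramp U j p) ` ((\<rat> \<inter> {0..}) \<times> B \<times> UNIV))"
    "\<And>i p. 0 \<le> h i p" "\<And>i p. h i p \<le> H p" "\<And>p. (\<lambda>i. h i p) \<longlonglongrightarrow> H p"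
proof -
  let ?G = "(\<lambda>(q, U, j) p. q * open_ramp U j p) ` ((\<rat> \<inter> {0..}) \<times> B \<times> UNIV)"
  define GH where "GH = {g \<in> ?G. \<forall>p. g p \<le> H p}"
  have cG: "countable GH"
    unfolding GH_def using B by (intro countable_Collect countable_image countable_SIGMA) (auto simp: countable_rat)
  have G0: "0 \<le> g p" if "g \<in> ?G" for g p
    using that by (auto simp: open_ramp_bounds)
  have ne: "GH \<noteq> {}"
  proof -
    obtain U where "U \<in> B" using topological_basisE[OF B(1) open_UNIV UNIV_I] by metis
    then have "(\<lambda>p. 0 * open_ramp U 0 p) \<in> ?G" by (intro image_eqI[where x = "(0, U, 0)"]) auto
    moreover have "\<forall>p. 0 * open_ramp U 0 p \<le> H p" using H(2) by simp
    ultimately show ?thesis unfolding GH_def by blast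
  qed
  define e where "e = from_nat_into GH"
  have e: "e i \<in> GH" for i unfolding e_def by (rule from_nat_into[OF ne])
  have er: "\<exists>i. g = e i" if "g \<in> GH" for g
    unfolding e_def using from_nat_into_surj[OF cG that] by metis
  define h where "h i p = Max ((\<lambda>g. g p) ` e ` {..i})" for i p
  have h1: "h i \<in> max_combs ?G" for i
  proof -
    have "finite (e ` {..i})" "e ` {..i} \<noteq> {}" "e ` {..i} \<subseteq> ?G"
      using e by (auto simp: GH_def)
    moreover have "h i = (\<lambda>p. Max ((\<lambda>g. g p) ` (e ` {..i})))" by (simp add: h_def fun_eq_iff)
    ultimately show ?thesis unfolding max_combs_def by blast
  qed
  have hge: "e k p \<le> h i p" if "k \<le> i" for i k p
    unfolding h_def using that by (intro Max_ge) auto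
  have h2: "0 \<le> h i p" for i p
    using hge[of 0 i p] G0[of "e 0" p] e[of 0] by (auto simp: GH_def)
  have h3: "h i p \<le> H p" for i p
    unfolding h_def using e by (intro Max.boundedI) (auto simp: GH_def)
  have h4: "(\<lambda>i. h i p) \<longlonglongrightarrow> H p" for p
  proof (rule LIMSEQ_I)
    fix d :: real assume d: "d > 0"
    have "\<exists>k. e k p > H p - d"
    proof (cases "H p - d < 0")
      case True
      then show ?thesis using G0[of "e 0" p] e[of 0] by (intro exI[of _ 0]) (auto simp: GH_def)
    next
      case False
      obtain q where q: "q \<in> \<rat>" "H p - d < q" "q < H p" using Rats_dense_in_real[of "H p - d" "H p"] d by auto
      have "open (H -` {q<..})" using H(1) by (simp add: continuous_on_open_vimage)
      then obtain U where U: "U \<in> B" "p \<in> U" "U \<subseteq> H -` {q<..}"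
        using topological_basisE[OF B(1)] q(3) by (metis greaterThan_iff vimageI)
      have "open U" using topological_basis_open B(1) U by blast
      then have "(\<lambda>j. q * open_ramp U j p) \<longlonglongrightarrow> q * indicator U p"
        by (intro tendsto_mult tendsto_const open_ramp_tendsto)
      then have "eventually (\<lambda>j. q * open_ramp U j p > H p - d) sequentially"
        using U q by (intro order_tendstoD(1)) auto
      then obtain j where j: "q * open_ramp U j p > H p - d"
        by (auto simp: eventually_sequentially)
      define g where "g = (\<lambda>p. q * open_ramp U j p)"
      have "q \<ge> 0" using q False by simp
      have "g \<in> ?G" unfolding g_def using q U \<open>q \<ge> 0\<close> by (intro image_eqI[where x = "(q, U, j)"]) auto
      moreover have "g p' \<le> H p'" for p'
      proof (cases "p' \<in> U")
        case True
        then have "q < H p'" using U by auto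
        moreover have "q * open_ramp U j p' \<le> q * 1"
          using \<open>q \<ge> 0\<close> open_ramp_bounds by (intro mult_left_mono)
        ultimately show ?thesis by (simp add: g_def)
      qed (simp add: g_def open_ramp_outside H)
      ultimately have "g \<in> GH" by (simp add: GH_def)
      then obtain k where "g = e k" using er by blast
      then have "e k p = q * open_ramp U j p" by (metis g_def)
      then show ?thesis using j by (intro exI[of _ k]) simp
    qed
    then obtain k where k: "e k p > H p - d" by blast
    have "norm (h i p - H p) < d" if "i \<ge> k" for i
      using hge[OF that, of p] h3[of i p] k by simp
    then show "\<exists>no. \<forall>n\<ge>no. norm (h n p - H p) < d" by blast
  qed
  show thesis by (rule that[OF h1 h2 h3 h4])
qed

definition averages :: "(nat \<Rightarrow> 'a) \<Rightarrow> ('a \<Rightarrow> real) \<Rightarrow> nat \<Rightarrow> real"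
  where "averages a h n = (\<Sum>k<n. h (a k)) / real n"

lemma averages_mono: "(\<And>p. h p \<le> H p) \<Longrightarrow> averages a h n \<le> averages a H n"
  by (auto simp: averages_def intro!: divide_right_mono sum_mono)

lemma averages_affine: "n > 0 \<Longrightarrow> averages a (\<lambda>p. r + c * H p) n = r + c * averages a H n"
  by (simp add: averages_def sum.distrib sum_distrib_left field_simps)

text \<open>Almost sure convergence of averages is proved for one test function at a time. Countability of the
family allows one null set to serve all test functions, and hence all
bounded continuous functions, because the averages of \<open>H\<close> and of \<open>- H\<close> are bounded below by those of
test functions that increase to them, up to constants.\<close>

lemma countable_test_functions:
  obtains \<H> :: "('a::{metric_space,second_countable_topology} \<Rightarrow> real) set"
  where "countable \<H>" "\<And>h. h \<in> \<H> \<Longrightarrow> \<exists>K. \<forall>p q. \<bar>h p - h q\<bar> \<le> K * dist p q"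
    "\<And>\<nu> a H. prob_space \<nu> \<Longrightarrow> sets \<nu> = sets borel \<Longrightarrow>
       (\<And>h. h \<in> \<H> \<Longrightarrow> averages a h \<longlonglongrightarrow> integral\<^sup>L \<nu> h) \<Longrightarrow>
       continuous_on UNIV H \<Longrightarrow> bounded (range H) \<Longrightarrow> averages a H \<longlonglongrightarrow> integral\<^sup>L \<nu> H"
proof -
  obtain B :: "'a set set" where B: "countable B" "topological_basis B"
    using ex_countable_basis by blast
  let ?G = "(\<lambda>(q, U, j) p. q * open_ramp U j p) ` ((\<rat> \<inter> {0..}) \<times> B \<times> (UNIV :: nat set))"
  have "countable ?G"
    using B by (intro countable_image countable_SIGMA) (auto simp: countable_rat)
  then have c: "countable (max_combs ?G)" by (rule countable_max_combs)
  have LG: "\<exists>K. \<forall>p q. \<bar>g p - g q\<bar> \<le> K * dist p q" if gG: "g \<in> ?G" for g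
  proof -
    obtain r U j where g: "g = (\<lambda>p. r * open_ramp U j p)" using gG by auto
    have "\<bar>g p - g q\<bar> \<le> (\<bar>r\<bar> * real j) * dist p q" for p q
      using mult_left_mono[OF open_ramp_lipschitz[of U j p q], of "\<bar>r\<bar>"]
      by (simp add: g abs_mult mult.assoc flip: right_diff_distrib)
    then show ?thesis by blast
  qed
  have L: "\<exists>K. \<forall>p q. \<bar>h p - h q\<bar> \<le> K * dist p q" if "h \<in> max_combs ?G" for h
  proof -
    obtain S where S: "h = (\<lambda>p. Max ((\<lambda>g. g p) ` S))" "finite S" "S \<noteq> {}" "S \<subseteq> ?G"
      using \<open>h \<in> max_combs ?G\<close> unfolding max_combs_def by blast
    show ?thesis unfolding S(1)
      by (rule max_combs_lipschitz[OF S(2,3)]) (use S(4) LG in blast)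
  qed
  show thesis
  proof (rule that[OF c L])
    fix \<nu> :: "'a measure" and a :: "nat \<Rightarrow> 'a" and H :: "'a \<Rightarrow> real"
    assume \<nu>: "prob_space \<nu>" "sets \<nu> = sets borel"
      and conv: "\<And>h. h \<in> max_combs ?G \<Longrightarrow> averages a h \<longlonglongrightarrow> integral\<^sup>L \<nu> h"
      and H: "continuous_on UNIV H" "bounded (range H)"
    interpret \<nu>: prob_space \<nu> by fact
    have meas: "f \<in> borel_measurable \<nu>" if "continuous_on UNIV f" for f :: "'a \<Rightarrow> real"
      using borel_measurable_continuous_onI[OF that] by (simp cong: measurable_cong_sets add: \<nu>)
    have lower: "eventually (\<lambda>n. averages a H n > integral\<^sup>L \<nu> H - e) sequentially"
      if H: "continuous_on UNIV H" "\<And>p. 0 \<le> H p" "\<And>p. H p \<le> b" and e: "e > 0" for H :: "'a \<Rightarrow> real" and b e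
    proof -
      obtain h where h: "\<And>i. h i \<in> max_combs ?G" "\<And>i p. 0 \<le> h i p" "\<And>i p. h i p \<le> H p"
          "\<And>p. (\<lambda>i. h i p) \<longlonglongrightarrow> H p"
        using continuous_as_max_limit[OF B(2,1) H(1,2)] by metis
      have hc: "continuous_on UNIV (h i)" for i
        using L[OF h(1)[of i]] lipschitz_continuous by blast
      have "(\<lambda>i. integral\<^sup>L \<nu> (h i)) \<longlonglongrightarrow> integral\<^sup>L \<nu> H"
      proof (rule integral_dominated_convergence[where w = "\<lambda>_. b"])
        show "AE x in \<nu>. norm (h i x) \<le> b" for i
        proof (rule AE_I2)
          fix x show "norm (h i x) \<le> b" using h(2)[of i x] h(3)[of i x] H(3)[of x] by simp
        qed
      qed (auto simp: meas H hc h)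
      then have "eventually (\<lambda>i. integral\<^sup>L \<nu> (h i) > integral\<^sup>L \<nu> H - e) sequentially"
        using e by (intro order_tendstoD(1)) auto
      then obtain i where i: "integral\<^sup>L \<nu> (h i) > integral\<^sup>L \<nu> H - e"
        by (auto simp: eventually_sequentially)
      have "eventually (\<lambda>n. averages a (h i) n > integral\<^sup>L \<nu> H - e) sequentially"
        by (rule order_tendstoD(1)[OF conv[OF h(1)] i])
      then show ?thesis
        by eventually_elim (rule less_le_trans[OF _ averages_mono[OF h(3)]])
    qed
    obtain b where "\<forall>y\<in>range H. norm y \<le> b" using H(2) unfolding bounded_iff by blast
    then have b: "\<bar>H p\<bar> \<le> b" for p by simp
    have Hint: "integrable \<nu> H"
      using b by (intro \<nu>.integrable_const_bound[where B = b] meas H) auto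
    show "averages a H \<longlonglongrightarrow> integral\<^sup>L \<nu> H"
    proof (rule LIMSEQ_I)
      fix e :: real assume e: "e > 0"
      have ev: "eventually (\<lambda>n. averages a (\<lambda>p. b + c * H p) n > integral\<^sup>L \<nu> (\<lambda>p. b + c * H p) - e) sequentially"
        if c: "\<bar>c\<bar> = 1" for c
      proof (rule lower)
        have "\<bar>c * H p\<bar> \<le> b" for p using b[of p] c by (simp add: abs_mult)
        from this[THEN abs_le_D1] this[THEN abs_le_D2]
        show "0 \<le> b + c * H p" "b + c * H p \<le> 2 * b" for p
          by (smt (verit))+
      qed (use H e in \<open>auto intro!: continuous_intros\<close>)
      have "eventually (\<lambda>n. averages a (\<lambda>p. b + 1 * H p) n > integral\<^sup>L \<nu> (\<lambda>p. b + 1 * H p) - e) sequentially"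
        by (rule ev) simp
      moreover have "eventually (\<lambda>n. averages a (\<lambda>p. b + (-1) * H p) n > integral\<^sup>L \<nu> (\<lambda>p. b + (-1) * H p) - e) sequentially"
        by (rule ev) simp
      moreover note eventually_gt_at_top[of "0 :: nat"]
      ultimately have "eventually (\<lambda>n. \<bar>averages a H n - integral\<^sup>L \<nu> H\<bar> < e) sequentially"
      proof eventually_elim
        case (elim n)
        have "integral\<^sup>L \<nu> (\<lambda>p. b + c * H p) = b + c * integral\<^sup>L \<nu> H" for c
        using Hint \<nu>.prob_space by simp
        note E = this
        show ?case
          using elim(1,2) E[of 1] E[of "-1"] averages_affine[OF elim(3), of a b 1 H]
            averages_affine[OF elim(3), of a b "-1" H] by linarith
      qed
      then show "\<exists>no. \<forall>n\<ge>no. norm (averages a H n - integral\<^sup>L \<nu> H) < e"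
        by (simp add: eventually_sequentially)
    qed
  qed
qed

section \<open>Fundamental domains of the integer lattice\<close>

definition unit_cube :: "(real^'n) set"
  where "unit_cube = {x. \<forall>i. 0 \<le> x $ i \<and> x $ i < 1}"

definition fundamental_domain :: "(real^'n) set \<Rightarrow> bool"
  where "fundamental_domain Q \<longleftrightarrow> Q \<in> sets borel \<and> (\<forall>x. \<exists>!w. w \<in> int_vectors \<and> x + w \<in> Q)"

lemma countable_int_vectors: "countable (int_vectors :: (real^'n) set)"
proof -
  let ?f = "\<lambda>g :: 'n \<Rightarrow> int. (\<chi> i. of_int (g i)) :: real^'n"
  have "int_vectors \<subseteq> range ?f"
  proof
    fix v :: "real^'n" assume "v \<in> int_vectors"
    then have "\<forall>i. \<exists>k. v $ i = of_int k" by (auto simp: int_vectors_def Ints_def)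
    then obtain g where "\<And>i. v $ i = of_int (g i)" by metis
    then have "v = ?f g" by (simp add: vec_eq_iff)
    then show "v \<in> range ?f" by blast
  qed
  moreover have "countable (UNIV :: ('n \<Rightarrow> int) set)"
    by (rule countableI_type)
  ultimately show ?thesis by (meson countable_image countable_subset)
qed

lemma nn_integral_lborel_shift:
  fixes f :: "'a::euclidean_space \<Rightarrow> ennreal"
  assumes [measurable]: "f \<in> borel_measurable borel"
  shows "(\<integral>\<^sup>+x. f (w + x) \<partial>lborel) = (\<integral>\<^sup>+x. f x \<partial>lborel)"
proof -
  have "(\<integral>\<^sup>+x. f x \<partial>lborel) = (\<integral>\<^sup>+x. f x \<partial>distr lborel borel ((+) w))"
    by (simp add: lborel_distr_plus)
  also have "\<dots> = (\<integral>\<^sup>+x. f (w + x) \<partial>lborel)"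
    by (subst nn_integral_distr) auto
  finally show ?thesis by simp
qed

text \<open>Insert \<open>1 = (\<Sum>w. indicator R (x + w))\<close> into the integral over \<open>Q\<close>, translate by \<open>- w\<close> in each
summand, and sum up the translates of \<open>Q\<close> again.\<close>

lemma nn_integral_fundamental_domain:
  fixes K :: "real^'n \<Rightarrow> ennreal"
  assumes Q: "fundamental_domain Q" and R: "fundamental_domain R"
    and [measurable]: "K \<in> borel_measurable borel"
    and per: "\<And>x w. w \<in> int_vectors \<Longrightarrow> K (x + w) = K x"
  shows "(\<integral>\<^sup>+x. K x * indicator Q x \<partial>lborel) = (\<integral>\<^sup>+x. K x * indicator R x \<partial>lborel)"
proof -
  let ?Z = "count_space (int_vectors :: (real^'n) set)"
  have [measurable]: "Q \<in> sets borel" "R \<in> sets borel" using Q R by (auto simp: fundamental_domain_def)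
  interpret Z: sigma_finite_measure ?Z
    by (rule sigma_finite_measure_count_space_countable[OF countable_int_vectors])
  interpret P: pair_sigma_finite ?Z lborel ..
  have one: "(\<integral>\<^sup>+w. indicator S (x + w) \<partial>?Z) = (1::ennreal)" if "fundamental_domain S" for S and x :: "real^'n"
  proof -
    note fd = that
    obtain w0 where w0: "w0 \<in> int_vectors" "x + w0 \<in> S" "\<And>w. w \<in> int_vectors \<Longrightarrow> x + w \<in> S \<Longrightarrow> w = w0"
    proof -
      have "\<exists>!w. w \<in> int_vectors \<and> x + w \<in> S" using fd by (simp add: fundamental_domain_def)
      then show thesis using that by (elim ex1E) blast
    qed
    have "(\<integral>\<^sup>+w. indicator S (x + w) \<partial>?Z) = (\<integral>\<^sup>+w. indicator {w0} w \<partial>?Z)"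
      using w0(1,2) by (intro nn_integral_cong) (auto split: split_indicator dest: w0(3))
    also have "\<dots> = 1" using w0(1) by simp
    finally show ?thesis .
  qed
  have meas: "(\<lambda>(w, x). K x * indicator S x * indicator T (x + w)) \<in> borel_measurable (?Z \<Otimes>\<^sub>M lborel)"
    if [measurable]: "S \<in> sets borel" "T \<in> sets borel" for S T
    by (intro measurable_pair_measure_countable1 countable_int_vectors) simp
  have "(\<integral>\<^sup>+x. K x * indicator Q x \<partial>lborel) = (\<integral>\<^sup>+x. (\<integral>\<^sup>+w. K x * indicator Q x * indicator R (x + w) \<partial>?Z) \<partial>lborel)"
    by (simp add: nn_integral_cmult one[OF R])
  also have "\<dots> = (\<integral>\<^sup>+w. (\<integral>\<^sup>+x. K x * indicator Q x * indicator R (x + w) \<partial>lborel) \<partial>?Z)"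
    by (rule P.Fubini') (rule meas; simp)
  also have "\<dots> = (\<integral>\<^sup>+w. (\<integral>\<^sup>+x. K x * indicator Q (x - w) * indicator R x \<partial>lborel) \<partial>?Z)"
  proof (rule nn_integral_cong)
    fix w :: "real^'n" assume "w \<in> space ?Z"
    then have w: "w \<in> int_vectors" "- w \<in> int_vectors" by (auto intro: int_vectors_minus)
    have "(\<integral>\<^sup>+x. K x * indicator Q x * indicator R (x + w) \<partial>lborel) =
      (\<integral>\<^sup>+x. K (- w + x) * indicator Q (- w + x) * indicator R (- w + x + w) \<partial>lborel)"
      by (subst nn_integral_lborel_shift[where w = "- w"]) auto
    also have "\<dots> = (\<integral>\<^sup>+x. K x * indicator Q (x - w) * indicator R x \<partial>lborel)"
      using per[OF w(2)] by (intro nn_integral_cong) (simp add: add.commute)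
    finally show "(\<integral>\<^sup>+x. K x * indicator Q x * indicator R (x + w) \<partial>lborel) =
      (\<integral>\<^sup>+x. K x * indicator Q (x - w) * indicator R x \<partial>lborel)" .
  qed
  also have "\<dots> = (\<integral>\<^sup>+w. (\<integral>\<^sup>+x. K x * indicator R x * indicator Q (x + - w) \<partial>lborel) \<partial>?Z)"
    by (simp add: ac_simps)
  also have "\<dots> = (\<integral>\<^sup>+x. (\<integral>\<^sup>+w. K x * indicator R x * indicator Q (x + - w) \<partial>?Z) \<partial>lborel)"
    by (rule P.Fubini'[symmetric]) (intro measurable_pair_measure_countable1 countable_int_vectors; simp)
  also have "\<dots> = (\<integral>\<^sup>+x. K x * indicator R x \<partial>lborel)"
  proof (rule nn_integral_cong)
    fix x :: "real^'n"
    have "(\<integral>\<^sup>+w. indicator Q (x + - w) \<partial>?Z) = (\<integral>\<^sup>+w. indicator Q (x + w) \<partial>?Z)"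
      by (rule nn_integral_bij_count_space[where g = uminus])
        (auto intro!: bij_betwI[where g = uminus] int_vectors_minus)
    then have "(\<integral>\<^sup>+w. indicator Q (x + - w) \<partial>?Z) = 1" using one[OF Q] by simp
    then show "(\<integral>\<^sup>+w. K x * indicator R x * indicator Q (x + - w) \<partial>?Z) = K x * indicator R x"
      by (subst nn_integral_cmult) auto
  qed
  finally show ?thesis .
qed

lemma unique_int_scaled:
  fixes a :: real and c :: int
  assumes "c \<noteq> 0"
  shows "\<exists>!w::int. 0 \<le> of_int c * (a + of_int w) \<and> of_int c * (a + of_int w) < \<bar>of_int c\<bar>"
proof (cases "c > 0")
  case True
  have "0 \<le> of_int c * (a + of_int w) \<and> of_int c * (a + of_int w) < \<bar>of_int c\<bar> \<longleftrightarrow> w = - \<lfloor>a\<rfloor>" for w :: int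
  proof -
    have "0 \<le> of_int c * (a + of_int w) \<longleftrightarrow> 0 \<le> a + of_int w" using True by (simp add: zero_le_mult_iff)
    moreover have "of_int c * (a + of_int w) < \<bar>of_int c\<bar> \<longleftrightarrow> a + of_int w < 1"
      using True mult_less_cancel_left_pos[of "of_int c" "a + of_int w" 1] by simp
    moreover have "0 \<le> a + of_int w \<and> a + of_int w < 1 \<longleftrightarrow> w = - \<lfloor>a\<rfloor>" by linarith
    ultimately show ?thesis by simp
  qed
  then show ?thesis by simp
next
  case False
  then have neg: "of_int c < (0::real)" using assms by simp
  have "0 \<le> of_int c * (a + of_int w) \<and> of_int c * (a + of_int w) < \<bar>of_int c\<bar> \<longleftrightarrow> w = \<lfloor>- a\<rfloor>" for w :: int
  proof -
    have "0 \<le> of_int c * (a + of_int w) \<longleftrightarrow> a + of_int w \<le> 0" using neg by (simp add: zero_le_mult_iff)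
    moreover have "of_int c * (a + of_int w) < \<bar>of_int c\<bar> \<longleftrightarrow> a + of_int w > - 1"
      using neg mult_less_cancel_left_neg[of "of_int c" "a + of_int w" "- 1"] by simp
    moreover have "a + of_int w \<le> 0 \<and> a + of_int w > - 1 \<longleftrightarrow> w = \<lfloor>- a\<rfloor>" by linarith
    ultimately show ?thesis by simp
  qed
  then show ?thesis by simp
qed

text \<open>The preimage of the box \<open>[0, \<bar>c\<bar>)\<close> under multiplication by \<open>c\<close>: the unit cube if \<open>c > 0\<close>, and
its reflection at the origin if \<open>c < 0\<close>.\<close>

lemma fundamental_domain_scaled:
  assumes "c \<noteq> 0"
  shows "fundamental_domain {x :: real^'n. \<forall>i. 0 \<le> of_int c * x $ i \<and> of_int c * x $ i < \<bar>of_int c\<bar>}"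
  (is "fundamental_domain ?Q")
  unfolding fundamental_domain_def
proof (intro conjI allI)
  show "?Q \<in> sets borel" by measurable
next
  fix x :: "real^'n"
  obtain g :: "'n \<Rightarrow> int" where g: "\<And>i. 0 \<le> of_int c * (x $ i + of_int (g i)) \<and> of_int c * (x $ i + of_int (g i)) < \<bar>of_int c\<bar>"
      "\<And>i k. 0 \<le> of_int c * (x $ i + of_int k) \<and> of_int c * (x $ i + of_int k) < \<bar>of_int c\<bar> \<Longrightarrow> k = g i"
  proof -
    have "\<forall>i. \<exists>w. (0 \<le> of_int c * (x $ i + of_int w) \<and> of_int c * (x $ i + of_int w) < \<bar>of_int c\<bar>) \<and>
      (\<forall>k. 0 \<le> of_int c * (x $ i + of_int k) \<and> of_int c * (x $ i + of_int k) < \<bar>of_int c\<bar> \<longrightarrow> k = w)"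
      using unique_int_scaled[OF assms] unfolding Ex1_def by blast
    from choice[OF this] show thesis using that by blast
  qed
  show "\<exists>!w. w \<in> int_vectors \<and> x + w \<in> ?Q"
  proof (rule ex1I[of _ "\<chi> i. of_int (g i)"])
    show "(\<chi> i. of_int (g i)) \<in> int_vectors \<and> x + (\<chi> i. of_int (g i)) \<in> ?Q"
      using g(1) by (simp add: int_vectors_def)
  next
    fix w assume w: "w \<in> int_vectors \<and> x + w \<in> ?Q"
    then have "\<forall>i. \<exists>k. w $ i = of_int k" by (auto simp: int_vectors_def Ints_def)
    then obtain h where h: "\<And>i. w $ i = of_int (h i)" by metis
    have "h i = g i" for i using w g(2)[of i "h i"] by (simp add: h)
    then show "w = (\<chi> i. of_int (g i))" by (simp add: vec_eq_iff h)
  qed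
qed

lemma fundamental_domain_unit_cube: "fundamental_domain unit_cube"
  using fundamental_domain_scaled[of 1] by (simp add: unit_cube_def)

lemma sets_unit_cube [measurable]: "unit_cube \<in> sets borel"
  by (rule conjunct1[OF fundamental_domain_unit_cube[unfolded fundamental_domain_def]])

definition cube_measure :: "(real^'n) measure"
  where "cube_measure = density lborel (indicator unit_cube)"

lemma sets_cube_measure [simp, measurable_cong]: "sets cube_measure = sets borel"
  by (simp add: cube_measure_def)

lemma space_cube_measure [simp]: "space cube_measure = UNIV"
  by (simp add: cube_measure_def)

lemma nn_integral_cube:
  "f \<in> borel_measurable borel \<Longrightarrow>
    (\<integral>\<^sup>+x. f x \<partial>cube_measure) = (\<integral>\<^sup>+x. f x * indicator unit_cube x \<partial>lborel)"
  unfolding cube_measure_def by (subst nn_integral_density) (simp_all add: mult.commute)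

lemma prob_space_cube: "prob_space (cube_measure :: (real^'n) measure)"
proof
  have "emeasure lborel (unit_cube :: (real^'n) set) = 1"
  proof (rule antisym)
    have "emeasure lborel (unit_cube :: (real^'n) set) \<le> emeasure lborel (cbox 0 (1 :: real^'n))"
      by (intro emeasure_mono) (auto simp: unit_cube_def mem_box_cart less_imp_le)
    also have "\<dots> = 1"
      by (subst emeasure_lborel_cbox) (auto simp: inner_axis Basis_vec_def intro!: prod.neutral)
    finally show "emeasure lborel (unit_cube :: (real^'n) set) \<le> 1" .
    have "1 = emeasure lborel (box 0 (1 :: real^'n))"
      by (subst emeasure_lborel_box) (auto simp: inner_axis Basis_vec_def intro!: prod.neutral)
    also have "\<dots> \<le> emeasure lborel (unit_cube :: (real^'n) set)"
      by (intro emeasure_mono) (auto simp: unit_cube_def mem_box_cart less_imp_le)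
    finally show "1 \<le> emeasure lborel (unit_cube :: (real^'n) set)" .
  qed
  then show "emeasure (cube_measure :: (real^'n) measure) (space cube_measure) = 1"
    by (simp add: cube_measure_def emeasure_density)
qed

lemma measurable_abs_torus [measurable]: "abs_torus \<in> borel_measurable borel"
  by (intro borel_measurable_continuous_onI continuous_on_abs_torus)

lemma torus_measure_cube: "torus_measure = distr cube_measure borel (abs_torus :: real^'n \<Rightarrow> 'n torus)"
proof (rule measure_eqI)
  fix A :: "'n torus set" assume "A \<in> sets torus_measure"
  then have [measurable]: "A \<in> sets borel" by (simp add: torus_measure_def)
  have [measurable]: "(abs_torus :: real^'n \<Rightarrow> 'n torus) \<in> measurable (restrict_space lborel unit_cube) borel"
    by (rule measurable_restrict_space1) simp
  have [measurable]: "(abs_torus -` A :: (real^'n) set) \<in> sets borel"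
    using measurable_sets[OF measurable_abs_torus, of A] by simp
  have "emeasure torus_measure A = emeasure (restrict_space lborel unit_cube) (abs_torus -` A \<inter> unit_cube)"
    unfolding torus_measure_def unit_cube_def[symmetric]
    by (subst emeasure_distr) (auto simp: space_restrict_space)
  also have "\<dots> = emeasure lborel (abs_torus -` A \<inter> (unit_cube :: (real^'n) set))"
    by (subst emeasure_restrict_space) auto
  also have "\<dots> = emeasure (distr cube_measure borel abs_torus) A"
    by (subst emeasure_distr) (auto simp: cube_measure_def emeasure_restricted Int_commute)
  finally show "emeasure torus_measure A = emeasure (distr cube_measure borel abs_torus) A" .
qed (simp add: torus_measure_def)

lemma prob_space_torus: "prob_space torus_measure"
  unfolding torus_measure_cube
  by (rule prob_space.prob_space_distr[OF prob_space_cube]) simp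

lemma sets_torus_measure [simp, measurable_cong]: "sets torus_measure = sets borel"
  by (simp add: torus_measure_cube)

section \<open>Digits and random preorbits\<close>

text \<open>The vectors \<open>v\<close> in this set number the preimages \<open>(x + v) / c\<close> of the torus point \<open>x\<close>.\<close>

definition digits :: "int \<Rightarrow> (real^'n) set"
  where "digits c = {v. \<forall>i. \<exists>k::int. 0 \<le> k \<and> k < \<bar>c\<bar> \<and> v $ i = of_int k}"

lemma digits_int_vectors: "digits c \<subseteq> int_vectors"
  by (auto simp: digits_def int_vectors_def) (metis Ints_of_int)

lemma digits_image: "digits c = (\<lambda>g. (\<chi> i. of_int (g i)) :: real^'n) ` (UNIV \<rightarrow>\<^sub>E {0..<\<bar>c\<bar>})"
proof (intro set_eqI iffI)
  fix v :: "real^'n" assume "v \<in> digits c"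
  then have "\<forall>i. \<exists>k::int. 0 \<le> k \<and> k < \<bar>c\<bar> \<and> v $ i = of_int k" by (simp add: digits_def)
  from choice[OF this] obtain g where g: "\<And>i. 0 \<le> g i \<and> g i < \<bar>c\<bar> \<and> v $ i = of_int (g i)"
    by blast
  then show "v \<in> (\<lambda>g. (\<chi> i. of_int (g i)) :: real^'n) ` (UNIV \<rightarrow>\<^sub>E {0..<\<bar>c\<bar>})"
    by (intro image_eqI[of _ _ g]) (auto simp: vec_eq_iff)
qed (auto simp: digits_def PiE_iff)

lemma finite_digits: "finite (digits c :: (real^'n) set)"
  unfolding digits_image by (intro finite_imageI finite_PiE) auto

lemma card_digits: "card (digits c :: (real^'n) set) = nat \<bar>c\<bar> ^ CARD('n)"
proof -
  have inj: "inj (\<lambda>g :: 'n \<Rightarrow> int. (\<chi> i. of_int (g i)) :: real^'n)"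
    by (rule injI) (simp add: vec_eq_iff fun_eq_iff)
  have "card ((UNIV :: 'n set) \<rightarrow>\<^sub>E {0..<\<bar>c\<bar>}) = nat \<bar>c\<bar> ^ CARD('n)"
    by (subst card_PiE) simp_all
  then show ?thesis
    unfolding digits_image by (subst card_image[OF inj_on_subset[OF inj]]) simp_all
qed

lemma zero_in_digits: "c \<noteq> 0 \<Longrightarrow> 0 \<in> digits c"
  by (auto simp: digits_def intro!: exI[of _ 0])

lemma digits_nonempty: "c \<noteq> 0 \<Longrightarrow> digits c \<noteq> {}"
  using zero_in_digits by blast

text \<open>Preorbits are lifted from the torus to the vector space: there they depend continuously on the point
and the digits, and affinely on the point, with slope \<open>c ^ (- n)\<close> after \<open>n\<close> steps.\<close>

primrec preorbit :: "int \<Rightarrow> real^'n \<Rightarrow> (nat \<Rightarrow> real^'n) \<Rightarrow> nat \<Rightarrow> real^'n"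
  where
    "preorbit c x \<omega> 0 = x"
  | "preorbit c x \<omega> (Suc n) = inverse (of_int c) *\<^sub>R (preorbit c x \<omega> n + \<omega> n)"

definition digit_space :: "int \<Rightarrow> (nat \<Rightarrow> real^'n) measure"
  where "digit_space c = (\<Pi>\<^sub>M i\<in>UNIV. measure_pmf (pmf_of_set (digits c)))"

lemma preorbit_shift:
  "preorbit c x \<omega> (n + k) = preorbit c (preorbit c x \<omega> n) (\<lambda>i. \<omega> (n + i)) k"
  by (induction k) auto

lemma preorbit_Suc_front:
  "preorbit c x (case_nat v \<omega>) (Suc n) = preorbit c (inverse (of_int c) *\<^sub>R (x + v)) \<omega> n"
  using preorbit_shift[of c x "case_nat v \<omega>" 1 n] by simp

lemma sequence_space_digits: "sequence_space (measure_pmf (pmf_of_set (digits c)))"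
  by (intro sequence_space.intro product_prob_space.intro product_prob_space_axioms.intro
      product_sigma_finite.intro prob_space_measure_pmf
      finite_measure.sigma_finite_measure prob_space.finite_measure)

lemma prob_space_digits: "prob_space (digit_space c)"
  unfolding digit_space_def by (intro prob_space_PiM prob_space_measure_pmf)

lemma measurable_digit:
  "(\<lambda>\<omega>. \<omega> n) \<in> measurable (digit_space c) (borel :: (real^'n) measure)"
proof -
  have "(\<lambda>\<omega>. \<omega> n) \<in> measurable (digit_space c) (measure_pmf (pmf_of_set (digits c :: (real^'n) set)))"
    unfolding digit_space_def by (rule measurable_component_singleton) simp
  moreover have "(\<lambda>v. v) \<in> measurable (measure_pmf (pmf_of_set (digits c :: (real^'n) set))) borel"
    by simp
  ultimately show ?thesis by (rule measurable_compose)
qed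

lemma AE_digits:
  assumes "c \<noteq> 0"
  shows "AE \<omega> in digit_space c. \<forall>n. \<omega> n \<in> (digits c :: (real^'n) set)"
  unfolding AE_all_countable
proof
  fix n :: nat
  have "AE v in measure_pmf (pmf_of_set (digits c)). v \<in> (digits c :: (real^'n) set)"
    using assms by (simp add: AE_measure_pmf_iff set_pmf_of_set finite_digits digits_nonempty)
  then show "AE \<omega> in digit_space c. \<omega> n \<in> (digits c :: (real^'n) set)"
    unfolding digit_space_def by (intro AE_PiM_component prob_space_measure_pmf) auto
qed

text \<open>The first digit is independent of the later ones, which have the same law as all digits.\<close>

lemma nn_integral_digit_space_Suc:
  fixes G :: "(nat \<Rightarrow> real^'n) \<Rightarrow> ennreal"
  assumes c: "c \<noteq> 0" and "G \<in> borel_measurable (digit_space c)"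
  shows "(\<integral>\<^sup>+\<omega>. G \<omega> \<partial>digit_space c) =
    (\<Sum>v\<in>digits c. \<integral>\<^sup>+\<omega>. G (case_nat v \<omega>) \<partial>digit_space c) / of_nat (card (digits c :: (real^'n) set))"
proof -
  let ?M = "measure_pmf (pmf_of_set (digits c :: (real^'n) set))"
  interpret S: sequence_space ?M by (rule sequence_space_digits)
  have G: "G \<in> borel_measurable S.S" using assms(2) by (simp add: digit_space_def)
  have cn: "(\<lambda>(s, \<omega>). case_nat s \<omega>) \<in> measurable (?M \<Otimes>\<^sub>M S.S) S.S" by measurable
  have Gc: "(\<lambda>z. G (case z of (s, \<omega>) \<Rightarrow> case_nat s \<omega>)) \<in> borel_measurable (?M \<Otimes>\<^sub>M S.S)"
    using measurable_compose[OF cn G] .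
  have "(\<integral>\<^sup>+\<omega>. G \<omega> \<partial>S.S) = (\<integral>\<^sup>+\<omega>. G \<omega> \<partial>distr (?M \<Otimes>\<^sub>M S.S) S.S (\<lambda>(s, \<omega>). case_nat s \<omega>))"
    by (simp only: S.PiM_iter)
  also have "\<dots> = (\<integral>\<^sup>+z. G (case z of (s, \<omega>) \<Rightarrow> case_nat s \<omega>) \<partial>(?M \<Otimes>\<^sub>M S.S))"
    by (rule nn_integral_distr[OF cn]) (use G in simp)
  also have "\<dots> = (\<integral>\<^sup>+v. (\<integral>\<^sup>+\<omega>. G (case_nat v \<omega>) \<partial>S.S) \<partial>?M)"
    by (subst S.P.nn_integral_fst[symmetric, OF Gc]) simp
  also have "\<dots> = (\<Sum>v\<in>digits c. \<integral>\<^sup>+\<omega>. G (case_nat v \<omega>) \<partial>S.S) / of_nat (card (digits c :: (real^'n) set))"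
    by (subst nn_integral_pmf_of_set[OF digits_nonempty[OF c] finite_digits]) simp
  finally show ?thesis by (simp add: digit_space_def)
qed

lemma measurable_preorbit [measurable]:
  "(\<lambda>(x, \<omega>). preorbit c x \<omega> n) \<in> measurable (borel \<Otimes>\<^sub>M digit_space c) (borel :: (real^'n) measure)"
proof (induction n)
  case (Suc n)
  have "(\<lambda>z. snd z n) \<in> measurable (borel \<Otimes>\<^sub>M digit_space c) (borel :: (real^'n) measure)"
    by (rule measurable_compose[OF measurable_snd measurable_digit])
  then show ?case using Suc unfolding preorbit.simps split_beta'
    by (intro borel_measurable_scaleR borel_measurable_add borel_measurable_const)
qed (simp add: split_beta')

text \<open>Shifting the point by a lattice vector only permutes its preimages, because the digits represent the
residues modulo \<open>c\<close>.\<close>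

lemma sum_digits_periodic:
  fixes K :: "real^'n \<Rightarrow> 'b::comm_monoid_add"
  assumes c: "c \<noteq> 0" and w: "w \<in> int_vectors"
    and per: "\<And>x w. w \<in> int_vectors \<Longrightarrow> K (x + w) = K x"
  shows "(\<Sum>v\<in>digits c. K (inverse (of_int c) *\<^sub>R (x + w + v))) =
    (\<Sum>v\<in>digits c. K (inverse (of_int c) *\<^sub>R (x + v)))"
proof -
  define r :: "real^'n \<Rightarrow> real^'n" where "r v = (\<chi> i. of_int ((\<lfloor>v $ i\<rfloor> + \<lfloor>w $ i\<rfloor>) mod \<bar>c\<bar>))" for v
  have r_dig: "r v \<in> digits c" for v
    using c by (auto simp: r_def digits_def intro!: exI[of _ "(_ + _) mod \<bar>c\<bar>"])
  have fl: "of_int \<lfloor>w $ i\<rfloor> = w $ i" for i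
    using w by (simp add: int_vectors_def)
  have fld: "of_int \<lfloor>v $ i\<rfloor> = v $ i" "0 \<le> \<lfloor>v $ i\<rfloor>" "\<lfloor>v $ i\<rfloor> < \<bar>c\<bar>" if vd: "v \<in> digits c" for v :: "real^'n" and i
  proof -
    obtain k :: int where "0 \<le> k" "k < \<bar>c\<bar>" "v $ i = of_int k"
      using vd by (auto simp: digits_def)
    then show "of_int \<lfloor>v $ i\<rfloor> = v $ i" "0 \<le> \<lfloor>v $ i\<rfloor>" "\<lfloor>v $ i\<rfloor> < \<bar>c\<bar>" by simp_all
  qed
  have diff: "inverse (of_int c) *\<^sub>R (w + v - r v) \<in> int_vectors" if v: "v \<in> digits c" for v
    unfolding int_vectors_def
  proof (intro CollectI allI)
    fix i
    let ?k = "\<lfloor>v $ i\<rfloor> + \<lfloor>w $ i\<rfloor>"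
    have "c dvd ?k - ?k mod \<bar>c\<bar>" by (metis abs_dvd_iff dvd_minus_mod)
    then obtain q where q: "?k - ?k mod \<bar>c\<bar> = c * q" by (elim dvdE)
    have "(w + v - r v) $ i = of_int (?k - ?k mod \<bar>c\<bar>)"
      unfolding of_int_diff of_int_add fl fld(1)[OF v] by (simp add: r_def)
    then have "(inverse (of_int c) *\<^sub>R (w + v - r v)) $ i = of_int q"
      using c unfolding q by simp
    then show "(inverse (of_int c) *\<^sub>R (w + v - r v)) $ i \<in> \<int>" by simp
  qed
  have inj: "inj_on r (digits c)"
  proof (rule inj_onI)
    fix v v' assume vv: "v \<in> digits c" "v' \<in> digits c" "r v = r v'"
    have "v $ i = v' $ i" for i
    proof -
      have "of_int ((\<lfloor>v $ i\<rfloor> + \<lfloor>w $ i\<rfloor>) mod \<bar>c\<bar>) = (of_int ((\<lfloor>v' $ i\<rfloor> + \<lfloor>w $ i\<rfloor>) mod \<bar>c\<bar>) :: real)"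
        using vv(3) by (simp add: r_def vec_eq_iff)
      then have "\<bar>c\<bar> dvd (\<lfloor>v $ i\<rfloor> + \<lfloor>w $ i\<rfloor>) - (\<lfloor>v' $ i\<rfloor> + \<lfloor>w $ i\<rfloor>)"
        using mod_eq_dvd_iff by (metis of_int_eq_iff)
      then have "\<bar>c\<bar> dvd \<lfloor>v $ i\<rfloor> - \<lfloor>v' $ i\<rfloor>" by simp
      moreover have "\<bar>\<lfloor>v $ i\<rfloor> - \<lfloor>v' $ i\<rfloor>\<bar> < \<bar>c\<bar>"
        using fld(2,3)[OF vv(1), of i] fld(2,3)[OF vv(2), of i] by linarith
      ultimately have "\<lfloor>v $ i\<rfloor> = \<lfloor>v' $ i\<rfloor>"
        using dvd_imp_le_int[of "\<lfloor>v $ i\<rfloor> - \<lfloor>v' $ i\<rfloor>" "\<bar>c\<bar>"] by linarith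
      then have "(of_int \<lfloor>v $ i\<rfloor> :: real) = of_int \<lfloor>v' $ i\<rfloor>" by (rule arg_cong)
      then show ?thesis unfolding fld(1)[OF vv(1), of i] fld(1)[OF vv(2), of i] .
    qed
    then show "v = v'" unfolding vec_eq_iff by blast
  qed
  have img: "r ` digits c = digits c"
    by (rule endo_inj_surj[OF finite_digits _ inj]) (use r_dig in blast)
  have "(\<Sum>v\<in>digits c. K (inverse (of_int c) *\<^sub>R (x + w + v))) =
    (\<Sum>v\<in>digits c. K (inverse (of_int c) *\<^sub>R (x + r v)))"
  proof (rule sum.cong)
    fix v :: "real^'n" assume v: "v \<in> digits c"
    have "inverse (of_int c) *\<^sub>R (x + w + v) =
        inverse (of_int c) *\<^sub>R (x + r v) + inverse (of_int c) *\<^sub>R (w + v - r v)"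
      unfolding scaleR_add_right[symmetric] by simp
    then show "K (inverse (of_int c) *\<^sub>R (x + w + v)) = K (inverse (of_int c) *\<^sub>R (x + r v))"
      using per[OF diff[OF v]] by simp
  qed simp
  also have "\<dots> = (\<Sum>v\<in>r ` digits c. K (inverse (of_int c) *\<^sub>R (x + v)))"
    by (subst sum.reindex[OF inj]) simp
  finally show ?thesis by (simp only: img)
qed

text \<open>The cubes \<open>v + [0, 1)\<close> for the digits \<open>v\<close> tile the box \<open>[0, \<bar>c\<bar>)\<close>.\<close>

lemma sum_indicator_cube_digits:
  "(\<Sum>v\<in>digits c. indicator unit_cube (y - v)) =
    (indicator {y :: real^'n. \<forall>i. 0 \<le> y $ i \<and> y $ i < \<bar>of_int c\<bar>} y :: ennreal)"
proof (cases "\<forall>i. 0 \<le> y $ i \<and> y $ i < \<bar>of_int c\<bar>")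
  case True
  define v0 :: "real^'n" where "v0 = (\<chi> i. of_int \<lfloor>y $ i\<rfloor>)"
  have "\<lfloor>y $ i\<rfloor> < \<bar>c\<bar>" for i using True by (metis floor_less_iff of_int_abs)
  then have v0: "v0 \<in> digits c" using True by (auto simp: v0_def digits_def)
  have "y - v \<in> unit_cube \<longleftrightarrow> v = v0" if v: "v \<in> digits c" for v
  proof
    assume "y - v \<in> unit_cube"
    then have b: "0 \<le> y $ i - v $ i" "y $ i - v $ i < 1" for i by (auto simp: unit_cube_def)
    have "v $ i = of_int \<lfloor>y $ i\<rfloor>" for i
    proof -
      obtain k :: int where k: "v $ i = of_int k" using v by (auto simp: digits_def)
      then have "\<lfloor>y $ i\<rfloor> = k" using b[of i] by (intro floor_unique) auto
      then show ?thesis using k by simp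
    qed
    then show "v = v0" by (simp add: v0_def vec_eq_iff)
  next
    assume "v = v0"
    then show "y - v \<in> unit_cube"
      by (auto simp: unit_cube_def v0_def) (metis frac_def frac_lt_1)
  qed
  then have "(\<Sum>v\<in>digits c. indicator unit_cube (y - v)) = (\<Sum>v\<in>digits c. if v = v0 then 1 else 0 :: ennreal)"
    by (intro sum.cong) (auto split: split_indicator)
  also have "\<dots> = 1" using v0 finite_digits[of c] by (subst sum.delta) simp_all
  finally show ?thesis using True by simp
next
  case False
  have "y - v \<notin> unit_cube" if vd: "v \<in> digits c" for v
  proof
    assume "y - v \<in> unit_cube"
    then have b: "0 \<le> y $ i - v $ i" "y $ i - v $ i < 1" for i by (auto simp: unit_cube_def)
    have "0 \<le> y $ i \<and> y $ i < \<bar>of_int c\<bar>" for i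
    proof -
      obtain k :: int where k: "0 \<le> k" "k < \<bar>c\<bar>" "v $ i = of_int k" using vd by (auto simp: digits_def)
      then have "v $ i + 1 \<le> \<bar>of_int c\<bar>" by (simp flip: of_int_abs)
      moreover have "0 \<le> v $ i" using k by simp
      ultimately show ?thesis using b[of i] by linarith
    qed
    then show False using False by blast
  qed
  then have "(\<Sum>v\<in>digits c. indicator unit_cube (y - v)) = (0 :: ennreal)"
    by (intro sum.neutral) auto
  then show ?thesis using False by simp
qed

lemma nn_integral_lborel_affine:
  fixes f :: "'a::euclidean_space \<Rightarrow> ennreal"
  assumes "c \<noteq> 0" and [measurable]: "f \<in> borel_measurable borel"
  shows "(\<integral>\<^sup>+x. f x \<partial>lborel) = ennreal (\<bar>c\<bar> ^ DIM('a)) * (\<integral>\<^sup>+x. f (t + c *\<^sub>R x) \<partial>lborel)"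
  by (subst lborel_affine[OF assms(1), of t])
    (simp add: nn_integral_density nn_integral_distr nn_integral_cmult)

text \<open>The transfer operator preserves Lebesgue measure: substituting \<open>x = c z - v\<close> turns the sum over the
preimages into one integral over the fundamental domain \<open>{z. c z \<in> [0, \<bar>c\<bar>)}\<close>.\<close>

lemma nn_integral_digit_average:
  fixes K :: "real^'n \<Rightarrow> ennreal"
  assumes c: "c \<noteq> 0" and [measurable]: "K \<in> borel_measurable borel"
    and per: "\<And>x w. w \<in> int_vectors \<Longrightarrow> K (x + w) = K x"
  shows "(\<integral>\<^sup>+x. (\<Sum>v\<in>digits c. K (inverse (of_int c) *\<^sub>R (x + v))) / of_nat (card (digits c :: (real^'n) set)) \<partial>cube_measure)
    = (\<integral>\<^sup>+x. K x \<partial>cube_measure)"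
proof -
  let ?N = "of_nat (card (digits c :: (real^'n) set)) :: ennreal"
  let ?Q = "{z :: real^'n. \<forall>i. 0 \<le> of_int c * z $ i \<and> of_int c * z $ i < \<bar>of_int c\<bar>}"
  have Nc: "?N = ennreal (\<bar>of_int c\<bar> ^ CARD('n))"
    by (simp add: card_digits ennreal_of_nat_eq_real_of_nat)
  have N0: "?N \<noteq> 0" "?N \<noteq> \<top>"
    using c by (simp add: card_digits, simp only: Nc ennreal_neq_top not_False_eq_True)
  have one: "(\<integral>\<^sup>+x. K (inverse (of_int c) *\<^sub>R (x + v)) * indicator unit_cube x \<partial>lborel) =
    ?N * (\<integral>\<^sup>+z. K z * indicator unit_cube (of_int c *\<^sub>R z - v) \<partial>lborel)" for v
    using c by (subst nn_integral_lborel_affine[of "of_int c" _ "- v"]) (auto simp: Nc)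
  have "(\<integral>\<^sup>+x. (\<Sum>v\<in>digits c. K (inverse (of_int c) *\<^sub>R (x + v))) / ?N \<partial>cube_measure) =
    (\<integral>\<^sup>+x. (\<Sum>v\<in>digits c. K (inverse (of_int c) *\<^sub>R (x + v))) / ?N * indicator unit_cube x \<partial>lborel)"
    by (subst nn_integral_cube) auto
  also have "\<dots> = (\<integral>\<^sup>+x. (\<Sum>v\<in>digits c. K (inverse (of_int c) *\<^sub>R (x + v)) * indicator unit_cube x) / ?N \<partial>lborel)"
    by (intro nn_integral_cong) (simp add: sum_distrib_left ennreal_times_divide mult.commute)
  also have "\<dots> = (\<Sum>v\<in>digits c. \<integral>\<^sup>+x. K (inverse (of_int c) *\<^sub>R (x + v)) * indicator unit_cube x \<partial>lborel) / ?N"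
    by (subst nn_integral_divide) (auto simp: nn_integral_sum)
  also have "\<dots> = (\<Sum>v\<in>digits c. \<integral>\<^sup>+z. K z * indicator unit_cube (of_int c *\<^sub>R z - v) \<partial>lborel)"
    unfolding one mult.commute[of ?N] sum_distrib_right[symmetric] by (rule mult_divide_eq_ennreal[OF N0])
  also have "\<dots> = (\<integral>\<^sup>+z. (\<Sum>v\<in>digits c. K z * indicator unit_cube (of_int c *\<^sub>R z - v)) \<partial>lborel)"
    by (subst nn_integral_sum) auto
  also have "\<dots> = (\<integral>\<^sup>+z. K z * indicator ?Q z \<partial>lborel)"
    by (intro nn_integral_cong)
      (auto simp: sum_distrib_left[symmetric] sum_indicator_cube_digits split: split_indicator)
  also have "\<dots> = (\<integral>\<^sup>+z. K z * indicator unit_cube z \<partial>lborel)"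
    by (intro nn_integral_fundamental_domain fundamental_domain_scaled fundamental_domain_unit_cube c per) auto
  finally show ?thesis by (simp add: nn_integral_cube)
qed

text \<open>Induction over the steps, splitting off the first digit. Averaging over the digits is needed to make
the integrand periodic in \<open>x\<close>, since for fixed digits the preorbit of \<open>x + w\<close> is a different one.\<close>

lemma preorbit_law_integral:
  fixes F :: "real^'n \<Rightarrow> ennreal"
  assumes c: "c \<noteq> 0" and [measurable]: "F \<in> borel_measurable borel"
    and per: "\<And>x w. w \<in> int_vectors \<Longrightarrow> F (x + w) = F x"
  shows "(\<integral>\<^sup>+x. (\<integral>\<^sup>+\<omega>. F (preorbit c x \<omega> m) \<partial>digit_space c) \<partial>cube_measure) = (\<integral>\<^sup>+x. F x \<partial>cube_measure)"
proof -
  define A where "A m x = (\<integral>\<^sup>+\<omega>. F (preorbit c x \<omega> m) \<partial>digit_space c)" for m and x :: "real^'n"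
  interpret P: prob_space "digit_space c :: (nat \<Rightarrow> real^'n) measure" by (rule prob_space_digits)
  have meas2: "(\<lambda>(x, \<omega>). F (preorbit c x \<omega> m)) \<in> borel_measurable (borel \<Otimes>\<^sub>M digit_space c)" for m
    using measurable_compose[OF measurable_preorbit assms(2)] by (simp add: split_beta')
  have meas1: "(\<lambda>\<omega>. F (preorbit c x \<omega> m)) \<in> borel_measurable (digit_space c)" for m x
    using measurable_compose[OF measurable_Pair1' meas2, of x m] by simp
  have Am: "A m \<in> borel_measurable borel" for m
    unfolding A_def by (rule P.borel_measurable_nn_integral) (use meas2 in \<open>simp add: split_beta'\<close>)
  have rec: "A (Suc m) x = (\<Sum>v\<in>digits c. A m (inverse (of_int c) *\<^sub>R (x + v))) / of_nat (card (digits c :: (real^'n) set))" for m x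
    unfolding A_def by (subst nn_integral_digit_space_Suc[OF c meas1]) (simp only: preorbit_Suc_front)
  have perA: "A m (x + w) = A m x" if "w \<in> int_vectors" for m x w
    using that
  proof (induction m arbitrary: x w)
    case 0 then show ?case using per by (simp add: A_def)
  next
    case (Suc m)
    show ?case
      unfolding rec using sum_digits_periodic[where K = "A m", OF c Suc.prems Suc.IH] by simp
  qed
  have intA: "(\<integral>\<^sup>+x. A m x \<partial>cube_measure) = (\<integral>\<^sup>+x. F x \<partial>cube_measure)" for m
  proof (induction m)
    case 0 show ?case by (simp add: A_def P.emeasure_space_1)
  next
    case (Suc m)
    then show ?case unfolding rec by (subst nn_integral_digit_average[OF c Am perA])
  qed
  show "(\<integral>\<^sup>+x. (\<integral>\<^sup>+\<omega>. F (preorbit c x \<omega> m) \<partial>digit_space c) \<partial>cube_measure) = (\<integral>\<^sup>+x. F x \<partial>cube_measure)"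
    using intA by (simp add: A_def)
qed

text \<open>A concrete model of the natural extension of multiplication by \<open>c\<close> on the torus.\<close>

definition natural_space :: "int \<Rightarrow> ((real^'n) \<times> (nat \<Rightarrow> real^'n)) measure"
  where "natural_space c = cube_measure \<Otimes>\<^sub>M digit_space c"

lemma prob_space_natural: "prob_space (natural_space c :: ((real^'n) \<times> (nat \<Rightarrow> real^'n)) measure)"
proof -
  interpret C: prob_space "cube_measure :: (real^'n) measure" by (rule prob_space_cube)
  interpret P: prob_space "digit_space c :: (nat \<Rightarrow> real^'n) measure" by (rule prob_space_digits)
  interpret CP: pair_prob_space "cube_measure :: (real^'n) measure" "digit_space c :: (nat \<Rightarrow> real^'n) measure" ..
  show ?thesis unfolding natural_space_def by (rule CP.prob_space_axioms)
qed

lemma measurable_preorbit_natural [measurable]: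
  "(\<lambda>z. preorbit c (fst z) (snd z) n) \<in> measurable (natural_space c) (borel :: (real^'n) measure)"
proof -
  have "sets (natural_space c :: ((real^'n) \<times> (nat \<Rightarrow> real^'n)) measure) = sets (borel \<Otimes>\<^sub>M digit_space c)"
    unfolding natural_space_def by (intro sets_pair_measure_cong) auto
  then have "(borel_measurable (natural_space c) :: (((real^'n) \<times> (nat \<Rightarrow> real^'n)) \<Rightarrow> real^'n) set) =
      borel_measurable (borel \<Otimes>\<^sub>M digit_space c)"
    by (rule measurable_cong_sets) simp
  then show ?thesis
    using measurable_preorbit[of c n] by (simp add: split_beta')
qed

lemma measurable_abs_torus_cube: "abs_torus \<in> borel_measurable cube_measure"
  by measurable

lemma preorbit_law_torus:
  assumes c: "c \<noteq> 0"
  shows "distr (natural_space c) borel (\<lambda>z. abs_torus (preorbit c (fst z) (snd z) m)) = (torus_measure :: 'n::finite torus measure)"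
proof (rule measure_eqI)
  fix A :: "'n torus set" assume "A \<in> sets (distr (natural_space c) borel (\<lambda>z. abs_torus (preorbit c (fst z) (snd z) m)))"
  then have [measurable]: "A \<in> sets borel" by simp
  interpret P: prob_space "digit_space c :: (nat \<Rightarrow> real^'n) measure" by (rule prob_space_digits)
  let ?F = "\<lambda>x :: real^'n. indicator A (abs_torus x) :: ennreal"
  have F: "?F \<in> borel_measurable borel" by measurable
  have "emeasure (distr (natural_space c) borel (\<lambda>z. abs_torus (preorbit c (fst z) (snd z) m))) A =
    (\<integral>\<^sup>+p. indicator A p \<partial>distr (natural_space c) borel (\<lambda>z. abs_torus (preorbit c (fst z) (snd z) m)))"
    by simp
  also have "\<dots> = (\<integral>\<^sup>+z. ?F (preorbit c (fst z) (snd z) m) \<partial>natural_space c)"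
    by (subst nn_integral_distr) auto
  also have "\<dots> = (\<integral>\<^sup>+x. (\<integral>\<^sup>+\<omega>. ?F (preorbit c x \<omega> m) \<partial>digit_space c) \<partial>cube_measure)"
  proof -
    have "(\<lambda>z. ?F (preorbit c (fst z) (snd z) m)) \<in> borel_measurable (cube_measure \<Otimes>\<^sub>M digit_space c)"
      using measurable_compose[OF measurable_preorbit_natural F] by (simp add: natural_space_def)
    from P.nn_integral_fst[OF this] show ?thesis by (simp add: natural_space_def)
  qed
  also have "\<dots> = (\<integral>\<^sup>+x. ?F x \<partial>cube_measure)"
  proof (rule preorbit_law_integral[OF c F])
    show "?F (x + w) = ?F x" if "w \<in> int_vectors" for x w
    proof -
      have "abs_torus (x + w) = abs_torus x" using that by (simp add: abs_torus_eq_iff)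
      then show ?thesis by simp
    qed
  qed
  also have "\<dots> = (\<integral>\<^sup>+p. indicator A p \<partial>torus_measure)"
    unfolding torus_measure_cube by (subst nn_integral_distr) (simp_all add: measurable_abs_torus_cube)
  also have "\<dots> = emeasure torus_measure A" by simp
  finally show "emeasure (distr (natural_space c) borel (\<lambda>z. abs_torus (preorbit c (fst z) (snd z) m))) A = emeasure torus_measure A" .
qed simp

section \<open>Almost every orbit equidistributes\<close>

text \<open>The second moments of the averages over the first \<open>m\<^sup>2\<close> terms are summable, so these averages tend
to zero almost surely. Between consecutive squares the averages change little because the variables
are bounded.\<close>

lemma averages_tendsto_zero:
  fixes X :: "nat \<Rightarrow> 'a \<Rightarrow> real"
  assumes M: "prob_space M" and meas: "\<And>k. X k \<in> borel_measurable M"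
    and bound: "\<And>k \<omega>. \<bar>X k \<omega>\<bar> \<le> B"
    and var: "\<And>n. (\<integral>\<omega>. (\<Sum>k<n. X k \<omega>)\<^sup>2 \<partial>M) \<le> C * real n"
  shows "AE \<omega> in M. (\<lambda>n. (\<Sum>k<n. X k \<omega>) / real n) \<longlonglongrightarrow> 0"
proof -
  interpret prob_space M by fact
  note [measurable] = meas
  have B0: "B \<ge> 0" using bound[of 0 undefined] by linarith
  define S where "S n \<omega> = (\<Sum>k<n. X k \<omega>)" for n \<omega>
  have Sm [measurable]: "S n \<in> borel_measurable M" for n unfolding S_def by measurable
  have Sb: "\<bar>S n \<omega>\<bar> \<le> B * real n" for n \<omega>
  proof -
    have "\<bar>S n \<omega>\<bar> \<le> (\<Sum>k<n. \<bar>X k \<omega>\<bar>)" unfolding S_def by (rule sum_abs)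
    also have "\<dots> \<le> (\<Sum>k<n. B)" by (intro sum_mono bound)
    finally show ?thesis by (simp add: mult.commute)
  qed
  define Y where "Y m \<omega> = (S (Suc m ^ 2) \<omega> / real (Suc m ^ 2))\<^sup>2" for m \<omega>
  have Ym [measurable]: "Y m \<in> borel_measurable M" for m unfolding Y_def by measurable
  have C0: "C \<ge> 0"
  proof -
    have "0 \<le> (\<integral>\<omega>. (\<Sum>k<1. X k \<omega>)\<^sup>2 \<partial>M)" by (rule Bochner_Integration.integral_nonneg) simp
    from order_trans[OF this var[of 1]] show ?thesis by simp
  qed
  have intY: "(\<integral>\<^sup>+\<omega>. ennreal (Y m \<omega>) \<partial>M) \<le> ennreal (C * (1 / real (Suc m) ^ 2))" for m
  proof -
    have int: "integrable M (\<lambda>\<omega>. (S n \<omega>)\<^sup>2)" for n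
    proof (rule integrable_const_bound[where B = "(B * real n)\<^sup>2"])
      show "AE x in M. norm ((S n x)\<^sup>2) \<le> (B * real n)\<^sup>2"
        using Sb[of n] by (auto intro!: AE_I2 simp: abs_le_square_iff[symmetric])
          (metis abs_ge_zero abs_of_nonneg order_trans)
    qed measurable
    have "(\<integral>\<^sup>+\<omega>. ennreal (Y m \<omega>) \<partial>M) = ennreal (\<integral>\<omega>. Y m \<omega> \<partial>M)"
      using int[of "Suc m ^ 2"] by (intro nn_integral_eq_integral) (auto simp: Y_def power_divide)
    also have "(\<integral>\<omega>. Y m \<omega> \<partial>M) = (\<integral>\<omega>. (S (Suc m ^ 2) \<omega>)\<^sup>2 \<partial>M) / (real (Suc m ^ 2))\<^sup>2"
      by (simp add: Y_def power_divide)
    also have "\<dots> \<le> (C * real (Suc m ^ 2)) / (real (Suc m ^ 2))\<^sup>2"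
      using var[of "Suc m ^ 2"] unfolding S_def by (intro divide_right_mono) auto
    also have "\<dots> = C * (1 / real (Suc m) ^ 2)"
      unfolding of_nat_power by (simp add: power2_eq_square del: of_nat_Suc)
    finally show ?thesis by (simp add: ennreal_leI)
  qed
  have "summable (\<lambda>m. 1 / real (Suc m) ^ 2)"
    using inverse_power_summable[of 2, where 'a = real] by (subst summable_Suc_iff) (simp add: field_simps)
  then have sm: "summable (\<lambda>m. C * (1 / real (Suc m) ^ 2))" by (rule summable_mult)
  have "(\<integral>\<^sup>+\<omega>. (\<Sum>m. ennreal (Y m \<omega>)) \<partial>M) = (\<Sum>m. \<integral>\<^sup>+\<omega>. ennreal (Y m \<omega>) \<partial>M)"
    by (rule nn_integral_suminf) measurable
  also have "\<dots> \<le> (\<Sum>m. ennreal (C * (1 / real (Suc m) ^ 2)))"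
    by (intro suminf_le intY) auto
  also have "\<dots> = ennreal (\<Sum>m. C * (1 / real (Suc m) ^ 2))"
    using C0 by (intro suminf_ennreal2 sm) auto
  finally have "(\<integral>\<^sup>+\<omega>. (\<Sum>m. ennreal (Y m \<omega>)) \<partial>M) \<noteq> \<infinity>"
    using ennreal_less_top le_less_trans infinity_ennreal_def by (metis less_irrefl)
  then have "AE \<omega> in M. (\<Sum>m. ennreal (Y m \<omega>)) \<noteq> \<infinity>"
    by (intro nn_integral_noteq_infinite) measurable
  then show ?thesis
  proof eventually_elim
    case (elim \<omega>)
    have "summable (\<lambda>m. Y m \<omega>)"
      using elim by (intro summable_suminf_not_top) (auto simp: Y_def)
    then have "(\<lambda>m. sqrt (Y m \<omega>)) \<longlonglongrightarrow> sqrt 0"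
      by (intro tendsto_real_sqrt summable_LIMSEQ_zero)
    then have Z0: "(\<lambda>m. \<bar>S (Suc m ^ 2) \<omega>\<bar> / real (Suc m ^ 2)) \<longlonglongrightarrow> 0"
      by (simp add: Y_def)
    \<comment> \<open>The square \<open>Suc (r n) ^ 2\<close> is the largest one that is at most \<open>n\<close>; the shift by one matches \<open>Y\<close>, which starts at \<open>1\<close>.\<close>
    define r where "r n = nat \<lfloor>sqrt (real n)\<rfloor> - 1" for n
    have r_top: "filterlim r at_top sequentially"
      unfolding filterlim_at_top
    proof
      fix Z
      show "\<forall>\<^sub>F n in sequentially. Z \<le> r n"
      proof (rule eventually_sequentiallyI)
        fix n assume "(Suc Z)\<^sup>2 \<le> n"
        then have "real (Suc Z) \<le> sqrt (real n)"
          by (intro real_le_rsqrt) (metis of_nat_le_iff of_nat_power)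
        then show "Z \<le> r n" unfolding r_def by (simp add: le_nat_floor le_diff_conv2) linarith
      qed
    qed
    have "(\<lambda>n. \<bar>S (Suc (r n) ^ 2) \<omega>\<bar> / real (Suc (r n) ^ 2) + 2 * B * (1 / real (Suc (r n)))) \<longlonglongrightarrow> 0 + 2 * B * 0"
      by (intro tendsto_add tendsto_mult tendsto_const filterlim_compose[OF Z0 r_top]
          filterlim_compose[OF lim_inverse_n'[THEN LIMSEQ_Suc] r_top])
    then have lim: "(\<lambda>n. \<bar>S (Suc (r n) ^ 2) \<omega>\<bar> / real (Suc (r n) ^ 2) + 2 * B * (1 / real (Suc (r n)))) \<longlonglongrightarrow> 0"
      by simp
    have le: "norm (S n \<omega> / real n) \<le> \<bar>S (Suc (r n) ^ 2) \<omega>\<bar> / real (Suc (r n) ^ 2) + 2 * B * (1 / real (Suc (r n)))"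
      if n: "n \<ge> 1" for n
    proof -
      define m where "m = Suc (r n)"
      have "sqrt (real n) \<ge> 1" using n by simp
      then have m1: "1 \<le> \<lfloor>sqrt (real n)\<rfloor>" by linarith
      then have m: "real m \<le> sqrt (real n)" "sqrt (real n) < real m + 1" "m \<ge> 1"
      proof -
        have "m = nat \<lfloor>sqrt (real n)\<rfloor>" using m1 unfolding m_def r_def by linarith
        then have "real m = of_int \<lfloor>sqrt (real n)\<rfloor>" "m \<ge> 1" using m1 by (simp, linarith)
        then show "real m \<le> sqrt (real n)" "sqrt (real n) < real m + 1" "m \<ge> 1" by linarith+
      qed
      have "(real m)\<^sup>2 \<le> (sqrt (real n))\<^sup>2" using m by (intro power_mono) auto
      then have "real (m\<^sup>2) \<le> real n" by simp
      then have mn: "m\<^sup>2 \<le> n" by (simp only: of_nat_le_iff)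
      have "(sqrt (real n))\<^sup>2 < (real m + 1)\<^sup>2" using m by (intro power_strict_mono) auto
      then have nm: "real n - real (m\<^sup>2) \<le> 2 * real m" 
      proof -
        assume "(sqrt (real n))\<^sup>2 < (real m + 1)\<^sup>2"
        then have "real n < real (m\<^sup>2 + 2 * m + 1)" by (simp add: power2_eq_square algebra_simps)
        then have "n < m\<^sup>2 + 2 * m + 1" by (simp only: of_nat_less_iff)
        then have "n \<le> m\<^sup>2 + 2 * m" by simp
        then have "real n \<le> real (m\<^sup>2 + 2 * m)" by (simp only: of_nat_le_iff)
        then show ?thesis by simp
      qed
      have split: "S n \<omega> = S (m\<^sup>2) \<omega> + (\<Sum>k\<in>{m\<^sup>2..<n}. X k \<omega>)"
        unfolding S_def lessThan_atLeast0 using mn by (subst sum.atLeastLessThan_concat) auto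
      have "\<bar>\<Sum>k\<in>{m\<^sup>2..<n}. X k \<omega>\<bar> \<le> (\<Sum>k\<in>{m\<^sup>2..<n}. \<bar>X k \<omega>\<bar>)" by (rule sum_abs)
      also have "\<dots> \<le> (\<Sum>k\<in>{m\<^sup>2..<n}. B)" by (intro sum_mono bound)
      also have "\<dots> = B * (real n - real (m\<^sup>2))" using mn by (simp add: of_nat_diff)
      also have "\<dots> \<le> B * (2 * real m)" using nm B0 by (intro mult_left_mono)
      finally have tail: "\<bar>\<Sum>k\<in>{m\<^sup>2..<n}. X k \<omega>\<bar> \<le> B * (2 * real m)" .
      have "\<bar>S n \<omega>\<bar> \<le> \<bar>S (m\<^sup>2) \<omega>\<bar> + B * (2 * real m)" using split tail by linarith
      then have "\<bar>S n \<omega>\<bar> / real n \<le> (\<bar>S (m\<^sup>2) \<omega>\<bar> + B * (2 * real m)) / real n"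
        by (intro divide_right_mono) auto
      also have "\<dots> \<le> (\<bar>S (m\<^sup>2) \<omega>\<bar> + B * (2 * real m)) / real (m\<^sup>2)"
        using mn m(3) n B0 by (intro divide_left_mono) (auto simp del: of_nat_power)
      also have "\<dots> = \<bar>S (m\<^sup>2) \<omega>\<bar> / real (m\<^sup>2) + 2 * B * (1 / real m)"
        using m(3) by (simp add: add_divide_distrib power2_eq_square)
      finally show ?thesis unfolding m_def by simp
    qed
    have "(\<lambda>n. S n \<omega> / real n) \<longlonglongrightarrow> 0"
      by (rule tendsto_0_le[OF lim, where K = 1])
        (use le in \<open>auto intro!: eventually_sequentiallyI[of 1] intro: order_trans[OF _ abs_ge_self]\<close>)
    then show ?case by (simp add: S_def)
  qed
qed

lemma second_moment_bound:
  fixes X :: "nat \<Rightarrow> 'a \<Rightarrow> real"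
  assumes M: "prob_space M" and meas: "\<And>k. X k \<in> borel_measurable M"
    and bound: "\<And>k \<omega>. \<bar>X k \<omega>\<bar> \<le> B"
    and cov: "\<And>j k. j \<le> k \<Longrightarrow> (\<integral>\<omega>. X j \<omega> * X k \<omega> \<partial>M) \<le> D * r ^ (k - j)"
    and r: "0 \<le> r" "r < 1" and D: "0 \<le> D"
  shows "(\<integral>\<omega>. (\<Sum>k<n. X k \<omega>)\<^sup>2 \<partial>M) \<le> (2 * D / (1 - r) + D) * real n"
proof -
  interpret prob_space M by fact
  note [measurable] = meas
  have geo: "(\<Sum>j<n. r ^ (n - j)) \<le> 1 / (1 - r)" for n
  proof (induction n)
    case (Suc n)
    have "(\<Sum>j<Suc n. r ^ (Suc n - j)) = r * (\<Sum>j<n. r ^ (n - j)) + r"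
      by (simp add: sum_distrib_left Suc_diff_le)
    also have "\<dots> \<le> r * (1 / (1 - r)) + r" using Suc r by (intro add_mono mult_left_mono) auto
    also have "\<dots> \<le> 1 / (1 - r)"
    proof -
      have "0 \<le> (1 - r)\<^sup>2" by simp
      then have "r + r * (1 - r) \<le> 1" by (simp add: power2_eq_square algebra_simps)
      then have "(r + r * (1 - r)) / (1 - r) \<le> 1 / (1 - r)" using r by (intro divide_right_mono) auto
      then show ?thesis using r by (simp add: add_divide_distrib)
    qed
    finally show ?case .
  qed (use r in simp)
  have intXX: "integrable M (\<lambda>\<omega>. X j \<omega> * X k \<omega>)" for j k
    by (rule integrable_const_bound[where B = "B * B"])
      (auto simp: abs_mult intro!: mult_mono bound order_trans[OF abs_ge_zero bound])
  show ?thesis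
  proof (induction n)
    case (Suc n)
    have eq: "(\<Sum>k<Suc n. X k \<omega>)\<^sup>2 = (\<Sum>k<n. X k \<omega>)\<^sup>2 + 2 * (\<Sum>j<n. X j \<omega> * X n \<omega>) + X n \<omega> * X n \<omega>" for \<omega>
      by (simp add: power2_eq_square algebra_simps sum_distrib_right sum_distrib_left)
    have sq: "(\<Sum>k<n. X k \<omega>)\<^sup>2 = (\<Sum>j<n. \<Sum>k<n. X j \<omega> * X k \<omega>)" for \<omega>
      by (simp add: power2_eq_square sum_product)
    have "(\<integral>\<omega>. (\<Sum>k<Suc n. X k \<omega>)\<^sup>2 \<partial>M) = (\<integral>\<omega>. (\<Sum>k<n. X k \<omega>)\<^sup>2 \<partial>M) + 2 * (\<Sum>j<n. \<integral>\<omega>. X j \<omega> * X n \<omega> \<partial>M)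
        + (\<integral>\<omega>. X n \<omega> * X n \<omega> \<partial>M)"
      unfolding eq by (simp add: intXX sq)
    also have "(\<Sum>j<n. \<integral>\<omega>. X j \<omega> * X n \<omega> \<partial>M) \<le> (\<Sum>j<n. D * r ^ (n - j))"
      by (intro sum_mono cov) auto
    also have "\<dots> \<le> D * (1 / (1 - r))"
      using geo[of n] D by (simp only: sum_distrib_left[symmetric] mult_left_mono)
    also have "(\<integral>\<omega>. X n \<omega> * X n \<omega> \<partial>M) \<le> D" using cov[of n n] by simp
    finally have "(\<integral>\<omega>. (\<Sum>k<Suc n. X k \<omega>)\<^sup>2 \<partial>M) \<le> (2 * D / (1 - r) + D) * real n + 2 * (D * (1 / (1 - r))) + D"
      using Suc by simp
    then show ?case by (simp add: algebra_simps add_divide_distrib)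
  qed simp
qed

definition torus_mult :: "int \<Rightarrow> 'n::finite torus \<Rightarrow> 'n torus"
  where "torus_mult c = torus_map (\<lambda>x. of_int c *\<^sub>R x)"

lemma torus_mult_abs: "torus_mult c (abs_torus x) = abs_torus (of_int c *\<^sub>R x)"
proof -
  have "rep_torus (abs_torus x) - x \<in> int_vectors" by (simp flip: abs_torus_eq_iff)
  then have "of_int c *\<^sub>R (rep_torus (abs_torus x) - x) \<in> int_vectors" by (rule int_vectors_scale)
  then show ?thesis
    by (simp add: torus_mult_def torus_map_def abs_torus_eq_iff scaleR_diff_right)
qed

lemma continuous_torus_mult: "continuous_on UNIV (torus_mult c)"
proof (rule continuous_on_torusI)
  show "continuous_on UNIV (\<lambda>x. torus_mult c (abs_torus x))"
    unfolding torus_mult_abs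
    by (intro continuous_on_compose2[OF continuous_on_abs_torus] continuous_intros) auto
qed

text \<open>Digits are integral, so multiplication by \<open>c\<close> undoes a step of the preorbit modulo the lattice.\<close>

lemma torus_mult_preorbit:
  assumes "c \<noteq> 0" "\<omega> n \<in> int_vectors"
  shows "torus_mult c (abs_torus (preorbit c x \<omega> (Suc n))) = abs_torus (preorbit c x \<omega> n)"
  using assms by (simp add: torus_mult_abs abs_torus_eq_iff)

lemma torus_mult_funpow_preorbit:
  assumes "c \<noteq> 0" "\<And>n. \<omega> n \<in> int_vectors"
  shows "(torus_mult c ^^ l) (abs_torus (preorbit c x \<omega> (l + k))) = abs_torus (preorbit c x \<omega> k)"
proof (induction l)
  case (Suc l)
  then show ?case
    using torus_mult_preorbit[of c \<omega> "l + k" x, OF assms(1) assms(2)]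
    by (simp add: funpow_Suc_right del: funpow.simps preorbit.simps)
qed simp

lemma preorbit_diff:
  "preorbit c x \<omega> n - preorbit c y \<omega> n = (inverse (of_int c)) ^ n *\<^sub>R (x - y)"
proof (induction n)
  case (Suc n)
  have "preorbit c x \<omega> (Suc n) - preorbit c y \<omega> (Suc n) =
      inverse (of_int c) *\<^sub>R (preorbit c x \<omega> n - preorbit c y \<omega> n)"
    by (simp add: scaleR_diff_right scaleR_add_right)
  then show ?case by (simp add: Suc)
qed simp

lemma AE_natural_digits:
  assumes "c \<noteq> 0"
  shows "AE z in (natural_space c :: ((real^'n) \<times> (nat \<Rightarrow> real^'n)) measure).
    fst z \<in> unit_cube \<and> (\<forall>n. snd z n \<in> digits c)"
proof -
  interpret P: prob_space "digit_space c :: (nat \<Rightarrow> real^'n) measure" by (rule prob_space_digits)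
  interpret C: prob_space "cube_measure :: (real^'n) measure" by (rule prob_space_cube)
  interpret CP: pair_sigma_finite "cube_measure :: (real^'n) measure" "digit_space c :: (nat \<Rightarrow> real^'n) measure" ..
  have "AE x in cube_measure. x \<in> (unit_cube :: (real^'n) set)"
    unfolding cube_measure_def by (subst AE_density) (auto intro!: AE_I2 simp: indicator_def split: if_splits)
  note cube = this
  have [measurable]: "(digits c :: (real^'n) set) \<in> sets borel"
    by (intro borel_closed finite_imp_closed finite_digits)
  have [measurable]: "(\<lambda>z. snd z n) \<in> measurable (cube_measure \<Otimes>\<^sub>M digit_space c) (borel :: (real^'n) measure)" for n
    by (rule measurable_compose[OF measurable_snd measurable_digit])
  show ?thesis unfolding natural_space_def
  proof (rule CP.AE_pair_measure)
    show "{z \<in> space (cube_measure \<Otimes>\<^sub>M digit_space c). fst z \<in> unit_cube \<and> (\<forall>n. snd z n \<in> digits c)}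
      \<in> sets (cube_measure \<Otimes>\<^sub>M (digit_space c :: (nat \<Rightarrow> real^'n) measure))"
      by measurable
    show "AE x in cube_measure. AE \<omega> in digit_space c.
        fst (x :: real^'n, \<omega> :: nat \<Rightarrow> real^'n) \<in> unit_cube \<and> (\<forall>n. snd (x, \<omega>) n \<in> digits c)"
      using cube by eventually_elim (use AE_digits[OF assms] in simp)
  qed
qed

lemma (in prob_space) abs_expectation_le:
  fixes f :: "'a \<Rightarrow> real"
  assumes "f \<in> borel_measurable M" "AE x in M. \<bar>f x\<bar> \<le> b"
  shows "\<bar>expectation f\<bar> \<le> b"
proof -
  have int: "integrable M f" using assms by (intro integrable_const_bound[where B = b]) auto
  have "\<bar>expectation f\<bar> \<le> (\<integral>x. \<bar>f x\<bar> \<partial>M)" by (rule integral_abs_bound)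
  also have "\<dots> \<le> b" using int assms(2) by (intro integral_le_const) auto
  finally show ?thesis .
qed

lemma bounded_continuous_torus:
  fixes F :: "'n::finite torus \<Rightarrow> real"
  assumes "continuous_on UNIV F"
  obtains B where "0 \<le> B" "\<And>p. \<bar>F p\<bar> \<le> B"
proof -
  have "bounded (range F)"
    using compact_imp_bounded[OF compact_continuous_image[OF assms compact_torus]] .
  then obtain B where B: "\<forall>y\<in>range F. norm y \<le> B" unfolding bounded_iff by blast
  then have "\<bar>F p\<bar> \<le> B" for p by simp
  moreover from this[of undefined] have "0 \<le> B" by linarith
  ultimately show thesis using that by blast
qed

lemma measurable_abs_preorbit [measurable]:
  "(\<lambda>z. abs_torus (preorbit c (fst z) (snd z) n)) \<in> measurable (natural_space c) (borel :: ('n::finite torus) measure)"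
  by (rule measurable_compose[OF measurable_preorbit_natural measurable_abs_torus])

lemma integral_preorbit:
  fixes G :: "'n::finite torus \<Rightarrow> real"
  assumes "c \<noteq> 0" and [measurable]: "G \<in> borel_measurable borel"
  shows "(\<integral>z. G (abs_torus (preorbit c (fst z) (snd z) m)) \<partial>natural_space c) = (\<integral>p. G p \<partial>torus_measure)"
  unfolding preorbit_law_torus[OF assms(1), of m, symmetric]
  by (rule integral_distr[symmetric]) measurable

lemma AE_natural_int_vectors:
  assumes "c \<noteq> 0"
  shows "AE z in (natural_space c :: ((real^'n) \<times> (nat \<Rightarrow> real^'n)) measure). \<forall>n. snd z n \<in> int_vectors"
  using AE_natural_digits[OF assms] by eventually_elim (use digits_int_vectors in blast)

lemma measurable_torus_mult_funpow [measurable]: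
  "(torus_mult c ^^ j) \<in> borel_measurable borel"
proof (induction j)
  case (Suc j)
  have "torus_mult c \<in> borel_measurable borel"
    by (rule borel_measurable_continuous_onI[OF continuous_torus_mult])
  then show ?case unfolding funpow.simps by (rule measurable_comp[OF Suc])
qed simp

text \<open>The first and the last point of a random preorbit are both uniformly distributed.\<close>

lemma torus_mult_invariant:
  fixes G :: "'n::finite torus \<Rightarrow> real"
  assumes c: "c \<noteq> 0" and G [measurable]: "G \<in> borel_measurable borel"
  shows "(\<integral>p. G ((torus_mult c ^^ j) p) \<partial>torus_measure) = (\<integral>p. G p \<partial>torus_measure)"
proof -
  have "(\<integral>p. G ((torus_mult c ^^ j) p) \<partial>torus_measure) =
      (\<integral>z. G ((torus_mult c ^^ j) (abs_torus (preorbit c (fst z) (snd z) (j + 0)))) \<partial>natural_space c)"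
    by (subst integral_preorbit[OF c, symmetric]) auto
  also have "\<dots> = (\<integral>z. G (abs_torus (preorbit c (fst z) (snd z) 0)) \<partial>natural_space c)"
  proof (rule integral_cong_AE)
    show "AE z in natural_space c. G ((torus_mult c ^^ j) (abs_torus (preorbit c (fst z) (snd z) (j + 0)))) =
       G (abs_torus (preorbit c (fst z) (snd z) 0))"
      using AE_natural_int_vectors[OF c]
      by eventually_elim (subst torus_mult_funpow_preorbit[OF c], auto)
  qed measurable
  also have "\<dots> = (\<integral>p. G p \<partial>torus_measure)"
    by (rule integral_preorbit[OF c G])
  finally show ?thesis .
qed

lemma unit_cube_dist:
  assumes "x \<in> unit_cube" "y \<in> unit_cube"
  shows "norm (x - y :: real^'n) \<le> CARD('n)"
proof -
  have "\<bar>(x - y) $ i\<bar> \<le> 1" for i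
    using assms unfolding unit_cube_def by (simp add: abs_le_iff) (smt (verit))
  then have "(\<Sum>i\<in>UNIV. \<bar>(x - y) $ i\<bar>) \<le> (\<Sum>i\<in>(UNIV :: 'n set). 1)" by (intro sum_mono) auto
  then show ?thesis using norm_le_l1_cart[of "x - y"] by simp
qed

text \<open>Write the point as the end of a random preorbit of length \<open>l\<close> of \<open>x\<close>. Then the second factor is
\<open>F x\<close>, while the average \<open>U x\<close> of the first factor over the digits has mean zero and oscillates on
the cube by at most \<open>K * CARD('n) / \<bar>c\<bar> ^ l\<close>, hence is that small everywhere.\<close>

lemma correlation_bound:
  fixes F :: "'n::finite torus \<Rightarrow> real"
  assumes c: "c \<noteq> 0"
    and lip: "\<And>p q. \<bar>F p - F q\<bar> \<le> K * dist p q" and K: "0 \<le> K"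
    and bound: "\<And>p. \<bar>F p\<bar> \<le> B"
    and mean: "(\<integral>p. F p \<partial>torus_measure) = 0"
  shows "\<bar>\<integral>p. F p * F ((torus_mult c ^^ l) p) \<partial>torus_measure\<bar> \<le> B * (K * CARD('n)) * (1 / \<bar>of_int c\<bar>) ^ l"
proof -
  interpret P: prob_space "digit_space c :: (nat \<Rightarrow> real^'n) measure" by (rule prob_space_digits)
  interpret C: prob_space "cube_measure :: (real^'n) measure" by (rule prob_space_cube)
  interpret N: prob_space "natural_space c :: ((real^'n) \<times> (nat \<Rightarrow> real^'n)) measure" by (rule prob_space_natural)
  interpret CP: pair_sigma_finite "cube_measure :: (real^'n) measure" "digit_space c :: (nat \<Rightarrow> real^'n) measure" ..
  have B0: "0 \<le> B" using bound[of undefined] by linarith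
  have Fc: "continuous_on UNIV F" by (rule lipschitz_continuous[OF lip])
  then have F [measurable]: "F \<in> borel_measurable borel" by (rule borel_measurable_continuous_onI)
  let ?f = "\<lambda>z. F (abs_torus (preorbit c (fst z) (snd z) l))"
  define U where "U x = (\<integral>\<omega>. F (abs_torus (preorbit c x \<omega> l)) \<partial>digit_space c)" for x :: "real^'n"
  have fm: "?f \<in> borel_measurable (natural_space c)" by measurable
  have fm': "(\<lambda>\<omega>. F (abs_torus (preorbit c x \<omega> l))) \<in> borel_measurable (digit_space c)" for x :: "real^'n"
    using measurable_compose[OF measurable_Pair1' fm[unfolded natural_space_def], of x] by simp
  have intf: "integrable (natural_space c) (\<lambda>z. g (fst z) * ?f z)"
    if [measurable]: "g \<in> borel_measurable borel" and gb: "\<And>x. \<bar>g x\<bar> \<le> b" for g :: "real^'n \<Rightarrow> real" and b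
  proof (rule N.integrable_const_bound[where B = "b * B"])
    have "0 \<le> b" using gb[of undefined] by linarith
    then show "AE z in natural_space c. norm (g (fst z) * ?f z) \<le> b * B"
      by (auto intro!: AE_I2 mult_mono gb bound simp: abs_mult)
    have "(\<lambda>z. g (fst z)) \<in> borel_measurable (natural_space c)"
      unfolding natural_space_def by measurable
    then show "(\<lambda>z. g (fst z) * ?f z) \<in> borel_measurable (natural_space c)" by measurable
  qed
  have fub: "(\<integral>z. g (fst z) * ?f z \<partial>natural_space c) = (\<integral>x. g x * U x \<partial>cube_measure)"
    if g: "g \<in> borel_measurable borel" and gb: "\<And>x. \<bar>g x\<bar> \<le> b" for g :: "real^'n \<Rightarrow> real" and b
    using CP.integral_fst'[OF intf[OF g gb, unfolded natural_space_def]]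
    by (simp add: natural_space_def U_def)
  have Um [measurable]: "U \<in> borel_measurable cube_measure"
    unfolding U_def
    by (rule P.borel_measurable_lebesgue_integral) (use fm in \<open>simp add: natural_space_def split_beta'\<close>)
  have Ub: "\<bar>U x\<bar> \<le> B" for x
    unfolding U_def by (intro P.abs_expectation_le fm') (simp add: bound)
  have meanU: "(\<integral>x. U x \<partial>cube_measure) = 0"
    using fub[of "\<lambda>_. 1" 1] integral_preorbit[OF c F, of l] mean by simp
  let ?e = "K * CARD('n) * (1 / \<bar>of_int c\<bar>) ^ l"
  have diff: "\<bar>U x - U y\<bar> \<le> ?e" if xy: "x \<in> unit_cube" "y \<in> unit_cube" for x y
  proof -
    have int: "integrable (digit_space c) (\<lambda>\<omega>. F (abs_torus (preorbit c x \<omega> l)))" for x :: "real^'n"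
      by (rule P.integrable_const_bound[where B = B]) (auto simp: bound fm')
    have "U x - U y = (\<integral>\<omega>. F (abs_torus (preorbit c x \<omega> l)) - F (abs_torus (preorbit c y \<omega> l)) \<partial>digit_space c)"
      unfolding U_def using int by simp
    moreover have "\<bar>F (abs_torus (preorbit c x \<omega> l)) - F (abs_torus (preorbit c y \<omega> l))\<bar> \<le> ?e" for \<omega>
    proof -
      have "\<bar>F (abs_torus (preorbit c x \<omega> l)) - F (abs_torus (preorbit c y \<omega> l))\<bar> \<le>
          K * dist (abs_torus (preorbit c x \<omega> l)) (abs_torus (preorbit c y \<omega> l))" by (rule lip)
      also have "\<dots> \<le> K * norm (preorbit c x \<omega> l - preorbit c y \<omega> l)"
        using K dist_abs_torus_le by (intro mult_left_mono) (auto simp: dist_norm)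
      also have "\<dots> \<le> K * ((1 / \<bar>of_int c\<bar>) ^ l * CARD('n))"
      proof (rule mult_left_mono[OF _ K])
        have "norm (preorbit c x \<omega> l - preorbit c y \<omega> l) = (1 / \<bar>of_int c\<bar>) ^ l * norm (x - y)"
          by (simp add: preorbit_diff power_abs inverse_eq_divide)
        also have "\<dots> \<le> (1 / \<bar>of_int c\<bar>) ^ l * CARD('n)"
          by (intro mult_left_mono unit_cube_dist xy) auto
        finally show "norm (preorbit c x \<omega> l - preorbit c y \<omega> l) \<le> (1 / \<bar>of_int c\<bar>) ^ l * CARD('n)" .
      qed
      finally show ?thesis by (simp add: mult_ac)
    qed
    ultimately show ?thesis
      using fm' by (simp only:) (intro P.abs_expectation_le borel_measurable_diff AE_I2)
  qed
  have Usmall: "\<bar>U x\<bar> \<le> ?e" if x: "x \<in> unit_cube" for x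
  proof -
    have intU: "integrable cube_measure U"
      by (rule C.integrable_const_bound[where B = B]) (auto simp: Ub)
    have "U x = (\<integral>y. U x - U y \<partial>cube_measure)"
      using intU meanU C.prob_space by (subst Bochner_Integration.integral_diff) auto
    moreover have "\<bar>\<integral>y. U x - U y \<partial>cube_measure\<bar> \<le> ?e"
    proof (rule C.abs_expectation_le)
      show "AE y in cube_measure. \<bar>U x - U y\<bar> \<le> ?e"
        unfolding cube_measure_def
        by (subst AE_density) (auto intro!: AE_I2 diff x simp: indicator_def split: if_splits)
    qed measurable
    ultimately show ?thesis by simp
  qed
  let ?G = "\<lambda>p. F p * F ((torus_mult c ^^ l) p)"
  have "(\<integral>p. ?G p \<partial>torus_measure) = (\<integral>z. ?G (abs_torus (preorbit c (fst z) (snd z) l)) \<partial>natural_space c)"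
    by (rule integral_preorbit[OF c, symmetric]) measurable
  also have "\<dots> = (\<integral>z. F (abs_torus (fst z)) * ?f z \<partial>natural_space c)"
  proof (rule integral_cong_AE)
    show "AE z in natural_space c. ?G (abs_torus (preorbit c (fst z) (snd z) l)) = F (abs_torus (fst z)) * ?f z"
      using AE_natural_int_vectors[OF c]
    proof eventually_elim
      case (elim z)
      then have "(torus_mult c ^^ l) (abs_torus (preorbit c (fst z) (snd z) l)) = abs_torus (fst z)"
        using torus_mult_funpow_preorbit[OF c, of "snd z" l "fst z" 0] by simp
      then show ?case by simp
    qed
    have "(\<lambda>z. F (abs_torus (fst z))) \<in> borel_measurable (natural_space c)"
      using measurable_compose[OF measurable_abs_preorbit[where n = 0] F] by simp
    then show "(\<lambda>z. F (abs_torus (fst z)) * ?f z) \<in> borel_measurable (natural_space c)" by measurable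
  qed measurable
  also have "\<dots> = (\<integral>x. F (abs_torus x) * U x \<partial>cube_measure)"
    by (rule fub[of _ B]) (auto simp: bound)
  finally have eq: "(\<integral>p. ?G p \<partial>torus_measure) = (\<integral>x. F (abs_torus x) * U x \<partial>cube_measure)" .
  have "\<bar>\<integral>x. F (abs_torus x) * U x \<partial>cube_measure\<bar> \<le> B * ?e"
  proof (rule C.abs_expectation_le)
    show "(\<lambda>x. F (abs_torus x) * U x) \<in> borel_measurable cube_measure"
      using measurable_compose[OF measurable_abs_torus_cube F] by measurable
    show "AE x in cube_measure. \<bar>F (abs_torus x) * U x\<bar> \<le> B * ?e"
      unfolding cube_measure_def
      by (subst AE_density)
        (auto intro!: AE_I2 mult_mono bound Usmall B0 simp: abs_mult indicator_def split: if_splits)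
  qed
  then show ?thesis using eq by (simp add: mult.assoc)
qed

theorem torus_mult_equidistributes:
  assumes c: "\<bar>c\<bar> \<ge> 2"
  shows "AE p in (torus_measure :: 'n::finite torus measure). \<forall>H. continuous_on UNIV H \<longrightarrow>
    averages (\<lambda>k. (torus_mult c ^^ k) p) H \<longlonglongrightarrow> integral\<^sup>L torus_measure H"
proof -
  interpret T: prob_space "torus_measure :: 'n torus measure" by (rule prob_space_torus)
  have c0: "c \<noteq> 0" using c by auto
  obtain \<H> :: "('n torus \<Rightarrow> real) set" where H: "countable \<H>"
      "\<And>h. h \<in> \<H> \<Longrightarrow> \<exists>K. \<forall>p q. \<bar>h p - h q\<bar> \<le> K * dist p q"
      "\<And>\<nu> a H. prob_space \<nu> \<Longrightarrow> sets \<nu> = sets borel \<Longrightarrow>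
       (\<And>h. h \<in> \<H> \<Longrightarrow> averages a h \<longlonglongrightarrow> integral\<^sup>L \<nu> h) \<Longrightarrow>
       continuous_on UNIV H \<Longrightarrow> bounded (range H) \<Longrightarrow> averages a H \<longlonglongrightarrow> integral\<^sup>L \<nu> H"
    using countable_test_functions[where 'a = "'n torus"] by metis
  have "AE p in torus_measure. averages (\<lambda>k. (torus_mult c ^^ k) p) h \<longlonglongrightarrow> integral\<^sup>L torus_measure h"
    if h: "h \<in> \<H>" for h
  proof -
    obtain K' where K': "\<And>p q. \<bar>h p - h q\<bar> \<le> K' * dist p q" using H(2)[OF h] by blast
    define K where "K = max K' 0"
    have K: "\<bar>h p - h q\<bar> \<le> K * dist p q" "0 \<le> K" for p q
      using order_trans[OF K'[of p q] mult_right_mono[of K' K "dist p q"]] by (auto simp: K_def)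
    have hc: "continuous_on UNIV h" by (rule lipschitz_continuous[OF K(1)])
    then have hm [measurable]: "h \<in> borel_measurable borel" by (rule borel_measurable_continuous_onI)
    define I where "I = integral\<^sup>L torus_measure h"
    define F where "F p = h p - I" for p
    have Fc: "continuous_on UNIV F" unfolding F_def by (intro continuous_intros hc)
    have [measurable]: "F \<in> borel_measurable borel" unfolding F_def by measurable
    obtain B where B: "0 \<le> B" "\<And>p. \<bar>F p\<bar> \<le> B" using bounded_continuous_torus[OF Fc] by blast
    obtain B' where B': "\<And>p. \<bar>h p\<bar> \<le> B'" using bounded_continuous_torus[OF hc] by blast
    have inth: "integrable torus_measure h"
      by (rule T.integrable_const_bound[where B = B']) (auto simp: B')
    have mean: "(\<integral>p. F p \<partial>torus_measure) = 0"
      unfolding F_def using inth T.prob_space by (subst Bochner_Integration.integral_diff) (auto simp: I_def)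
    have lipF: "\<bar>F p - F q\<bar> \<le> K * dist p q" for p q using K(1)[of p q] by (simp add: F_def)
    define X where "X k p = F ((torus_mult c ^^ k) p)" for k p
    have Xm [measurable]: "X k \<in> borel_measurable torus_measure" for k unfolding X_def by measurable
    have Xb: "\<bar>X k p\<bar> \<le> B" for k p by (simp add: X_def B)
    have cov: "(\<integral>p. X j p * X k p \<partial>torus_measure) \<le> B * (K * CARD('n)) * (1 / \<bar>of_int c\<bar>) ^ (k - j)" if jk: "j \<le> k" for j k
    proof -
      have e: "(torus_mult c ^^ k) p = (torus_mult c ^^ (k - j)) ((torus_mult c ^^ j) p)" for p :: "'n torus"
        using jk by (metis comp_apply funpow_add le_add_diff_inverse2)
      have "(\<integral>p. X j p * X k p \<partial>torus_measure) =
        (\<integral>p. (\<lambda>p. F p * F ((torus_mult c ^^ (k - j)) p)) ((torus_mult c ^^ j) p) \<partial>torus_measure)"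
        unfolding X_def by (simp only: e[symmetric])
      also have "\<dots> = (\<integral>p. F p * F ((torus_mult c ^^ (k - j)) p) \<partial>torus_measure)"
        by (rule torus_mult_invariant[OF c0]) measurable
      also have "\<dots> \<le> B * (K * CARD('n)) * (1 / \<bar>of_int c\<bar>) ^ (k - j)"
        using correlation_bound[OF c0 lipF K(2) B(2) mean, of "k - j"] by (rule abs_le_D1)
      finally show ?thesis .
    qed
    have r: "0 \<le> 1 / \<bar>real_of_int c\<bar>" "1 / \<bar>real_of_int c\<bar> < 1"
      using c by (auto simp flip: of_int_abs)
    have D: "0 \<le> B * (K * CARD('n))" using B K by simp
    have "AE p in torus_measure. (\<lambda>n. (\<Sum>k<n. X k p) / real n) \<longlonglongrightarrow> 0"
      by (rule averages_tendsto_zero[OF prob_space_torus Xm Xb second_moment_bound[OF prob_space_torus Xm Xb cov r D]])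
    then show ?thesis
    proof eventually_elim
      case (elim p)
      have "averages (\<lambda>k. (torus_mult c ^^ k) p) h n = I + (\<Sum>k<n. X k p) / real n" if "n > 0" for n
        using that by (simp add: averages_def X_def F_def sum_subtractf diff_divide_distrib)
      then have "eventually (\<lambda>n. I + (\<Sum>k<n. X k p) / real n = averages (\<lambda>k. (torus_mult c ^^ k) p) h n) sequentially"
        by (intro eventually_sequentiallyI[of 1]) simp
      moreover have "(\<lambda>n. I + (\<Sum>k<n. X k p) / real n) \<longlonglongrightarrow> I + 0"
        by (intro tendsto_add tendsto_const elim)
      ultimately have "averages (\<lambda>k. (torus_mult c ^^ k) p) h \<longlonglongrightarrow> I + 0"
        by (rule Lim_transform_eventually[rotated])
      then show ?case unfolding I_def[symmetric] by simp
    qed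
  qed
  then have "AE p in torus_measure. \<forall>h\<in>\<H>. averages (\<lambda>k. (torus_mult c ^^ k) p) h \<longlonglongrightarrow> integral\<^sup>L torus_measure h"
    by (subst AE_ball_countable[OF H(1)]) blast
  then show ?thesis
  proof eventually_elim
    case (elim p)
    show ?case
    proof (intro allI impI)
      fix h :: "'n torus \<Rightarrow> real" assume h: "continuous_on UNIV h"
      show "averages (\<lambda>k. (torus_mult c ^^ k) p) h \<longlonglongrightarrow> integral\<^sup>L torus_measure h"
      proof (rule H(3)[OF prob_space_torus sets_torus_measure bspec[OF elim] h])
        show "bounded (range h)"
          using compact_imp_bounded[OF compact_continuous_image[OF h compact_torus]] .
      qed
    qed
  qed
qed

section \<open>The SRB measure of the skew product\<close>

abbreviation scaled_skew :: "int \<Rightarrow> real \<Rightarrow> ('n::finite torus \<Rightarrow> real) \<Rightarrow> 'n torus \<times> real \<Rightarrow> 'n torus \<times> real"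
  where "scaled_skew c lam g \<equiv> skew_product (\<lambda>x. of_int c *\<^sub>R x) (\<lambda>y. lam * y) g"

text \<open>The second coordinate, at time zero, of the orbit that comes from the infinite past along the
preorbit described by \<open>z\<close>.\<close>

definition fibre :: "int \<Rightarrow> real \<Rightarrow> ('n::finite torus \<Rightarrow> real) \<Rightarrow> (real^'n) \<times> (nat \<Rightarrow> real^'n) \<Rightarrow> real"
  where "fibre c lam g z = (\<Sum>n. lam ^ n * g (abs_torus (preorbit c (fst z) (snd z) (Suc n))))"

definition solenoid_measure :: "int \<Rightarrow> real \<Rightarrow> ('n::finite torus \<Rightarrow> real) \<Rightarrow> ('n torus \<times> real) measure"
  where "solenoid_measure c lam g = distr (natural_space c) borel (\<lambda>z. (abs_torus (fst z), fibre c lam g z))"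

lemma scaled_skew_eq: "scaled_skew c lam g (p, y) = (torus_mult c p, lam * y + g p)"
  by (simp add: skew_product_def torus_mult_def)

lemma fst_funpow_skew: "fst ((scaled_skew c lam g ^^ k) z) = (torus_mult c ^^ k) (fst z)"
  by (induction k) (auto simp: skew_product_def torus_mult_def split: prod.splits)

text \<open>Orbits over the same base point approach each other, so averages do not depend on the initial
height.\<close>

lemma snd_funpow_skew_contracts:
  "snd ((scaled_skew c lam g ^^ m) (p, y)) - snd ((scaled_skew c lam g ^^ m) (p, y')) = lam ^ m * (y - y')"
proof (induction m)
  case (Suc m)
  let ?T = "scaled_skew c lam g"
  have "snd ((?T ^^ Suc m) (p, t)) = lam * snd ((?T ^^ m) (p, t)) + g ((torus_mult c ^^ m) p)" for t
    using fst_funpow_skew[of m c lam g "(p, t)"]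
    by (cases "(?T ^^ m) (p, t)") (simp add: scaled_skew_eq)
  then have "snd ((?T ^^ Suc m) (p, y)) - snd ((?T ^^ Suc m) (p, y')) =
      lam * (snd ((?T ^^ m) (p, y)) - snd ((?T ^^ m) (p, y')))"
    by (simp only:) (simp add: algebra_simps)
  then show ?case by (simp only: Suc) simp
qed simp

lemma snd_funpow_skew_bound:
  assumes lam: "0 \<le> lam" "lam < 1" and g: "\<And>p. \<bar>g p\<bar> \<le> G"
  shows "\<bar>snd ((scaled_skew c lam g ^^ k) (p, y))\<bar> \<le> \<bar>y\<bar> + G / (1 - lam)"
proof (induction k)
  case 0
  have "0 \<le> G" using g[of undefined] by linarith
  then show ?case using lam by simp
next
  case (Suc k)
  let ?T = "scaled_skew c lam g"
  obtain q s where qs: "(?T ^^ k) (p, y) = (q, s)" by fastforce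
  have "\<bar>lam * s + g q\<bar> \<le> lam * \<bar>s\<bar> + G"
    using g[of q] lam abs_triangle_ineq[of "lam * s" "g q"] by (simp add: abs_mult)
  also have "\<dots> \<le> lam * (\<bar>y\<bar> + G / (1 - lam)) + G"
    using Suc lam qs by (intro add_mono mult_left_mono) auto
  also have "\<dots> = lam * \<bar>y\<bar> + G / (1 - lam)"
    using lam by (simp add: field_simps)
  also have "\<dots> \<le> \<bar>y\<bar> + G / (1 - lam)"
    using lam mult_right_mono[of lam 1 "\<bar>y\<bar>"] by simp
  finally show ?case by (simp add: qs scaled_skew_eq)
qed

lemma skew_funpow_preorbit:
  assumes "c \<noteq> 0" "\<And>n. \<omega> n \<in> int_vectors"
  shows "(scaled_skew c lam g ^^ m) (abs_torus (preorbit c x \<omega> m), y) =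
    (abs_torus x, lam ^ m * y + (\<Sum>j<m. lam ^ j * g (abs_torus (preorbit c x \<omega> (Suc j)))))"
proof (induction m arbitrary: y)
  case (Suc m)
  have "(scaled_skew c lam g ^^ Suc m) (abs_torus (preorbit c x \<omega> (Suc m)), y) =
      (scaled_skew c lam g ^^ m) (abs_torus (preorbit c x \<omega> m), lam * y + g (abs_torus (preorbit c x \<omega> (Suc m))))"
    unfolding funpow_Suc_right comp_apply scaled_skew_eq torus_mult_preorbit[OF assms(1) assms(2)] ..
  then show ?case by (simp only: Suc) (simp add: algebra_simps)
qed simp

lemma continuous_skew:
  assumes "continuous_on UNIV g"
  shows "continuous_on UNIV (scaled_skew c lam g)"
proof -
  have "continuous_on UNIV (\<lambda>z. (torus_mult c (fst z), lam * snd z + g (fst z)))"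
    by (intro continuous_intros continuous_on_compose2[OF continuous_torus_mult]
        continuous_on_compose2[OF assms]) auto
  then show ?thesis by (simp add: skew_product_def torus_mult_def case_prod_unfold)
qed

lemma continuous_funpow:
  fixes T :: "'a::topological_space \<Rightarrow> 'a"
  assumes "continuous_on UNIV T"
  shows "continuous_on UNIV (T ^^ k)"
proof (induction k)
  case (Suc k)
  then show ?case unfolding funpow.simps comp_def by (rule continuous_on_compose2[OF assms]) auto
qed (simp add: id_def)

lemma fibre_summable:
  fixes g :: "'n::finite torus \<Rightarrow> real"
  assumes lam: "0 \<le> lam" "lam < 1" and g: "\<And>p. \<bar>g p\<bar> \<le> G"
  shows "summable (\<lambda>n. lam ^ n * g (abs_torus (preorbit c x \<omega> (Suc n))))"
proof -
  have s: "summable (\<lambda>n. lam ^ n * G)" using lam by (intro summable_mult2 summable_geometric) auto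
  have "norm (lam ^ n * g (abs_torus (preorbit c x \<omega> (Suc n)))) \<le> lam ^ n * G" for n
    using lam g by (simp add: abs_mult mult_left_mono)
  then show ?thesis by (rule summable_comparison_test'[OF s])
qed

lemma measurable_fibre [measurable]:
  fixes g :: "'n::finite torus \<Rightarrow> real"
  assumes [measurable]: "g \<in> borel_measurable borel"
  shows "fibre c lam g \<in> borel_measurable (natural_space c)"
  unfolding fibre_def by measurable

lemma measurable_abs_fst_natural [measurable]:
  "(\<lambda>z. abs_torus (fst z)) \<in> measurable (natural_space c) (borel :: ('n::finite torus) measure)"
  using measurable_abs_preorbit[where n = 0] by simp

lemma measurable_solenoid_map [measurable]:
  fixes g :: "'n::finite torus \<Rightarrow> real"
  assumes [measurable]: "g \<in> borel_measurable borel"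
  shows "(\<lambda>z. (abs_torus (fst z), fibre c lam g z)) \<in> borel_measurable (natural_space c)"
  unfolding borel_prod[symmetric] by measurable

lemma bounded_range_real:
  fixes h :: "'a \<Rightarrow> real"
  assumes "bounded (range h)"
  obtains b where "\<And>v. \<bar>h v\<bar> \<le> b"
  using assms unfolding bounded_iff by (metis rangeI real_norm_def)

lemma averages_shift:
  assumes b: "\<And>k. \<bar>f k\<bar> \<le> b"
  shows "\<bar>(\<Sum>k<n. f (k + m)) - (\<Sum>k<n. f k)\<bar> \<le> 2 * b * real m"
proof (induction m)
  case (Suc m)
  have "(\<Sum>k<n. f (k + Suc m)) - (\<Sum>k<n. f (k + m)) = f (n + m) - f m"
    using sum_lessThan_telescope[of "\<lambda>k. f (k + m)" n] by (simp add: sum_subtractf)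
  then show ?case using Suc b[of "n + m"] b[of m] by (simp add: algebra_simps abs_le_iff)
qed simp

lemma weakly_converges_averages:
  assumes "weakly_converges (empirical_measure T z) \<mu>" "continuous_on UNIV h" "bounded (range h)"
  shows "averages (\<lambda>k. (T ^^ k) z) h \<longlonglongrightarrow> integral\<^sup>L \<mu> h"
proof -
  have "h \<in> borel_measurable borel" using assms(2) by (rule borel_measurable_continuous_onI)
  then have "averages (\<lambda>k. (T ^^ k) z) h = (\<lambda>n. integral\<^sup>L (empirical_measure T z n) h)"
    by (simp add: fun_eq_iff integral_empirical_measure averages_def)
  then show ?thesis using assms by (simp add: weakly_converges_def)
qed

text \<open>Up to an error that is uniformly small for large \<open>m\<close>, the point of the orbit at time \<open>k + m\<close> is the
image under \<open>m\<close> steps of the base point at time \<open>k\<close> with height zero, so the averages along the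
orbit are averages of the continuous function \<open>H m\<close> along the base orbit. The integral of \<open>H m\<close> is
computed at the end of a random preorbit of length \<open>m\<close>, where \<open>m\<close> steps of the map produce a partial
sum of \<open>fibre\<close>.\<close>

lemma generic_converges_solenoid:
  fixes g :: "'n::finite torus \<Rightarrow> real"
  assumes c: "c \<noteq> 0" and lam: "0 \<le> lam" "lam < 1" and g: "continuous_on UNIV g"
    and p: "\<And>H. continuous_on UNIV H \<Longrightarrow> averages (\<lambda>k. (torus_mult c ^^ k) p) H \<longlonglongrightarrow> integral\<^sup>L torus_measure H"
  shows "weakly_converges (empirical_measure (scaled_skew c lam g) (p, y)) (solenoid_measure c lam g)"
  unfolding weakly_converges_def
proof (intro allI impI)
  let ?T = "scaled_skew c lam g"
  fix h :: "'n torus \<times> real \<Rightarrow> real" assume "continuous_on UNIV h \<and> bounded (range h)"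
  then have h: "continuous_on UNIV h" and "bounded (range h)" by auto
  then obtain b where b: "\<And>v. \<bar>h v\<bar> \<le> b" using bounded_range_real by blast
  have hm [measurable]: "h \<in> borel_measurable borel" using h by (rule borel_measurable_continuous_onI)
  have gm [measurable]: "g \<in> borel_measurable borel" using g by (rule borel_measurable_continuous_onI)
  interpret N: prob_space "natural_space c :: ((real^'n) \<times> (nat \<Rightarrow> real^'n)) measure" by (rule prob_space_natural)
  obtain G where G: "0 \<le> G" "\<And>p. \<bar>g p\<bar> \<le> G" using bounded_continuous_torus[OF g] by blast
  define B where "B = \<bar>y\<bar> + G / (1 - lam)"
  have snd_bound: "\<bar>snd ((?T ^^ k) (q, t))\<bar> \<le> \<bar>t\<bar> + G / (1 - lam)" for k q t
    by (rule snd_funpow_skew_bound[OF lam]) (rule G(2))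
  have B0: "0 \<le> B" using G lam by (simp add: B_def)
  define I where "I = integral\<^sup>L (solenoid_measure c lam g) h"
  have I: "I = (\<integral>z. h (abs_torus (fst z), fibre c lam g z) \<partial>natural_space c)"
    unfolding I_def solenoid_measure_def by (rule integral_distr) measurable
  define H where "H m q = h ((?T ^^ m) (q, 0))" for m q
  have Hc: "continuous_on UNIV (H m)" for m
    unfolding H_def
    by (intro continuous_on_compose2[OF h] continuous_on_compose2[OF continuous_funpow[OF continuous_skew[OF g]]]
        continuous_intros) auto
  have Hint: "integral\<^sup>L torus_measure (H m) =
    (\<integral>z. h (abs_torus (fst z), \<Sum>j<m. lam ^ j * g (abs_torus (preorbit c (fst z) (snd z) (Suc j)))) \<partial>natural_space c)" for m
  proof -
    have [measurable]: "H m \<in> borel_measurable borel" by (rule borel_measurable_continuous_onI[OF Hc])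
    have "integral\<^sup>L torus_measure (H m) = (\<integral>z. H m (abs_torus (preorbit c (fst z) (snd z) m)) \<partial>natural_space c)"
      by (rule integral_preorbit[OF c, symmetric]) measurable
    also have "\<dots> = (\<integral>z. h (abs_torus (fst z), \<Sum>j<m. lam ^ j * g (abs_torus (preorbit c (fst z) (snd z) (Suc j)))) \<partial>natural_space c)"
    proof (rule integral_cong_AE)
      show "AE z in natural_space c. H m (abs_torus (preorbit c (fst z) (snd z) m)) =
          h (abs_torus (fst z), \<Sum>j<m. lam ^ j * g (abs_torus (preorbit c (fst z) (snd z) (Suc j))))"
        using AE_natural_int_vectors[OF c]
      proof eventually_elim
        case (elim z)
        then show ?case using skew_funpow_preorbit[OF c, of "snd z" m lam g "fst z" 0] by (simp add: H_def)
      qed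
      show "(\<lambda>z. h (abs_torus (fst z), \<Sum>j<m. lam ^ j * g (abs_torus (preorbit c (fst z) (snd z) (Suc j)))))
          \<in> borel_measurable (natural_space c)"
        by (rule measurable_compose[OF _ hm]) (unfold borel_prod[symmetric], measurable)
    qed measurable
    finally show ?thesis .
  qed
  have Hlim: "(\<lambda>m. integral\<^sup>L torus_measure (H m)) \<longlonglongrightarrow> I"
    unfolding Hint I
  proof (rule integral_dominated_convergence[where w = "\<lambda>_. b"])
    show "(\<lambda>z. h (abs_torus (fst z), fibre c lam g z)) \<in> borel_measurable (natural_space c)"
      by (rule measurable_compose[OF _ hm]) measurable
    show "(\<lambda>z. h (abs_torus (fst z), \<Sum>j<m. lam ^ j * g (abs_torus (preorbit c (fst z) (snd z) (Suc j)))))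
          \<in> borel_measurable (natural_space c)" for m
      by (rule measurable_compose[OF _ hm]) (unfold borel_prod[symmetric], measurable)
    show "AE z in natural_space c. (\<lambda>m. h (abs_torus (fst z), \<Sum>j<m. lam ^ j * g (abs_torus (preorbit c (fst z) (snd z) (Suc j)))))
       \<longlonglongrightarrow> h (abs_torus (fst z), fibre c lam g z)"
    proof (rule AE_I2)
      fix z :: "(real^'n) \<times> (nat \<Rightarrow> real^'n)"
      have "isCont h v" for v
        using h unfolding continuous_on_eq_continuous_at[OF open_UNIV] by blast
      moreover have "(\<lambda>m. (abs_torus (fst z), \<Sum>j<m. lam ^ j * g (abs_torus (preorbit c (fst z) (snd z) (Suc j)))))
         \<longlonglongrightarrow> (abs_torus (fst z), fibre c lam g z)"
        unfolding fibre_def by (intro tendsto_Pair tendsto_const summable_LIMSEQ fibre_summable[OF lam G(2)])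
      ultimately show "(\<lambda>m. h (abs_torus (fst z), \<Sum>j<m. lam ^ j * g (abs_torus (preorbit c (fst z) (snd z) (Suc j)))))
         \<longlonglongrightarrow> h (abs_torus (fst z), fibre c lam g z)"
        by (rule isCont_tendsto_compose)
    qed
  qed (auto simp: b)
  let ?K = "(UNIV :: 'n torus set) \<times> cball (0::real) B"
  have "compact ?K" by (intro compact_Times compact_torus compact_cball)
  then have uc: "uniformly_continuous_on ?K h"
    using h by (intro compact_uniformly_continuous continuous_on_subset[OF h]) auto
  have "averages (\<lambda>k. (?T ^^ k) (p, y)) h \<longlonglongrightarrow> I"
  proof (rule LIMSEQ_I)
    fix e :: real assume e: "e > 0"
    then obtain d where d: "d > 0" "\<And>u v. u \<in> ?K \<Longrightarrow> v \<in> ?K \<Longrightarrow> dist v u < d \<Longrightarrow> dist (h v) (h u) < e / 4"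
      using uc unfolding uniformly_continuous_on_def by (metis divide_pos_pos zero_less_numeral)
    have "(\<lambda>m. lam ^ m * B) \<longlonglongrightarrow> 0 * B"
      using lam by (intro tendsto_mult tendsto_const LIMSEQ_realpow_zero)
    then have "eventually (\<lambda>m. lam ^ m * B < d) sequentially" using d(1) by (auto intro: order_tendstoD)
    moreover have "eventually (\<lambda>m. dist (integral\<^sup>L torus_measure (H m)) I < e / 4) sequentially"
      using e by (intro tendstoD[OF Hlim]) auto
    ultimately have "eventually (\<lambda>m. lam ^ m * B < d \<and> dist (integral\<^sup>L torus_measure (H m)) I < e / 4) sequentially"
      by (rule eventually_conj)
    then obtain m where m: "lam ^ m * B < d" "dist (integral\<^sup>L torus_measure (H m)) I < e / 4"
      by (auto simp: eventually_sequentially)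
    have close: "\<bar>h ((?T ^^ (k + m)) (p, y)) - H m ((torus_mult c ^^ k) p)\<bar> \<le> e / 4" for k
    proof -
      define s where "s = snd ((?T ^^ k) (p, y))"
      have s: "\<bar>s\<bar> \<le> B" unfolding s_def B_def by (rule snd_bound)
      have e1: "(?T ^^ k) (p, y) = ((torus_mult c ^^ k) p, s)"
        using fst_funpow_skew[of k c lam g "(p, y)"] by (simp add: s_def prod_eq_iff)
      let ?q = "(torus_mult c ^^ k) p"
      let ?u = "(?T ^^ m) (?q, s)" and ?v = "(?T ^^ m) (?q, 0)"
      have u: "?u = (?T ^^ (k + m)) (p, y)" by (simp add: funpow_add add.commute[of k] e1)
      have f: "fst ?u = fst ?v" by (simp add: fst_funpow_skew)
      have "snd ?u = snd ((?T ^^ (k + m)) (p, y))" by (simp only: u)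
      then have "\<bar>snd ?u\<bar> \<le> B" unfolding B_def by (simp only: snd_bound)
      moreover have "\<bar>snd ?v\<bar> \<le> B"
        unfolding B_def using snd_bound[of m ?q 0] by simp
      ultimately have uK: "?u \<in> ?K" and vK: "?v \<in> ?K" by (auto simp: mem_Times_iff)
      have duv: "dist ?u ?v < d"
      proof -
        have "dist ?u ?v = \<bar>snd ?u - snd ?v\<bar>" using f by (simp add: dist_prod_def dist_real_def)
        also have "\<dots> = lam ^ m * \<bar>s\<bar>"
          unfolding snd_funpow_skew_contracts using lam by (simp add: abs_mult)
        also have "\<dots> \<le> lam ^ m * B" using s lam by (intro mult_left_mono) auto
        finally show ?thesis using m(1) by simp
      qed
      have "dist (h ?u) (h ?v) < e / 4" by (rule d(2)[OF vK uK duv])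
      then show ?thesis by (simp add: u H_def dist_real_def)
    qed
    have "eventually (\<lambda>n. dist (averages (\<lambda>k. (torus_mult c ^^ k) p) (H m) n) (integral\<^sup>L torus_measure (H m)) < e / 4) sequentially"
      using e by (intro tendstoD[OF p[OF Hc]]) auto
    moreover have "eventually (\<lambda>n. 2 * b * real m / real n < e / 4) sequentially"
    proof -
      have "(\<lambda>n. 2 * b * real m / real n) \<longlonglongrightarrow> 0" by (rule lim_const_over_n)
      then show ?thesis using e by (intro order_tendstoD) auto
    qed
    moreover note eventually_gt_at_top[of "0 :: nat"]
    ultimately have "eventually (\<lambda>n. norm (averages (\<lambda>k. (?T ^^ k) (p, y)) h n - I) < e) sequentially"
    proof eventually_elim
      case (elim n)
      let ?f = "\<lambda>k. h ((?T ^^ k) (p, y))"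
      have "\<bar>(\<Sum>k<n. ?f (k + m)) - (\<Sum>k<n. ?f k)\<bar> / real n \<le> 2 * b * real m / real n"
        by (intro divide_right_mono averages_shift b) auto
      then have 1: "\<bar>(\<Sum>k<n. ?f (k + m)) / real n - (\<Sum>k<n. ?f k) / real n\<bar> \<le> 2 * b * real m / real n"
        by (simp add: diff_divide_distrib[symmetric])
      have "\<bar>(\<Sum>k<n. ?f (k + m)) - (\<Sum>k<n. H m ((torus_mult c ^^ k) p))\<bar> \<le> (\<Sum>k<n. e / 4)"
        unfolding sum_subtractf[symmetric] by (rule order_trans[OF sum_abs sum_mono]) (rule close)
      then have "\<bar>(\<Sum>k<n. ?f (k + m)) - (\<Sum>k<n. H m ((torus_mult c ^^ k) p))\<bar> / real n \<le> (real n * (e / 4)) / real n"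
        by (intro divide_right_mono) auto
      then have 2: "\<bar>(\<Sum>k<n. ?f (k + m)) / real n - (\<Sum>k<n. H m ((torus_mult c ^^ k) p)) / real n\<bar> \<le> e / 4"
        using elim(3) by (simp add: diff_divide_distrib[symmetric])
      show ?case using 1 2 elim m(2) unfolding averages_def dist_real_def real_norm_def by linarith
    qed
    then show "\<exists>no. \<forall>n\<ge>no. norm (averages (\<lambda>k. (?T ^^ k) (p, y)) h n - I) < e"
      by (simp add: eventually_sequentially)
  qed
  moreover have "averages (\<lambda>k. (?T ^^ k) (p, y)) h = (\<lambda>n. integral\<^sup>L (empirical_measure ?T (p, y) n) h)"
    by (simp add: fun_eq_iff integral_empirical_measure[OF hm] averages_def)
  ultimately show "(\<lambda>n. integral\<^sup>L (empirical_measure ?T (p, y) n) h) \<longlonglongrightarrow> integral\<^sup>L (solenoid_measure c lam g) h"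
    by (simp add: I_def)
qed

lemma volume_nontrivial: "emeasure (volume_measure :: ('n::finite torus \<times> real) measure) UNIV \<noteq> 0"
proof -
  have "emeasure (volume_measure :: ('n torus \<times> real) measure) (UNIV \<times> UNIV) =
      emeasure (torus_measure :: 'n torus measure) UNIV * emeasure (lborel :: real measure) UNIV"
    unfolding volume_measure_def by (rule lborel.emeasure_pair_measure_Times) auto
  moreover have "emeasure (torus_measure :: 'n torus measure) UNIV = 1"
  proof -
    have "emeasure (torus_measure :: 'n torus measure) (space torus_measure) = 1"
      by (rule prob_space.emeasure_space_1[OF prob_space_torus])
    then show ?thesis by (simp add: sets_eq_imp_space_eq[OF sets_torus_measure])
  qed
  ultimately show ?thesis by simp
qed

lemma space_volume [simp]: "space volume_measure = UNIV"
  using sets_eq_imp_space_eq[OF sets_volume_measure] by simp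

lemma AE_volume_ex:
  assumes "AE z in (volume_measure :: ('n::finite torus \<times> real) measure). P z"
  shows "\<exists>z. P z"
proof -
  have "ae_filter (volume_measure :: ('n torus \<times> real) measure) \<noteq> bot"
    using volume_nontrivial by (simp add: ae_filter_eq_bot_iff)
  then show ?thesis using assms eventually_happens' by blast
qed

text \<open>Convergence holds over the equidistributing base points, for every height. Invariance of the limit
follows from convergence along one orbit, as a shift in time does not change limits of averages.\<close>

theorem is_SRB_solenoid:
  fixes g :: "'n::finite torus \<Rightarrow> real"
  assumes c: "\<bar>c\<bar> \<ge> 2" and lam: "0 \<le> lam" "lam < 1" and g: "continuous_on UNIV g"
  shows "is_SRB_measure (scaled_skew c lam g) (solenoid_measure c lam g)"
proof -
  let ?T = "scaled_skew c lam g" and ?\<mu> = "solenoid_measure c lam g"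
  have c0: "c \<noteq> 0" using c by auto
  have gm [measurable]: "g \<in> borel_measurable borel" using g by (rule borel_measurable_continuous_onI)
  have prob: "prob_space ?\<mu>"
    unfolding solenoid_measure_def by (rule prob_space.prob_space_distr[OF prob_space_natural]) measurable
  have sets: "sets ?\<mu> = sets borel" by (simp add: solenoid_measure_def)
  have Tc: "continuous_on UNIV ?T" by (rule continuous_skew[OF g])
  then have Tm: "?T \<in> borel_measurable borel" by (rule borel_measurable_continuous_onI)
  have Tmu: "?T \<in> measurable ?\<mu> ?\<mu>" using Tm by (simp cong: measurable_cong_sets add: sets)
  have Tmub: "?T \<in> measurable ?\<mu> borel" using Tm by (simp cong: measurable_cong_sets add: sets)
  interpret TT: prob_space "torus_measure :: 'n torus measure" by (rule prob_space_torus)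
  interpret TL: pair_sigma_finite "torus_measure :: 'n torus measure" "lborel :: real measure" ..
  have AE: "AE z in volume_measure. weakly_converges (empirical_measure ?T z) ?\<mu>"
  proof -
    obtain N where N: "N \<in> null_sets (torus_measure :: 'n torus measure)"
      "\<And>p. p \<notin> N \<Longrightarrow> \<forall>H. continuous_on UNIV H \<longrightarrow>
        averages (\<lambda>k. (torus_mult c ^^ k) p) H \<longlonglongrightarrow> integral\<^sup>L torus_measure H"
      using torus_mult_equidistributes[OF c, where 'n = 'n]
      unfolding eventually_ae_filter by (auto simp: sets_eq_imp_space_eq[OF sets_torus_measure])
    have "N \<times> UNIV \<in> null_sets (volume_measure :: ('n torus \<times> real) measure)"
      unfolding volume_measure_def using N(1)
      by (intro null_setsI) (auto simp: lborel.emeasure_pair_measure_Times null_sets_def)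
    moreover have "weakly_converges (empirical_measure ?T z) ?\<mu>" if "z \<notin> N \<times> UNIV" for z
      using generic_converges_solenoid[OF c0 lam g, of "fst z" "snd z"] N(2)[of "fst z"] that
      by (cases z) auto
    ultimately show ?thesis by (intro AE_I') auto
  qed
  then obtain z where z: "weakly_converges (empirical_measure ?T z) ?\<mu>" using AE_volume_ex by blast
  \<comment> \<open>Invariance, read off from the averages along the orbit of \<open>z\<close>.\<close>
  have "distr ?\<mu> borel ?T = ?\<mu>"
  proof (rule measure_eq_by_continuous)
    show "prob_space (distr ?\<mu> borel ?T)" by (rule prob_space.prob_space_distr[OF prob Tmub])
    fix h :: "'n torus \<times> real \<Rightarrow> real" assume h: "continuous_on UNIV h" and hb: "bounded (range h)"
    have hm: "h \<in> borel_measurable borel" using h by (rule borel_measurable_continuous_onI)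
    obtain b where b: "\<And>v. \<bar>h v\<bar> \<le> b" using bounded_range_real[OF hb] by blast
    have hT: "continuous_on UNIV (\<lambda>z. h (?T z))" by (rule continuous_on_compose2[OF h Tc]) auto
    have hTb: "bounded (range (\<lambda>z. h (?T z)))" by (rule bounded_subset[OF hb]) auto
    have 1: "averages (\<lambda>k. (?T ^^ k) z) (\<lambda>z. h (?T z)) \<longlonglongrightarrow> (\<integral>z. h (?T z) \<partial>?\<mu>)"
      by (rule weakly_converges_averages[OF z hT hTb])
    have 2: "averages (\<lambda>k. (?T ^^ k) z) h \<longlonglongrightarrow> integral\<^sup>L ?\<mu> h"
      by (rule weakly_converges_averages[OF z h hb])
    have "(\<lambda>n. averages (\<lambda>k. (?T ^^ k) z) (\<lambda>z. h (?T z)) n - averages (\<lambda>k. (?T ^^ k) z) h n) \<longlonglongrightarrow> 0"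
    proof (rule Lim_null_comparison)
      show "\<forall>\<^sub>F n in sequentially. norm (averages (\<lambda>k. (?T ^^ k) z) (\<lambda>z. h (?T z)) n - averages (\<lambda>k. (?T ^^ k) z) h n)
         \<le> 2 * b * real 1 / real n"
      proof (rule always_eventually, rule allI)
        fix n
        have "\<bar>(\<Sum>k<n. h ((?T ^^ (k + 1)) z)) - (\<Sum>k<n. h ((?T ^^ k) z))\<bar> / real n \<le> 2 * b * real 1 / real n"
          by (intro divide_right_mono averages_shift[where f = "\<lambda>k. h ((?T ^^ k) z)"] b) auto
        then show "norm (averages (\<lambda>k. (?T ^^ k) z) (\<lambda>z. h (?T z)) n - averages (\<lambda>k. (?T ^^ k) z) h n) \<le> 2 * b * real 1 / real n"
          by (simp add: averages_def diff_divide_distrib[symmetric])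
      qed
      show "(\<lambda>n. 2 * b * real 1 / real n) \<longlonglongrightarrow> 0" by (rule lim_const_over_n)
    qed
    from LIMSEQ_unique[OF this tendsto_diff[OF 1 2]]
    have "(\<integral>z. h (?T z) \<partial>?\<mu>) = integral\<^sup>L ?\<mu> h" by simp
    then show "integral\<^sup>L (distr ?\<mu> borel ?T) h = integral\<^sup>L ?\<mu> h"
      by (subst integral_distr[OF Tmub hm])
  qed (simp_all add: prob sets)
  moreover have "distr ?\<mu> ?\<mu> ?T = distr ?\<mu> borel ?T" by (rule distr_cong) (auto simp: sets)
  ultimately show ?thesis
    unfolding is_SRB_measure_def using prob sets Tmu AE by simp
qed

text \<open>Two SRB measures are limits along a common orbit, because the volume is not the zero measure.\<close>

theorem SRB_measure_eq_solenoid: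
  fixes g :: "'n::finite torus \<Rightarrow> real"
  assumes "\<bar>c\<bar> \<ge> 2" "0 \<le> lam" "lam < 1" "continuous_on UNIV g"
  shows "SRB_measure (scaled_skew c lam g) = solenoid_measure c lam g"
  unfolding SRB_measure_def
proof (rule the_equality)
  let ?T = "scaled_skew c lam g" and ?\<mu> = "solenoid_measure c lam g"
  show S: "is_SRB_measure ?T ?\<mu>" by (rule is_SRB_solenoid[OF assms])
  fix \<nu> assume N: "is_SRB_measure ?T \<nu>"
  have "AE z in volume_measure. weakly_converges (empirical_measure ?T z) ?\<mu> \<and> weakly_converges (empirical_measure ?T z) \<nu>"
    using S N by (intro AE_conjI) (auto simp: is_SRB_measure_def)
  then obtain z where z: "weakly_converges (empirical_measure ?T z) ?\<mu>" "weakly_converges (empirical_measure ?T z) \<nu>"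
    using AE_volume_ex by blast
  show "\<nu> = ?\<mu>"
  proof (rule measure_eq_by_continuous)
    fix h :: "'n torus \<times> real \<Rightarrow> real" assume h: "continuous_on UNIV h" "bounded (range h)"
    show "integral\<^sup>L \<nu> h = integral\<^sup>L ?\<mu> h"
      by (rule LIMSEQ_unique[OF weakly_converges_averages[OF z(2) h] weakly_converges_averages[OF z(1) h]])
  qed (use S N in \<open>auto simp: is_SRB_measure_def\<close>)
qed

section \<open>Smooth bump functions on the torus\<close>

lemma Ck_differentiable_Suc_imp:
  "Ck_differentiable (Suc k) f \<Longrightarrow> Ck_differentiable k f"
proof (induction k arbitrary: f)
  case 0
  then show ?case
    by (auto simp: continuous_on_eq_continuous_at intro: differentiable_imp_continuous_within)
next
  case (Suc k)
  then show ?case by (metis Ck_differentiable.simps(2))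
qed

lemma Ck_differentiableI:
  assumes "\<And>x. (f has_derivative f' x) (at x)" "\<And>v. Ck_differentiable k (\<lambda>x. f' x v)"
  shows "Ck_differentiable (Suc k) f"
proof -
  have "frechet_derivative f (at x) = f' x" for x
    using frechet_derivative_at[OF assms(1)] by simp
  moreover have "f differentiable (at x)" for x
    using assms(1) unfolding differentiable_def by blast
  ultimately show ?thesis using assms(2) by simp
qed

lemma Ck_differentiableD:
  assumes "Ck_differentiable (Suc k) f"
  shows "(f has_derivative frechet_derivative f (at x)) (at x)"
    "Ck_differentiable k (\<lambda>x. frechet_derivative f (at x) v)"
  using assms by (simp_all add: frechet_derivative_works)

lemma Ck_differentiable_const: "Ck_differentiable k (\<lambda>x. a)"
proof (induction k arbitrary: a)
  case (Suc k)
  show ?case by (rule Ck_differentiableI[where f' = "\<lambda>x v. 0"]) (auto intro!: derivative_eq_intros Suc)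
qed simp

lemma Ck_differentiable_add:
  "Ck_differentiable k f \<Longrightarrow> Ck_differentiable k g \<Longrightarrow> Ck_differentiable k (\<lambda>x. f x + g x)"
proof (induction k arbitrary: f g)
  case (Suc k)
  show ?case
    by (rule Ck_differentiableI[OF has_derivative_add[OF Ck_differentiableD(1)[OF Suc.prems(1)] Ck_differentiableD(1)[OF Suc.prems(2)]]])
      (intro Suc.IH Ck_differentiableD(2) Suc.prems)
qed (auto intro: continuous_intros)

lemma Ck_differentiable_mult:
  "Ck_differentiable k f \<Longrightarrow> Ck_differentiable k g \<Longrightarrow> Ck_differentiable k (\<lambda>x. f x * g x)"
proof (induction k arbitrary: f g)
  case (Suc k)
  show ?case
    by (rule Ck_differentiableI[OF has_derivative_mult[OF Ck_differentiableD(1)[OF Suc.prems(1)] Ck_differentiableD(1)[OF Suc.prems(2)]]])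
      (intro Ck_differentiable_add Suc.IH Ck_differentiableD(2) Suc.prems Ck_differentiable_Suc_imp[OF Suc.prems(1)]
        Ck_differentiable_Suc_imp[OF Suc.prems(2)])
qed (auto intro: continuous_intros)

lemma Ck_differentiable_cos:
  "Ck_differentiable k (\<lambda>x :: real^'n. a * cos (w * x $ i + b))"
proof (induction k arbitrary: a b)
  case (Suc k)
  have "((\<lambda>x :: real^'n. a * cos (w * x $ i + b)) has_derivative (\<lambda>v. a * w * v $ i * cos (w * x $ i + (b + pi / 2)))) (at x)" for x
  proof -
    have n: "((\<lambda>x :: real^'n. x $ i) has_derivative (\<lambda>v. v $ i)) (at x)"
      by (rule bounded_linear.has_derivative[OF bounded_linear_vec_nth has_derivative_ident])
    have "((\<lambda>x :: real^'n. a * cos (w * x $ i + b)) has_derivative (\<lambda>v. a * (- sin (w * x $ i + b) * (w * v $ i)))) (at x)"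
      by (rule derivative_eq_intros n refl)+ (simp add: fun_eq_iff)
    moreover have "cos (w * x $ i + (b + pi / 2)) = - sin (w * x $ i + b)"
      unfolding add.assoc[symmetric] by (subst cos_add) simp
    ultimately show ?thesis by (simp add: mult_ac)
  qed
  then show ?case by (rule Ck_differentiableI) (rule Suc)
qed (auto intro!: continuous_intros)

lemma Ck_differentiable_prod:
  "finite I \<Longrightarrow> (\<And>i. i \<in> I \<Longrightarrow> Ck_differentiable k (f i)) \<Longrightarrow> Ck_differentiable k (\<lambda>x. \<Prod>i\<in>I. f i x)"
  by (induction I rule: finite_induct) (auto intro: Ck_differentiable_const Ck_differentiable_mult)

text \<open>The value \<open>1\<close> is attained only at the projection of \<open>q\<close>, so that the powers of this trigonometric
polynomial converge pointwise to the indicator of that point.\<close>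

definition torus_bump :: "real^'n \<Rightarrow> 'n::finite torus \<Rightarrow> real"
  where "torus_bump q p = (\<Prod>i\<in>UNIV. (1 + cos (2 * pi * (rep_torus p $ i - q $ i))) / 2)"

lemma torus_bump_abs: "torus_bump q (abs_torus x) = (\<Prod>i\<in>UNIV. (1 / 2 + 1 / 2 * cos (2 * pi * x $ i + (- 2 * pi * q $ i))))"
  unfolding torus_bump_def
proof (rule prod.cong)
  fix i
  have "rep_torus (abs_torus x) - x \<in> int_vectors" by (simp flip: abs_torus_eq_iff)
  then obtain k :: int where "(rep_torus (abs_torus x) - x) $ i = of_int k" by (auto simp: int_vectors_def Ints_def)
  then have k: "rep_torus (abs_torus x) $ i = x $ i + of_int k" by simp
  have "cos (2 * pi * (rep_torus (abs_torus x) $ i - q $ i)) = cos ((2 * pi * x $ i + (- 2 * pi * q $ i)) + (2 * pi) * of_int k)"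
    by (simp add: k algebra_simps)
  also have "\<dots> = cos (2 * pi * x $ i + (- 2 * pi * q $ i))"
  proof -
    have "cos (2 * pi * of_int k) = 1" "sin (2 * pi * of_int k) = 0"
      by (rule cos_int_2pin, rule sin_int_2pin)
    then show ?thesis by (subst cos_add) simp
  qed
  finally show "(1 + cos (2 * pi * (rep_torus (abs_torus x) $ i - q $ i))) / 2 =
      1 / 2 + 1 / 2 * cos (2 * pi * x $ i + (- 2 * pi * q $ i))"
    by (simp add: add_divide_distrib)
qed simp

lemma smooth_torus_bump_power: "smooth_torus (\<lambda>p. torus_bump q p ^ K)"
  unfolding smooth_torus_def Ck_torus_def
proof
  fix k
  have b: "Ck_differentiable k (\<lambda>x. torus_bump q (abs_torus x))"
    unfolding torus_bump_abs
    by (intro Ck_differentiable_prod Ck_differentiable_add Ck_differentiable_const Ck_differentiable_cos) auto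
  show "Ck_differentiable k (\<lambda>x. torus_bump q (abs_torus x) ^ K)"
    by (induction K) (auto intro: Ck_differentiable_const Ck_differentiable_mult b)
qed

lemma half_one_plus_cos_bounds:
  fixes t :: real
  shows "0 \<le> (1 + cos t) / 2" "(1 + cos t) / 2 \<le> 1"
proof -
  have "0 \<le> cos t - (- 1)" by (simp only: diff_ge_0_iff_ge cos_ge_minus_one)
  then show "0 \<le> (1 + cos t) / 2" by (simp add: add.commute)
  show "(1 + cos t) / 2 \<le> 1" by simp
qed

lemma torus_bump_bounds: "0 \<le> torus_bump q p" "torus_bump q p \<le> 1"
  unfolding torus_bump_def by (auto intro!: prod_nonneg prod_le_1 half_one_plus_cos_bounds)

lemma torus_bump_eq_1_iff: "torus_bump q (abs_torus x) = 1 \<longleftrightarrow> abs_torus x = abs_torus q"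
proof
  assume "abs_torus x = abs_torus q"
  then have "torus_bump q (abs_torus x) = torus_bump q (abs_torus q)" by simp
  then show "torus_bump q (abs_torus x) = 1" unfolding torus_bump_abs by simp
next
  assume one: "torus_bump q (abs_torus x) = 1"
  define f where "f i = 1 / 2 + 1 / 2 * cos (2 * pi * x $ i + (- 2 * pi * q $ i))" for i
  have f: "0 \<le> f i" "f i \<le> 1" for i
    unfolding f_def using cos_ge_minus_one[of "2 * pi * x $ i + (- 2 * pi * q $ i)"]
      cos_le_one[of "2 * pi * x $ i + (- 2 * pi * q $ i)"] by linarith+
  have fi: "f i = 1" for i
  proof -
    have "(\<Prod>j\<in>UNIV. f j) = f i * (\<Prod>j\<in>UNIV - {i}. f j)" by (subst prod.remove[of _ i]) auto
    also have "\<dots> \<le> f i * 1" by (intro mult_left_mono prod_le_1) (auto simp: f)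
    finally show ?thesis using one f(2)[of i] by (simp add: torus_bump_abs f_def)
  qed
  have c: "cos (2 * pi * x $ i + (- 2 * pi * q $ i)) = 1" for i
    using fi[of i] unfolding f_def by linarith
  have "(x - q) $ i \<in> \<int>" for i
  proof -
    obtain n :: int where "2 * pi * x $ i + (- 2 * pi * q $ i) = of_int n * 2 * pi"
      using c[of i] by (auto simp: cos_one_2pi_int)
    then have "(2 * pi) * (x $ i - q $ i) = (2 * pi) * of_int n" by (simp add: algebra_simps)
    then have "x $ i - q $ i = of_int n" by (subst (asm) mult_cancel_left) auto
    then show ?thesis by simp
  qed
  then show "abs_torus x = abs_torus q" by (simp add: abs_torus_eq_iff int_vectors_def)
qed

lemma smooth_torus_continuous:
  assumes "Ck_torus k g"
  shows "continuous_on UNIV g"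
proof (rule continuous_on_torusI)
  have "Ck_differentiable 0 f" if "Ck_differentiable k f" for f :: "real^'a \<Rightarrow> real"
    using that by (induction k) (use Ck_differentiable_Suc_imp in blast)+
  then show "continuous_on UNIV (\<lambda>x. g (abs_torus x))"
    using assms unfolding Ck_torus_def by fastforce
qed

section \<open>Transversality of distinct preorbits\<close>

text \<open>Dominated convergence for series.\<close>

lemma geometric_weights_tendsto:
  fixes a :: "nat \<Rightarrow> 'n::finite torus"
  assumes lam: "0 \<le> lam" "lam < 1"
  shows "(\<lambda>K. \<Sum>n. lam ^ n * torus_bump q (a n) ^ K) \<longlonglongrightarrow> (\<Sum>n. lam ^ n * (if a n = abs_torus q then 1 else 0))"
proof -
  have "((\<lambda>K. \<Sum>n. lam ^ n * torus_bump q (a n) ^ K) \<longlongrightarrow> (\<Sum>n. lam ^ n * (if a n = abs_torus q then 1 else 0))) sequentially"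
  proof (rule tannerys_theorem[THEN conjunct2, THEN conjunct2])
    show "summable (\<lambda>n. lam ^ n)" using lam by (intro summable_geometric) auto
    show "((\<lambda>K. lam ^ n * torus_bump q (a n) ^ K) \<longlongrightarrow> lam ^ n * (if a n = abs_torus q then 1 else 0)) sequentially" for n
    proof (cases "a n = abs_torus q")
      case True
      then have "torus_bump q (a n) = 1" by (simp add: torus_bump_eq_1_iff)
      then show ?thesis using True by simp
    next
      case False
      obtain x where "a n = abs_torus x" using torus_cover by metis
      then have "torus_bump q (a n) \<noteq> 1" using False by (simp add: torus_bump_eq_1_iff)
      then have "norm (torus_bump q (a n)) < 1" using torus_bump_bounds[of q "a n"] by simp
      then have "(\<lambda>K. torus_bump q (a n) ^ K) \<longlonglongrightarrow> 0" by (rule LIMSEQ_power_zero)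
      then show ?thesis using False by (intro tendsto_mult tendsto_const) simp
    qed
    show "\<forall>\<^sub>F (n, K) in at_top \<times>\<^sub>F sequentially. norm (lam ^ n * torus_bump q (a n) ^ K) \<le> lam ^ n"
    proof (rule always_eventually, clarify)
      fix n K
      have "0 \<le> torus_bump q (a n) ^ K" "torus_bump q (a n) ^ K \<le> 1"
        using torus_bump_bounds[of q "a n"] by (simp_all add: power_le_one)
      then show "norm (lam ^ n * torus_bump q (a n) ^ K) \<le> lam ^ n"
        using lam by (simp add: abs_mult mult_left_le)
    qed
  qed simp
  then show ?thesis .
qed

lemma torus_bump_separates:
  fixes a b :: "nat \<Rightarrow> 'n::finite torus"
  assumes lam: "0 < lam" "lam < 1"
    and q: "b 0 = abs_torus q"
    and b: "\<And>n. n \<ge> 1 \<Longrightarrow> b n \<noteq> b 0"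
    and a0: "a 0 \<noteq> b 0" and a: "\<And>n m. a n = b 0 \<Longrightarrow> a m = b 0 \<Longrightarrow> n = m"
  shows "\<exists>K. (\<Sum>n. lam ^ n * torus_bump q (a n) ^ K) < (\<Sum>n. lam ^ n * torus_bump q (b n) ^ K)"
proof -
  have B: "(\<Sum>n. lam ^ n * (if b n = abs_torus q then 1 else 0)) = 1"
  proof -
    have "(\<Sum>n. lam ^ n * (if b n = abs_torus q then 1 else 0)) = (\<Sum>n. if n = 0 then 1 else 0)"
    proof (rule suminf_cong)
      fix n show "lam ^ n * (if b n = abs_torus q then 1 else 0) = (if n = 0 then 1 else 0)"
        using b[of n] q by (cases "n = 0") auto
    qed
    also have "\<dots> = 1" using sums_unique[OF sums_single[of 0 "\<lambda>_. 1 :: real"]] by simp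
    finally show ?thesis .
  qed
  have A: "(\<Sum>n. lam ^ n * (if a n = abs_torus q then 1 else 0)) \<le> lam"
  proof (cases "\<exists>n. a n = abs_torus q")
    case True
    then obtain n where n: "a n = abs_torus q" by blast
    then have "n \<noteq> 0" using a0 q by metis
    have "(\<Sum>m. lam ^ m * (if a m = abs_torus q then 1 else 0)) = (\<Sum>m. if m = n then lam ^ n else 0)"
      using a n q by (intro suminf_cong) auto
    also have "\<dots> = lam ^ n" using sums_unique[OF sums_single[of n "\<lambda>_. lam ^ n"]] by simp
    also have "\<dots> \<le> lam ^ 1" using lam \<open>n \<noteq> 0\<close> by (intro power_decreasing) auto
    finally show ?thesis by simp
  next
    case False
    then show ?thesis using lam by simp
  qed
  have "eventually (\<lambda>K. (\<Sum>n. lam ^ n * torus_bump q (a n) ^ K) < (1 + lam) / 2) sequentially"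
    using lam A by (intro order_tendstoD(2)[OF geometric_weights_tendsto]) auto
  moreover have "eventually (\<lambda>K. (\<Sum>n. lam ^ n * torus_bump q (b n) ^ K) > (1 + lam) / 2) sequentially"
    using lam B by (intro order_tendstoD(1)[OF geometric_weights_tendsto]) auto
  ultimately have "eventually (\<lambda>K. (\<Sum>n. lam ^ n * torus_bump q (a n) ^ K) < (\<Sum>n. lam ^ n * torus_bump q (b n) ^ K)) sequentially"
    by eventually_elim simp
  then show ?thesis by (auto simp: eventually_sequentially)
qed

text \<open>Two distinct points with the same image cannot both be periodic, as a common period would make them
equal. A point that is not periodic occurs at most once in any preorbit, and the bump at the first
point of one of the preorbits, chosen not to be periodic, separates them.\<close>

lemma smooth_separates_preorbits:
  fixes a b :: "nat \<Rightarrow> 'n::finite torus" and T :: "'n torus \<Rightarrow> 'n torus"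
  assumes lam: "0 < lam" "lam < 1"
    and Ta: "\<And>n. T (a (Suc n)) = a n" and Tb: "\<And>n. T (b (Suc n)) = b n"
    and T0: "T (a 0) = T (b 0)" and ab: "a 0 \<noteq> b 0"
  shows "\<exists>\<psi>. smooth_torus \<psi> \<and> (\<Sum>n. lam ^ n * \<psi> (a n)) \<noteq> (\<Sum>n. lam ^ n * \<psi> (b n))"
proof -
  have iter: "(T ^^ k) (d (n + k)) = d n" if "\<And>n. T (d (Suc n)) = d n" for d :: "nat \<Rightarrow> 'n torus" and k n
    by (induction k) (simp_all add: that funpow_Suc_right del: funpow.simps)
  have once: "n = m" if d: "\<And>n. T (d (Suc n)) = d n" and per: "\<And>k. k \<ge> 1 \<Longrightarrow> (T ^^ k) p \<noteq> p"
    and dp: "d n = p" "d m = p" for d :: "nat \<Rightarrow> 'n torus" and p n m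
  proof -
    have "\<not> i < j" if "d i = p" "d j = p" for i j
    proof
      assume "i < j"
      then have "(T ^^ (j - i)) p = p" using iter[of d "j - i" i, OF d] that by simp
      then show False using per[of "j - i"] \<open>i < j\<close> by simp
    qed
    from this[OF dp] this[OF dp(2,1)] show ?thesis by linarith
  qed
  have sep: "\<exists>\<psi>. smooth_torus \<psi> \<and> (\<Sum>n. lam ^ n * \<psi> (a n)) \<noteq> (\<Sum>n. lam ^ n * \<psi> (b n))"
    if a: "\<And>n. T (a (Suc n)) = a n" and b: "\<And>n. T (b (Suc n)) = b n" and ab: "a 0 \<noteq> b 0"
      and per: "\<And>k. k \<ge> 1 \<Longrightarrow> (T ^^ k) (b 0) \<noteq> b 0" for a b :: "nat \<Rightarrow> 'n torus"
  proof -
    obtain q where q: "b 0 = abs_torus q" using torus_cover by metis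
    have "\<exists>K. (\<Sum>n. lam ^ n * torus_bump q (a n) ^ K) < (\<Sum>n. lam ^ n * torus_bump q (b n) ^ K)"
    proof (rule torus_bump_separates[where a = a and b = b, OF lam q _ ab])
      show "b n \<noteq> b 0" if "n \<ge> 1" for n using once[where d = b and p = "b 0" and n = n and m = 0, OF b per] that by auto
      show "n = m" if "a n = b 0" "a m = b 0" for n m by (rule once[where d = a and p = "b 0", OF a per that])
    qed
    then obtain K where "(\<Sum>n. lam ^ n * torus_bump q (a n) ^ K) < (\<Sum>n. lam ^ n * torus_bump q (b n) ^ K)" ..
    then show ?thesis
      by (intro exI[of _ "\<lambda>p. torus_bump q p ^ K"]) (simp add: smooth_torus_bump_power)
  qed
  show ?thesis
  proof (cases "\<exists>k\<ge>1. (T ^^ k) (b 0) = b 0")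
    case False
    then show ?thesis by (intro sep Ta Tb ab) auto
  next
    case True
    then obtain k where k: "k \<ge> 1" "(T ^^ k) (b 0) = b 0" by blast
    have "(T ^^ l) (a 0) \<noteq> a 0" if l: "l \<ge> 1" for l
    proof
      assume la: "(T ^^ l) (a 0) = a 0"
      have per_mult: "(T ^^ (i * j)) x = x" if "(T ^^ i) x = x" for i j x
        by (induction j) (simp_all add: funpow_add that)
      \<comment> \<open>After \<open>l * k\<close> steps both points return to themselves, but after one step they have merged.\<close>
      obtain r where r: "l * k = Suc r" using k l by (cases "l * k") auto
      have "a 0 = (T ^^ (l * k)) (a 0)" using per_mult[OF la] by simp
      also have "\<dots> = (T ^^ r) (T (a 0))" by (simp only: r funpow_Suc_right comp_apply)
      also have "\<dots> = (T ^^ r) (T (b 0))" by (simp only: T0)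
      also have "\<dots> = (T ^^ (k * l)) (b 0)" by (simp only: mult.commute[of k] r funpow_Suc_right comp_apply)
      also have "\<dots> = b 0" using per_mult[OF k(2)] by simp
      finally show False using ab by simp
    qed
    then obtain \<psi> where "smooth_torus \<psi>" "(\<Sum>n. lam ^ n * \<psi> (b n)) \<noteq> (\<Sum>n. lam ^ n * \<psi> (a n))"
      using sep[OF Tb Ta ab[symmetric]] by blast
    then show ?thesis by (intro exI[of _ \<psi>]) auto
  qed
qed

definition digit_seqs :: "int \<Rightarrow> (nat \<Rightarrow> real^'n) set"
  where "digit_seqs c = {\<omega>. \<forall>n. \<omega> n \<in> digits c}"

lemma compact_digit_seqs: "compact (digit_seqs c :: (nat \<Rightarrow> real^'n) set)"
proof -
  have "compactin (product_topology (\<lambda>_. euclidean) UNIV) (PiE UNIV (\<lambda>_ :: nat. digits c :: (real^'n) set))"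
    unfolding compactin_PiE using finite_digits by (auto intro: finite_imp_compact)
  moreover have "PiE UNIV (\<lambda>_ :: nat. digits c :: (real^'n) set) = digit_seqs c"
    by (auto simp: digit_seqs_def PiE_def)
  ultimately show ?thesis by (simp add: euclidean_product_topology)
qed

lemma digits_distinct_norm:
  fixes v w :: "real^'n"
  assumes "v \<in> digits c" "w \<in> digits c" "v \<noteq> w"
  shows "1 \<le> norm (v - w)"
proof -
  obtain i where i: "v $ i \<noteq> w $ i" using assms(3) by (auto simp: vec_eq_iff)
  obtain k l :: int where "v $ i = of_int k" "w $ i = of_int l"
    using assms unfolding digits_def by blast
  then have "1 \<le> \<bar>(v - w) $ i\<bar>" using i by (simp flip: of_int_diff of_int_abs)
  then show ?thesis using component_le_norm_cart[of "v - w" i] by linarith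
qed

lemma digits_distinct_torus:
  fixes v w x :: "real^'n"
  assumes c: "c \<noteq> 0" and v: "v \<in> digits c" "w \<in> digits c" "v \<noteq> w"
  shows "abs_torus (inverse (of_int c) *\<^sub>R (x + v)) \<noteq> abs_torus (inverse (of_int c) *\<^sub>R (x + w))"
proof
  assume "abs_torus (inverse (of_int c) *\<^sub>R (x + v)) = abs_torus (inverse (of_int c) *\<^sub>R (x + w))"
  then have int: "inverse (of_int c) *\<^sub>R (v - w) \<in> int_vectors"
    by (simp add: abs_torus_eq_iff flip: scaleR_diff_right)
  obtain i where i: "v $ i \<noteq> w $ i" using v(3) by (auto simp: vec_eq_iff)
  obtain k l :: int where kl: "v $ i = of_int k" "w $ i = of_int l" "0 \<le> k" "k < \<bar>c\<bar>" "0 \<le> l" "l < \<bar>c\<bar>"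
    using v unfolding digits_def by blast
  obtain m :: int where "(inverse (of_int c) *\<^sub>R (v - w)) $ i = of_int m"
    using int by (auto simp: int_vectors_def Ints_def)
  then have "of_int (k - l) = (of_int (c * m) :: real)" using c kl by (simp add: field_simps)
  then have eq: "k - l = c * m" by (simp only: of_int_eq_iff)
  have "k \<noteq> l" using i kl by auto
  then have "k - l \<noteq> 0" by simp
  moreover have "c dvd k - l" unfolding eq by simp
  ultimately have "\<bar>c\<bar> \<le> \<bar>k - l\<bar>" by (rule dvd_imp_le_int)
  then show False using kl by linarith
qed

lemma continuous_preorbit:
  "continuous_on UNIV (\<lambda>z :: (real^'n) \<times> (nat \<Rightarrow> real^'n). preorbit c (fst z) (snd z) n)"
proof (induction n)
  case (Suc n)
  have "continuous_on UNIV (\<lambda>z :: (real^'n) \<times> (nat \<Rightarrow> real^'n). snd z n)"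
    by (rule continuous_on_compose2[OF continuous_on_product_coordinates continuous_on_snd]) (auto intro: continuous_intros)
  then show ?case using Suc by (auto intro!: continuous_intros)
qed (auto intro!: continuous_intros)

lemma continuous_fibre:
  fixes g :: "'n::finite torus \<Rightarrow> real"
  assumes lam: "0 \<le> lam" "lam < 1" and g: "continuous_on UNIV g"
  shows "continuous_on UNIV (fibre c lam g)"
proof -
  obtain G where G: "0 \<le> G" "\<And>p. \<bar>g p\<bar> \<le> G" using bounded_continuous_torus[OF g] by blast
  have "uniform_limit UNIV (\<lambda>n z. \<Sum>i<n. lam ^ i * g (abs_torus (preorbit c (fst z) (snd z) (Suc i)))) (fibre c lam g) sequentially"
    unfolding fibre_def
  proof (rule Weierstrass_m_test)
    show "norm (lam ^ n * g (abs_torus (preorbit c (fst z) (snd z) (Suc n)))) \<le> lam ^ n * G" for n z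
      using lam G by (simp add: abs_mult mult_left_mono del: preorbit.simps)
    show "summable (\<lambda>n. lam ^ n * G)" using lam by (intro summable_mult2 summable_geometric) auto
  qed
  then show ?thesis
    by (rule uniform_limit_theorem[rotated])
      (auto intro!: always_eventually continuous_intros continuous_on_compose2[OF g]
        continuous_on_compose2[OF continuous_on_abs_torus] continuous_on_compose2[OF continuous_preorbit]
        simp del: preorbit.simps)
qed

text \<open>The pairs of preorbits whose first digits differ form a compact space, covered by the open sets where
some smooth \<open>\<psi>\<close> has different sums along the two preorbits. On it, the sum of the absolute
differences over a finite subcover is bounded below.\<close>

theorem transversality:
  fixes lam :: real and X :: "(real^'n::finite) set"
  assumes c: "\<bar>c\<bar> \<ge> 2" and lam: "0 < lam" "lam < 1" and X: "compact X"
  obtains s :: nat and \<phi> :: "nat \<Rightarrow> 'n::finite torus \<Rightarrow> real" and \<delta> :: real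
  where "0 < \<delta>" "\<And>k. k \<in> {1..s} \<Longrightarrow> smooth_torus (\<phi> k)"
    "\<And>x \<omega> \<omega>'. x \<in> X \<Longrightarrow> \<omega> \<in> digit_seqs c \<Longrightarrow> \<omega>' \<in> digit_seqs c \<Longrightarrow> \<omega> 0 \<noteq> \<omega>' 0 \<Longrightarrow>
      \<exists>k\<in>{1..s}. \<delta> \<le> \<bar>fibre c lam (\<phi> k) (x, \<omega>) - fibre c lam (\<phi> k) (x, \<omega>')\<bar>"
proof -
  have c0: "c \<noteq> 0" using c by auto
  define D where "D \<psi> z = fibre c lam \<psi> (fst z, fst (snd z)) - fibre c lam \<psi> (fst z, snd (snd z))"
    for \<psi> :: "'n torus \<Rightarrow> real" and z
  have p1: "continuous_on UNIV (\<lambda>z :: (real^'n) \<times> (nat \<Rightarrow> real^'n) \<times> (nat \<Rightarrow> real^'n). fst z)"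
    and p2: "continuous_on UNIV (\<lambda>z :: (real^'n) \<times> (nat \<Rightarrow> real^'n) \<times> (nat \<Rightarrow> real^'n). fst (snd z))"
    and p3: "continuous_on UNIV (\<lambda>z :: (real^'n) \<times> (nat \<Rightarrow> real^'n) \<times> (nat \<Rightarrow> real^'n). snd (snd z))"
    by (intro continuous_on_fst continuous_on_snd continuous_on_id)+
  have Dc: "continuous_on UNIV (D \<psi>)" if "smooth_torus \<psi>" for \<psi>
  proof -
    have "continuous_on UNIV \<psi>"
      using that smooth_torus_continuous[of 0 \<psi>] by (simp add: smooth_torus_def)
    note f = continuous_fibre[OF less_imp_le[OF lam(1)] lam(2) this, of c]
    have "continuous_on UNIV (\<lambda>z :: (real^'n) \<times> (nat \<Rightarrow> real^'n) \<times> (nat \<Rightarrow> real^'n). fibre c lam \<psi> (fst z, fst (snd z)))"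
      by (rule continuous_on_compose2[OF f continuous_on_Pair[OF p1 p2]]) auto
    moreover have "continuous_on UNIV (\<lambda>z :: (real^'n) \<times> (nat \<Rightarrow> real^'n) \<times> (nat \<Rightarrow> real^'n). fibre c lam \<psi> (fst z, snd (snd z)))"
      by (rule continuous_on_compose2[OF f continuous_on_Pair[OF p1 p3]]) auto
    ultimately show ?thesis unfolding D_def by (rule continuous_on_diff)
  qed
  define Z where "Z = (X \<times> ((digit_seqs c :: (nat \<Rightarrow> real^'n) set) \<times> (digit_seqs c :: (nat \<Rightarrow> real^'n) set))) \<inter> {z. 1 \<le> norm (fst (snd z) 0 - snd (snd z) (0::nat))}"
  have cf: "continuous_on UNIV (\<lambda>z :: (real^'n) \<times> (nat \<Rightarrow> real^'n) \<times> (nat \<Rightarrow> real^'n). fst (snd z) 0)"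
    by (rule continuous_on_compose2[OF continuous_on_product_coordinates p2]) auto
  have cs: "continuous_on UNIV (\<lambda>z :: (real^'n) \<times> (nat \<Rightarrow> real^'n) \<times> (nat \<Rightarrow> real^'n). snd (snd z) 0)"
    by (rule continuous_on_compose2[OF continuous_on_product_coordinates p3]) auto
  have "compact Z" unfolding Z_def
    by (intro compact_Int_closed compact_Times X compact_digit_seqs closed_Collect_le continuous_intros cf cs)
  moreover have "open {z. D \<psi> z \<noteq> 0}" if "\<psi> \<in> Collect smooth_torus" for \<psi>
    using that by (intro open_Collect_neq Dc continuous_intros) auto
  moreover have "Z \<subseteq> (\<Union>\<psi>\<in>Collect smooth_torus. {z. D \<psi> z \<noteq> 0})"
  proof
    fix z assume "z \<in> Z"
    obtain x \<omega> \<omega>' where zeq: "z = (x, \<omega>, \<omega>')" by (cases z) auto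
    have z: "z = (x, \<omega>, \<omega>')" "\<omega> \<in> digit_seqs c" "\<omega>' \<in> digit_seqs c" "\<omega> 0 \<noteq> \<omega>' 0"
      using \<open>z \<in> Z\<close> by (auto simp: Z_def zeq)
    have int: "\<eta> n \<in> int_vectors" "\<eta> n \<in> digits c" if "\<eta> \<in> digit_seqs c" for \<eta> :: "nat \<Rightarrow> real^'n" and n
      using that digits_int_vectors by (auto simp: digit_seqs_def)
    define a where "a n = abs_torus (preorbit c x \<omega> (Suc n))" for n
    define b where "b n = abs_torus (preorbit c x \<omega>' (Suc n))" for n
    have "\<exists>\<psi>. smooth_torus \<psi> \<and> (\<Sum>n. lam ^ n * \<psi> (a n)) \<noteq> (\<Sum>n. lam ^ n * \<psi> (b n))"
    proof (rule smooth_separates_preorbits[OF lam, where T = "torus_mult c"])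
      show "torus_mult c (a (Suc n)) = a n" "torus_mult c (b (Suc n)) = b n" for n
        unfolding a_def b_def by (rule torus_mult_preorbit[OF c0]; rule int; rule z)+
      show "torus_mult c (a 0) = torus_mult c (b 0)"
        unfolding a_def b_def
        using torus_mult_preorbit[where \<omega> = \<omega> and n = 0 and x = x, OF c0 int(1)[OF z(2)]]
          torus_mult_preorbit[where \<omega> = \<omega>' and n = 0 and x = x, OF c0 int(1)[OF z(3)]]
        by (simp only: preorbit.simps(1))
      show "a 0 \<noteq> b 0"
        unfolding a_def b_def using digits_distinct_torus[OF c0 int(2)[OF z(2)] int(2)[OF z(3)] z(4)] by simp
    qed
    then show "z \<in> (\<Union>\<psi>\<in>Collect smooth_torus. {z. D \<psi> z \<noteq> 0})"
      by (auto simp: z D_def fibre_def a_def b_def simp del: preorbit.simps)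
  qed
  ultimately obtain \<Psi> where \<Psi>: "\<Psi> \<subseteq> Collect smooth_torus" "finite \<Psi>" "Z \<subseteq> (\<Union>\<psi>\<in>\<Psi>. {z. D \<psi> z \<noteq> 0})"
    by (rule compactE_image)
  define W where "W z = (\<Sum>\<psi>\<in>\<Psi>. \<bar>D \<psi> z\<bar>)" for z
  have Wpos: "0 < W z" if zZ: "z \<in> Z" for z
  proof -
    obtain \<psi> where "\<psi> \<in> \<Psi>" "D \<psi> z \<noteq> 0" using \<Psi>(3) zZ by blast
    then show ?thesis unfolding W_def using \<Psi>(2) by (intro sum_pos2[of _ \<psi>]) auto
  qed
  have "\<exists>\<epsilon>>0. \<forall>z\<in>Z. \<epsilon> \<le> W z"
  proof (cases "Z = {}")
    case False
    have "continuous_on Z W" unfolding W_def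
      using \<Psi>(1) by (intro continuous_intros continuous_on_subset[OF Dc]) auto
    then obtain z where "z \<in> Z" "\<forall>y\<in>Z. W z \<le> W y"
      using continuous_attains_inf[OF \<open>compact Z\<close> False] by blast
    then show ?thesis using Wpos by blast
  qed (auto intro: exI[of _ 1])
  then obtain \<epsilon> where \<epsilon>: "\<epsilon> > 0" "\<And>z. z \<in> Z \<Longrightarrow> \<epsilon> \<le> W z" by blast
  obtain \<phi> where \<phi>: "bij_betw \<phi> {1..card \<Psi>} \<Psi>" using ex_bij_betw_nat_finite_1[OF \<Psi>(2)] by blast
  \<comment> \<open>One of the \<open>card \<Psi>\<close> summands reaches this size; the \<open>1\<close> in the denominator covers the case of an empty set.\<close>
  define \<delta> where "\<delta> = \<epsilon> / (1 + card \<Psi>)"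
  show thesis
  proof (rule that[of \<delta> "card \<Psi>" \<phi>])
    show "0 < \<delta>" using \<epsilon> by (simp add: \<delta>_def)
    show "smooth_torus (\<phi> k)" if "k \<in> {1..card \<Psi>}" for k
      using bij_betwE[OF \<phi>] that \<Psi>(1) by blast
    fix x and \<omega> \<omega>' :: "nat \<Rightarrow> real^'n"
    assume h: "x \<in> X" "\<omega> \<in> digit_seqs c" "\<omega>' \<in> digit_seqs c" "\<omega> 0 \<noteq> \<omega>' 0"
    have "1 \<le> norm (\<omega> 0 - \<omega>' 0)" using h by (intro digits_distinct_norm[of _ c]) (auto simp: digit_seqs_def)
    then have z: "(x, \<omega>, \<omega>') \<in> Z" using h by (simp add: Z_def)
    show "\<exists>k\<in>{1..card \<Psi>}. \<delta> \<le> \<bar>fibre c lam (\<phi> k) (x, \<omega>) - fibre c lam (\<phi> k) (x, \<omega>')\<bar>"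
    proof (rule ccontr)
      assume neg: "\<not> ?thesis"
      have "\<bar>D \<psi> (x, \<omega>, \<omega>')\<bar> \<le> \<delta>" if "\<psi> \<in> \<Psi>" for \<psi>
      proof -
        have "\<psi> \<in> \<phi> ` {1..card \<Psi>}" using that bij_betw_imp_surj_on[OF \<phi>] by (simp only:)
        then obtain k where k: "k \<in> {1..card \<Psi>}" "\<psi> = \<phi> k" by (elim imageE)
        have "\<not> \<delta> \<le> \<bar>fibre c lam (\<phi> k) (x, \<omega>) - fibre c lam (\<phi> k) (x, \<omega>')\<bar>"
          using neg k(1) by blast
        then show ?thesis by (simp add: D_def k(2))
      qed
      then have "W (x, \<omega>, \<omega>') \<le> (\<Sum>\<psi>\<in>\<Psi>. \<delta>)" unfolding W_def by (intro sum_mono)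
      also have "\<dots> = card \<Psi> * \<delta>" by simp
      also have "\<dots> < \<epsilon>" using \<epsilon>(1) by (simp add: \<delta>_def field_simps)
      finally show False using \<epsilon>(2)[OF z] by simp
    qed
  qed
qed

section \<open>A finite small-ball energy makes the measure absolutely continuous\<close>

text \<open>The probability that two random preorbits of the same point give values of \<open>h\<close> within \<open>2 * \<rho>\<close>,
divided by \<open>2 * \<rho>\<close>. It bounds the squared \<open>L2\<close> norm of the law of \<open>h\<close> smoothed at scale \<open>\<rho>\<close>.\<close>

definition energy :: "int \<Rightarrow> ((real^'n) \<times> (nat \<Rightarrow> real^'n) \<Rightarrow> real) \<Rightarrow> real \<Rightarrow> ennreal"
  where "energy c h \<rho> = (\<integral>\<^sup>+z. (\<integral>\<^sup>+\<omega>. indicator {- 2 * \<rho>..2 * \<rho>} (h z - h (fst z, \<omega>)) \<partial>digit_space c) \<partial>natural_space c)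
     * ennreal (1 / (2 * \<rho>))"

text \<open>Plays the role of the Cauchy-Schwarz inequality: either \<open>d \<le> M\<close>, or \<open>d\<close> is at most \<open>d\<^sup>2 / M\<close>.\<close>

lemma ennreal_le_add_square:
  fixes d :: ennreal
  assumes "M > 0"
  shows "d \<le> ennreal M + ennreal (1 / M) * (d * d)"
proof (cases "d \<le> ennreal M")
  case False
  then have "ennreal (1 / M) * ennreal M \<le> ennreal (1 / M) * d" by (intro mult_left_mono) auto
  then have "1 \<le> ennreal (1 / M) * d" using assms by (simp add: ennreal_mult''[symmetric])
  then have "1 * d \<le> (ennreal (1 / M) * d) * d" by (intro mult_right_mono) auto
  also have "\<dots> \<le> ennreal M + ennreal (1 / M) * (d * d)"
    by (simp add: mult.assoc add_increasing)
  finally show ?thesis by simp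
qed (simp add: add_increasing2)

lemma nn_integral_ball_indicator:
  "(\<integral>\<^sup>+y. indicator {- \<rho>..\<rho>} (a - y :: real) \<partial>lborel) = ennreal (2 * \<rho>)" if "0 \<le> \<rho>" for a \<rho> :: real
proof -
  have "(\<integral>\<^sup>+y. indicator {- \<rho>..\<rho>} (a - y) \<partial>lborel) = (\<integral>\<^sup>+y. indicator {a - \<rho>..a + \<rho>} y \<partial>lborel)"
    by (intro nn_integral_cong) (auto split: split_indicator)
  also have "\<dots> = ennreal (2 * \<rho>)" using that by simp
  finally show ?thesis .
qed

lemma nn_integral_natural:
  fixes F :: "(real^'n) \<times> (nat \<Rightarrow> real^'n) \<Rightarrow> ennreal"
  assumes "F \<in> borel_measurable (natural_space c)"
  shows "(\<integral>\<^sup>+z. F z \<partial>natural_space c) = (\<integral>\<^sup>+x. (\<integral>\<^sup>+\<omega>. F (x, \<omega>) \<partial>digit_space c) \<partial>cube_measure)"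
proof -
  interpret P: prob_space "digit_space c :: (nat \<Rightarrow> real^'n) measure" by (rule prob_space_digits)
  show ?thesis using P.nn_integral_fst[OF assms[unfolded natural_space_def]] by (simp add: natural_space_def)
qed

text \<open>Expanding the square gives two independent copies; both are within \<open>\<rho>\<close> of a common \<open>y\<close> only if
they are within \<open>2 * \<rho>\<close> of each other, and then only for \<open>y\<close> in a set of length at most
\<open>2 * \<rho>\<close>.\<close>

lemma smoothed_square_bound:
  fixes h :: "'a \<Rightarrow> real"
  assumes P: "prob_space P" and h [measurable]: "h \<in> borel_measurable P" and \<rho>: "\<rho> > 0"
  shows "(\<integral>\<^sup>+y. (ennreal (1 / (2 * \<rho>)) * (\<integral>\<^sup>+\<omega>. indicator {- \<rho>..\<rho>} (h \<omega> - y) \<partial>P)) *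
       (ennreal (1 / (2 * \<rho>)) * (\<integral>\<^sup>+\<omega>. indicator {- \<rho>..\<rho>} (h \<omega> - y) \<partial>P)) \<partial>lborel)
    \<le> (\<integral>\<^sup>+\<omega>. (\<integral>\<^sup>+\<omega>'. indicator {- 2 * \<rho>..2 * \<rho>} (h \<omega> - h \<omega>') \<partial>P) \<partial>P) * ennreal (1 / (2 * \<rho>))"
proof -
  interpret P: prob_space P by fact
  interpret PL: pair_sigma_finite lborel P ..
  let ?k = "ennreal (1 / (2 * \<rho>))"
  let ?K = "\<lambda>\<omega> y. indicator {- \<rho>..\<rho>} (h \<omega> - y) :: ennreal"
  have kk: "?k * ennreal (2 * \<rho>) = 1" using \<rho> by (simp add: ennreal_mult''[symmetric])
  have "(\<integral>\<^sup>+y. (?k * (\<integral>\<^sup>+\<omega>. ?K \<omega> y \<partial>P)) * (?k * (\<integral>\<^sup>+\<omega>. ?K \<omega> y \<partial>P)) \<partial>lborel) =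
    (\<integral>\<^sup>+y. (\<integral>\<^sup>+\<omega>. (\<integral>\<^sup>+\<omega>'. ?k * ?k * (?K \<omega> y * ?K \<omega>' y) \<partial>P) \<partial>P) \<partial>lborel)"
  proof (rule nn_integral_cong)
    fix y
    have "(\<integral>\<^sup>+\<omega>. (\<integral>\<^sup>+\<omega>'. ?k * ?k * (?K \<omega> y * ?K \<omega>' y) \<partial>P) \<partial>P) =
       (\<integral>\<^sup>+\<omega>. (?k * (\<integral>\<^sup>+\<omega>'. ?K \<omega>' y \<partial>P) * ?k) * ?K \<omega> y \<partial>P)"
      by (intro nn_integral_cong) (simp add: nn_integral_cmult[symmetric] mult_ac)
    also have "\<dots> = (?k * (\<integral>\<^sup>+\<omega>'. ?K \<omega>' y \<partial>P) * ?k) * (\<integral>\<^sup>+\<omega>. ?K \<omega> y \<partial>P)"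
      by (rule nn_integral_cmult) measurable
    finally show "(?k * (\<integral>\<^sup>+\<omega>. ?K \<omega> y \<partial>P)) * (?k * (\<integral>\<^sup>+\<omega>. ?K \<omega> y \<partial>P)) =
      (\<integral>\<^sup>+\<omega>. (\<integral>\<^sup>+\<omega>'. ?k * ?k * (?K \<omega> y * ?K \<omega>' y) \<partial>P) \<partial>P)"
      by (simp add: mult_ac)
  qed
  also have "\<dots> = (\<integral>\<^sup>+\<omega>. (\<integral>\<^sup>+y. (\<integral>\<^sup>+\<omega>'. ?k * ?k * (?K \<omega> y * ?K \<omega>' y) \<partial>P) \<partial>lborel) \<partial>P)"
    by (rule PL.Fubini'[symmetric]) measurable
  also have "\<dots> = (\<integral>\<^sup>+\<omega>. (\<integral>\<^sup>+\<omega>'. (\<integral>\<^sup>+y. ?k * ?k * (?K \<omega> y * ?K \<omega>' y) \<partial>lborel) \<partial>P) \<partial>P)"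
    by (intro nn_integral_cong PL.Fubini'[symmetric]) measurable
  also have "\<dots> \<le> (\<integral>\<^sup>+\<omega>. (\<integral>\<^sup>+\<omega>'. indicator {- 2 * \<rho>..2 * \<rho>} (h \<omega> - h \<omega>') * ?k \<partial>P) \<partial>P)"
  proof (intro nn_integral_mono)
    fix \<omega> \<omega>'
    have "(\<integral>\<^sup>+y. ?k * ?k * (?K \<omega> y * ?K \<omega>' y) \<partial>lborel) \<le>
      (\<integral>\<^sup>+y. (?k * ?k * indicator {- 2 * \<rho>..2 * \<rho>} (h \<omega> - h \<omega>')) * ?K \<omega> y \<partial>lborel)"
      by (intro nn_integral_mono) (auto split: split_indicator)
    also have "\<dots> = (?k * ?k * indicator {- 2 * \<rho>..2 * \<rho>} (h \<omega> - h \<omega>')) * ennreal (2 * \<rho>)"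
      using \<rho> by (subst nn_integral_cmult) (auto simp: nn_integral_ball_indicator)
    also have "\<dots> = (?k * ennreal (2 * \<rho>)) * (indicator {- 2 * \<rho>..2 * \<rho>} (h \<omega> - h \<omega>') * ?k)"
      by (simp only: mult_ac)
    also have "\<dots> = indicator {- 2 * \<rho>..2 * \<rho>} (h \<omega> - h \<omega>') * ?k" by (simp only: kk mult_1)
    finally show "(\<integral>\<^sup>+y. ?k * ?k * (?K \<omega> y * ?K \<omega>' y) \<partial>lborel) \<le> indicator {- 2 * \<rho>..2 * \<rho>} (h \<omega> - h \<omega>') * ?k" .
  qed
  also have "\<dots> = (\<integral>\<^sup>+\<omega>. (\<integral>\<^sup>+\<omega>'. indicator {- 2 * \<rho>..2 * \<rho>} (h \<omega> - h \<omega>') \<partial>P) \<partial>P) * ?k"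
    by (simp add: nn_integral_multc)
  finally show ?thesis .
qed

lemma open_indicator_le_liminf:
  fixes U :: "('a::real_normed_vector \<times> real) set"
  assumes U: "open U" and x: "(x, a) \<in> U"
  shows "eventually (\<lambda>m. (\<integral>\<^sup>+y. indicator U (x, y) * indicator {- (1 / real (Suc m))..1 / real (Suc m)} (a - y) \<partial>lborel) *
      ennreal (1 / (2 * (1 / real (Suc m)))) = 1) sequentially"
proof -
  obtain e where e: "e > 0" "\<And>v. dist v (x, a) < e \<Longrightarrow> v \<in> U" using U x unfolding open_dist by blast
  have "eventually (\<lambda>m. 1 / real (Suc m) < e) sequentially"
    using e(1) by (intro order_tendstoD[OF lim_inverse_n'[THEN LIMSEQ_Suc]]) 
  then show ?thesis
  proof eventually_elim
    case (elim m)
    let ?r = "1 / real (Suc m)"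
    have r: "?r > 0" by simp
    have "(\<integral>\<^sup>+y. indicator U (x, y) * indicator {- ?r..?r} (a - y) \<partial>lborel) = (\<integral>\<^sup>+y. indicator {- ?r..?r} (a - y) \<partial>lborel)"
    proof (rule nn_integral_cong)
      fix y
      have "(x, y) \<in> U" if "a - y \<in> {- ?r..?r}"
      proof (rule e(2))
        have "dist (x, y) (x, a) = \<bar>y - a\<bar>" by (simp add: dist_prod_def dist_real_def)
        also have "\<dots> \<le> ?r" using that by (simp add: abs_le_iff)
        finally show "dist (x, y) (x, a) < e" using elim by simp
      qed
      then show "indicator U (x, y) * indicator {- ?r..?r} (a - y) = (indicator {- ?r..?r} (a - y) :: ennreal)"
        by (simp split: split_indicator)
    qed
    also have "\<dots> = ennreal (2 * ?r)" by (rule nn_integral_ball_indicator) simp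
    finally have "(\<integral>\<^sup>+y. indicator U (x, y) * indicator {- ?r..?r} (a - y) \<partial>lborel) * ennreal (1 / (2 * ?r)) =
      ennreal (2 * ?r) * ennreal (1 / (2 * ?r))" by simp
    also have "\<dots> = ennreal ((2 * ?r) * (1 / (2 * ?r)))" using r by (intro ennreal_mult[symmetric]) auto
    also have "(2 * ?r) * (1 / (2 * ?r)) = 1" using r by (simp del: of_nat_Suc)
    finally show ?case by simp
  qed
qed

text \<open>As \<open>U\<close> is open, its indicator is at most the lower limit of its averages over short vertical
intervals. By Fatou the mass of \<open>U\<close> is at most the lower limit of the integrals of the smoothed
densities over \<open>U\<close>, and each of these is bounded by the volume of \<open>U\<close> and the energy.\<close>

lemma open_set_mass_bound:
  fixes h :: "(real^'n) \<times> (nat \<Rightarrow> real^'n) \<Rightarrow> real" and U :: "((real^'n) \<times> real) set"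
  assumes h: "h \<in> borel_measurable (natural_space c)" and U: "open U" and M: "M > 0"
    and E: "frequently (\<lambda>m. energy c h (1 / real (Suc m)) \<le> L) sequentially"
  shows "(\<integral>\<^sup>+z. indicator U (fst z, h z) \<partial>natural_space c) \<le> ennreal M * emeasure lborel U + ennreal (1 / M) * L"
proof -
  interpret P: prob_space "digit_space c :: (nat \<Rightarrow> real^'n) measure" by (rule prob_space_digits)
  interpret PL: pair_sigma_finite "lborel :: real measure" "digit_space c :: (nat \<Rightarrow> real^'n) measure" ..
  have hm [measurable]: "h \<in> borel_measurable (cube_measure \<Otimes>\<^sub>M digit_space c)"
    using h by (simp add: natural_space_def)
  have Um [measurable]: "U \<in> sets (borel \<Otimes>\<^sub>M borel)" unfolding borel_prod using U by simp
  define I where "I \<rho> = (\<integral>\<^sup>+z. (\<integral>\<^sup>+y. indicator U (fst z, y) * indicator {- \<rho>..\<rho>} (h z - y) \<partial>lborel) * ennreal (1 / (2 * \<rho>)) \<partial>natural_space c)"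
    for \<rho> :: real
  have main: "I \<rho> \<le> ennreal M * emeasure lborel U + ennreal (1 / M) * energy c h \<rho>" if \<rho>: "\<rho> > 0" for \<rho>
  proof -
    let ?k = "ennreal (1 / (2 * \<rho>))"
    define d where "d x y = ?k * (\<integral>\<^sup>+\<omega>. indicator {- \<rho>..\<rho>} (h (x, \<omega>) - y) \<partial>digit_space c)" for x y
    have dm [measurable]: "(\<lambda>z. d (fst z) (snd z)) \<in> borel_measurable (cube_measure \<Otimes>\<^sub>M lborel)"
      unfolding d_def by measurable
    have dx [measurable]: "d x \<in> borel_measurable borel" for x
      unfolding d_def by measurable
    have hx [measurable]: "(\<lambda>\<omega>. h (x, \<omega>)) \<in> borel_measurable (digit_space c)" for x
      using measurable_compose[OF measurable_Pair1' hm, of x] by simp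
    have "I \<rho> = (\<integral>\<^sup>+x. (\<integral>\<^sup>+\<omega>. (\<integral>\<^sup>+y. indicator U (x, y) * indicator {- \<rho>..\<rho>} (h (x, \<omega>) - y) \<partial>lborel) * ?k \<partial>digit_space c) \<partial>cube_measure)"
      unfolding I_def by (subst nn_integral_natural) (simp_all add: natural_space_def)
    also have "\<dots> = (\<integral>\<^sup>+x. (\<integral>\<^sup>+y. indicator U (x, y) * d x y \<partial>lborel) \<partial>cube_measure)"
    proof (rule nn_integral_cong)
      fix x :: "real^'n"
      have "(\<integral>\<^sup>+\<omega>. (\<integral>\<^sup>+y. indicator U (x, y) * indicator {- \<rho>..\<rho>} (h (x, \<omega>) - y) \<partial>lborel) * ?k \<partial>digit_space c) =
        (\<integral>\<^sup>+\<omega>. (\<integral>\<^sup>+y. indicator U (x, y) * indicator {- \<rho>..\<rho>} (h (x, \<omega>) - y) * ?k \<partial>lborel) \<partial>digit_space c)"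
        by (intro nn_integral_cong) (simp add: nn_integral_multc)
      also have "\<dots> = (\<integral>\<^sup>+y. (\<integral>\<^sup>+\<omega>. indicator U (x, y) * indicator {- \<rho>..\<rho>} (h (x, \<omega>) - y) * ?k \<partial>digit_space c) \<partial>lborel)"
        by (rule PL.Fubini') measurable
      also have "\<dots> = (\<integral>\<^sup>+y. indicator U (x, y) * d x y \<partial>lborel)"
        unfolding d_def
        by (intro nn_integral_cong) (simp add: nn_integral_cmult nn_integral_multc mult_ac)
      finally show "(\<integral>\<^sup>+\<omega>. (\<integral>\<^sup>+y. indicator U (x, y) * indicator {- \<rho>..\<rho>} (h (x, \<omega>) - y) \<partial>lborel) * ?k \<partial>digit_space c) =
        (\<integral>\<^sup>+y. indicator U (x, y) * d x y \<partial>lborel)" .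
    qed
    also have "\<dots> \<le> (\<integral>\<^sup>+x. (\<integral>\<^sup>+y. ennreal M * indicator U (x, y) + ennreal (1 / M) * (d x y * d x y) \<partial>lborel) \<partial>cube_measure)"
      using ennreal_le_add_square[OF M]
      by (intro nn_integral_mono) (auto split: split_indicator)
    also have "\<dots> = ennreal M * (\<integral>\<^sup>+x. (\<integral>\<^sup>+y. indicator U (x, y) \<partial>lborel) \<partial>cube_measure) +
        ennreal (1 / M) * (\<integral>\<^sup>+x. (\<integral>\<^sup>+y. d x y * d x y \<partial>lborel) \<partial>cube_measure)"
    proof -
      have "(\<integral>\<^sup>+y. ennreal M * indicator U (x, y) + ennreal (1 / M) * (d x y * d x y) \<partial>lborel) =
          ennreal M * (\<integral>\<^sup>+y. indicator U (x, y) \<partial>lborel) + ennreal (1 / M) * (\<integral>\<^sup>+y. d x y * d x y \<partial>lborel)" for x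
        by (subst nn_integral_add) (simp_all add: nn_integral_cmult)
      moreover have "(\<lambda>x. \<integral>\<^sup>+y. d x y * d x y \<partial>lborel) \<in> borel_measurable cube_measure"
      proof (rule lborel.borel_measurable_nn_integral)
        show "(\<lambda>(x, y). d x y * d x y) \<in> borel_measurable (cube_measure \<Otimes>\<^sub>M lborel)"
          unfolding split_beta' using dm by measurable
      qed
      moreover have "(\<lambda>x. \<integral>\<^sup>+y. indicator U (x, y) \<partial>lborel) \<in> borel_measurable cube_measure"
        by measurable
      ultimately show ?thesis by (simp only:) (subst nn_integral_add, simp_all add: nn_integral_cmult)
    qed
    also have "\<dots> \<le> ennreal M * emeasure lborel U + ennreal (1 / M) * energy c h \<rho>"
    proof (intro add_mono mult_left_mono)
      have "(\<integral>\<^sup>+x. (\<integral>\<^sup>+y. indicator U (x, y) \<partial>lborel) \<partial>cube_measure) =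
        (\<integral>\<^sup>+x. (\<integral>\<^sup>+y. indicator U (x, y) \<partial>lborel) * indicator unit_cube x \<partial>lborel)"
        by (rule nn_integral_cube) measurable
      also have "\<dots> \<le> (\<integral>\<^sup>+x. (\<integral>\<^sup>+y. indicator U (x, y) \<partial>lborel) \<partial>lborel)"
        by (intro nn_integral_mono) (auto split: split_indicator)
      also have "\<dots> = (\<integral>\<^sup>+z. indicator U z \<partial>(lborel \<Otimes>\<^sub>M lborel))"
        by (subst lborel.nn_integral_fst[symmetric]) (auto simp: borel_prod U)
      also have "\<dots> = emeasure lborel U" using U by (simp add: lborel_prod)
      finally show "(\<integral>\<^sup>+x. (\<integral>\<^sup>+y. indicator U (x, y) \<partial>lborel) \<partial>cube_measure) \<le> emeasure lborel U" .
      have "(\<integral>\<^sup>+x. (\<integral>\<^sup>+y. d x y * d x y \<partial>lborel) \<partial>cube_measure) \<le>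
        (\<integral>\<^sup>+x. (\<integral>\<^sup>+\<omega>. (\<integral>\<^sup>+\<omega>'. indicator {- 2 * \<rho>..2 * \<rho>} (h (x, \<omega>) - h (x, \<omega>')) \<partial>digit_space c) \<partial>digit_space c) * ?k \<partial>cube_measure)"
        unfolding d_def by (intro nn_integral_mono smoothed_square_bound prob_space_digits hx \<rho>)
      also have "\<dots> = energy c h \<rho>"
        unfolding energy_def
        by (subst nn_integral_natural) (simp_all add: natural_space_def nn_integral_multc)
      finally show "(\<integral>\<^sup>+x. (\<integral>\<^sup>+y. d x y * d x y \<partial>lborel) \<partial>cube_measure) \<le> energy c h \<rho>" .
    qed auto
    finally show ?thesis .
  qed
  let ?B = "ennreal M * emeasure lborel U + ennreal (1 / M) * L"
  have "(\<integral>\<^sup>+z. indicator U (fst z, h z) \<partial>natural_space c) \<le>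
    (\<integral>\<^sup>+z. liminf (\<lambda>m. (\<integral>\<^sup>+y. indicator U (fst z, y) * indicator {- (1 / real (Suc m))..1 / real (Suc m)} (h z - y) \<partial>lborel) *
      ennreal (1 / (2 * (1 / real (Suc m))))) \<partial>natural_space c)"
  proof (rule nn_integral_mono)
    fix z :: "(real^'n) \<times> (nat \<Rightarrow> real^'n)"
    show "indicator U (fst z, h z) \<le> liminf (\<lambda>m. (\<integral>\<^sup>+y. indicator U (fst z, y) * indicator {- (1 / real (Suc m))..1 / real (Suc m)} (h z - y) \<partial>lborel) *
      ennreal (1 / (2 * (1 / real (Suc m)))))"
    proof (cases "(fst z, h z) \<in> U")
      case True
      show ?thesis
        by (rule Liminf_bounded, rule eventually_mono[OF open_indicator_le_liminf[OF U True]]) (use True in simp)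
    qed simp
  qed
  also have "\<dots> \<le> liminf (\<lambda>m. I (1 / real (Suc m)))"
    unfolding I_def by (rule nn_integral_liminf) (simp add: natural_space_def)
  also have "\<dots> \<le> ?B"
  proof (rule ccontr)
    assume "\<not> ?thesis"
    then have "?B < liminf (\<lambda>m. I (1 / real (Suc m)))" by simp
    then have ev: "eventually (\<lambda>m. ?B < I (1 / real (Suc m))) sequentially" by (rule less_LiminfD)
    have "frequently (\<lambda>m. energy c h (1 / real (Suc m)) \<le> L \<and> ?B < I (1 / real (Suc m))) sequentially"
      by (rule frequently_eventually_frequently[OF E ev])
    then obtain m where m: "energy c h (1 / real (Suc m)) \<le> L" "?B < I (1 / real (Suc m))"
      by (auto dest!: frequently_ex)
    have "I (1 / real (Suc m)) \<le> ennreal M * emeasure lborel U + ennreal (1 / M) * energy c h (1 / real (Suc m))"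
      by (rule main) simp
    also have "\<dots> \<le> ?B" using m(1) by (intro add_left_mono mult_left_mono) auto
    finally show False using m(2) by simp
  qed
  finally show ?thesis .
qed

text \<open>A null set lies in open sets of arbitrarily small volume \<open>e\<^sup>2\<close>; take \<open>M = 1 / e\<close> in the bound for the
mass of open sets.\<close>

theorem absolutely_continuous_of_energy:
  fixes g :: "'n::finite torus \<Rightarrow> real"
  assumes c: "c \<noteq> 0" and g: "g \<in> borel_measurable borel" and L: "L < \<top>"
    and E: "frequently (\<lambda>m. energy c (fibre c lam g) (1 / real (Suc m)) \<le> L) sequentially"
  shows "absolutely_continuous volume_measure (solenoid_measure c lam g)"
  unfolding absolutely_continuous_def
proof
  let ?h = "fibre c lam g"
  fix A :: "('n torus \<times> real) set" assume A: "A \<in> null_sets volume_measure"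
  then have Am: "A \<in> sets borel" by (auto simp: null_sets_def)
  have hm: "?h \<in> borel_measurable (natural_space c)" by (rule measurable_fibre[OF g])
  have Am' [measurable]: "A \<in> sets (borel \<Otimes>\<^sub>M borel)" unfolding borel_prod by (rule Am)
  \<comment> \<open>The part of the preimage of \<open>A\<close> over the unit cube, where outer regularity of Lebesgue measure applies.\<close>
  define A' where "A' = {z :: (real^'n) \<times> real. fst z \<in> unit_cube \<and> (abs_torus (fst z), snd z) \<in> A}"
  have A'm [measurable]: "A' \<in> sets (borel \<Otimes>\<^sub>M borel)"
  proof -
    have "{z \<in> space (borel \<Otimes>\<^sub>M borel). fst z \<in> unit_cube \<and> (abs_torus (fst z), snd z) \<in> A}
        \<in> sets ((borel :: (real^'n) measure) \<Otimes>\<^sub>M (borel :: real measure))"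
      by measurable
    then show ?thesis by (simp add: A'_def space_pair_measure)
  qed
  then have A'b: "A' \<in> sets borel" unfolding borel_prod .
  have "emeasure lborel A' = emeasure (lborel \<Otimes>\<^sub>M lborel) A'" by (simp add: lborel_prod)
  also have "\<dots> = (\<integral>\<^sup>+z. indicator A' z \<partial>(lborel \<Otimes>\<^sub>M lborel))" by simp
  also have "\<dots> = (\<integral>\<^sup>+x. (\<integral>\<^sup>+y. indicator A' (x, y) \<partial>lborel) \<partial>lborel)"
    by (subst lborel.nn_integral_fst[symmetric]) simp_all
  also have "\<dots> = (\<integral>\<^sup>+x. (\<integral>\<^sup>+y. indicator A (abs_torus x, y) \<partial>lborel) * indicator unit_cube x \<partial>lborel)"
    by (intro nn_integral_cong) (auto simp: A'_def indicator_def intro!: nn_integral_cong)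
  also have "\<dots> = (\<integral>\<^sup>+x. (\<integral>\<^sup>+y. indicator A (abs_torus x, y) \<partial>lborel) \<partial>cube_measure)"
    by (rule nn_integral_cube[symmetric]) measurable
  also have "\<dots> = (\<integral>\<^sup>+p. (\<integral>\<^sup>+y. indicator A (p, y) \<partial>lborel) \<partial>torus_measure)"
    unfolding torus_measure_cube by (subst nn_integral_distr) (simp_all add: measurable_abs_torus_cube)
  also have "\<dots> = (\<integral>\<^sup>+z. indicator A z \<partial>(torus_measure \<Otimes>\<^sub>M lborel))"
  proof -
    have "(indicator A :: _ \<Rightarrow> ennreal) \<in> borel_measurable (torus_measure \<Otimes>\<^sub>M lborel)" by measurable
    then show ?thesis by (rule lborel.nn_integral_fst)
  qed
  also have "\<dots> = emeasure volume_measure A"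
    unfolding volume_measure_def[symmetric] using Am by simp
  also have "\<dots> = 0" using A by (simp add: null_sets_def)
  finally have A'0: "emeasure lborel A' = 0" .
  have "emeasure (solenoid_measure c lam g) A = (\<integral>\<^sup>+z. indicator A (abs_torus (fst z), ?h z) \<partial>natural_space c)"
  proof -
    have "emeasure (solenoid_measure c lam g) A = (\<integral>\<^sup>+v. indicator A v \<partial>solenoid_measure c lam g)"
      using Am by (simp add: solenoid_measure_def)
    also have "\<dots> = (\<integral>\<^sup>+z. indicator A (abs_torus (fst z), ?h z) \<partial>natural_space c)"
      unfolding solenoid_measure_def
      by (rule nn_integral_distr[OF measurable_solenoid_map[OF g]]) (use Am in simp)
    finally show ?thesis .
  qed
  also have "\<dots> = (\<integral>\<^sup>+z. indicator A' (fst z, ?h z) \<partial>natural_space c)"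
  proof (rule nn_integral_cong_AE)
    show "AE z in natural_space c. (indicator A (abs_torus (fst z), ?h z) :: ennreal) = indicator A' (fst z, ?h z)"
      using AE_natural_digits[OF c] by eventually_elim (simp add: A'_def indicator_def)
  qed
  finally have eq: "emeasure (solenoid_measure c lam g) A = (\<integral>\<^sup>+z. indicator A' (fst z, ?h z) \<partial>natural_space c)" .
  have le: "emeasure (solenoid_measure c lam g) A \<le> ennreal e + ennreal e * L" if e: "e > 0" for e
  proof -
    obtain U where U: "open U" "A' \<subseteq> U" "emeasure lborel (U - A') < ennreal (e * e)"
    proof (rule outer_regular_lborel[of A' "e * e"])
      show "A' \<in> sets borel" by (rule A'b)
    qed (use e in auto)
    have "emeasure lborel U \<le> emeasure lborel (U - A') + emeasure lborel A'"
      using U A'b by (subst plus_emeasure) (auto intro!: emeasure_mono)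
    also have "\<dots> \<le> ennreal (e * e)" using U(3) A'0 by simp
    finally have Ue: "emeasure lborel U \<le> ennreal (e * e)" .
    have "emeasure (solenoid_measure c lam g) A \<le> (\<integral>\<^sup>+z. indicator U (fst z, ?h z) \<partial>natural_space c)"
      unfolding eq using U(2) by (intro nn_integral_mono) (auto split: split_indicator)
    also have "\<dots> \<le> ennreal (1 / e) * emeasure lborel U + ennreal (1 / (1 / e)) * L"
      by (rule open_set_mass_bound[OF hm U(1) _ E]) (use e in simp)
    also have "\<dots> \<le> ennreal (1 / e) * ennreal (e * e) + ennreal (1 / (1 / e)) * L"
      by (intro add_right_mono mult_left_mono Ue) auto
    also have "ennreal (1 / e) * ennreal (e * e) = ennreal e"
      using e by (simp add: ennreal_mult''[symmetric])
    finally show ?thesis by simp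
  qed
  have "emeasure (solenoid_measure c lam g) A = 0"
  proof -
    obtain l where l: "L = ennreal l" "0 \<le> l" using L by (cases L) auto
    have "emeasure (solenoid_measure c lam g) A \<le> 0 + ennreal r" if r: "r > 0" for r
    proof -
      have "emeasure (solenoid_measure c lam g) A \<le> ennreal (r / (1 + l)) + ennreal (r / (1 + l)) * L"
        using l r by (intro le) simp
      also have "\<dots> = ennreal (r / (1 + l) + r / (1 + l) * l)"
        using l r by (simp add: ennreal_mult[symmetric] ennreal_plus[symmetric] del: ennreal_plus)
      also have "r / (1 + l) + r / (1 + l) * l = r * (1 + l) / (1 + l)"
        by (simp add: distrib_left add_divide_distrib)
      also have "\<dots> = r" using l(2) by simp
      finally show ?thesis by simp
    qed
    then have "emeasure (solenoid_measure c lam g) A \<le> 0" by (rule ennreal_le_epsilon)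
    then show ?thesis by simp
  qed
  then show "A \<in> null_sets (solenoid_measure c lam g)"
    using Am by (auto simp: null_sets_def solenoid_measure_def)
qed

section \<open>The energy is finite for almost every parameter\<close>

text \<open>Integrate first over the coordinate with the large coefficient: the condition confines it to an
interval of length at most \<open>2 * \<rho> / \<eta>\<close>.\<close>

lemma nn_integral_slab:
  fixes \<Delta> :: "nat \<Rightarrow> real"
  assumes I: "finite I" "k' \<in> I" and \<eta>: "0 < \<eta>" "\<eta> \<le> \<bar>\<Delta> k'\<bar>" and \<rho>: "0 \<le> \<rho>" and R: "0 \<le> R"
  shows "(\<integral>\<^sup>+t. indicator (PiE I (\<lambda>_. {- R..R})) t * indicator {- \<rho>..\<rho>} (a + (\<Sum>k\<in>I. t k * \<Delta> k)) \<partial>(\<Pi>\<^sub>M k\<in>I. lborel))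
    \<le> ennreal ((2 * R) ^ (card I - 1) * (2 * \<rho> / \<eta>))"
proof -
  interpret product_sigma_finite "\<lambda>_ :: nat. lborel :: real measure" ..
  define J where "J = I - {k'}"
  have J: "finite J" "k' \<notin> J" "I = insert k' J" using I by (auto simp: J_def)
  let ?box = "\<lambda>I. PiE I (\<lambda>_. {- R..R})"
  have boxm [measurable]: "?box K \<in> sets (\<Pi>\<^sub>M k\<in>K. lborel)" if "finite K" for K :: "nat set"
    using that by (intro sets_PiM_I_finite) auto
  have "(\<lambda>t. indicator (?box I) t * indicator {- \<rho>..\<rho>} (a + (\<Sum>k\<in>I. t k * \<Delta> k)) :: ennreal) \<in> borel_measurable (\<Pi>\<^sub>M k\<in>I. lborel)"
    using boxm[OF I(1)] by measurable
  then have m: "(\<lambda>t. indicator (?box I) t * indicator {- \<rho>..\<rho>} (a + (\<Sum>k\<in>I. t k * \<Delta> k)) :: ennreal) \<in> borel_measurable (\<Pi>\<^sub>M k\<in>insert k' J. lborel)"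
    unfolding J(3) .
  have slab: "(\<integral>\<^sup>+y. indicator {- \<rho>..\<rho>} (b + y * \<Delta> k') \<partial>lborel) \<le> ennreal (2 * \<rho> / \<eta>)" for b
  proof -
    have D: "0 < \<bar>\<Delta> k'\<bar>" using \<eta> by linarith
    have "(\<integral>\<^sup>+y. indicator {- \<rho>..\<rho>} (b + y * \<Delta> k') \<partial>lborel) \<le> (\<integral>\<^sup>+y. indicator {- (\<rho> / \<eta>)..\<rho> / \<eta>} (- b / \<Delta> k' - y) \<partial>lborel)"
    proof (rule nn_integral_mono)
      fix y
      have "- b / \<Delta> k' - y \<in> {- (\<rho> / \<eta>)..\<rho> / \<eta>}" if "b + y * \<Delta> k' \<in> {- \<rho>..\<rho>}"
      proof -
        have "\<bar>- b / \<Delta> k' - y\<bar> = \<bar>b + y * \<Delta> k'\<bar> / \<bar>\<Delta> k'\<bar>"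
        proof -
          have "- b / \<Delta> k' - y = - (b + y * \<Delta> k') / \<Delta> k'" using D by (simp add: field_simps)
          then show ?thesis by (simp only: abs_divide abs_minus_cancel)
        qed
        also have "\<dots> \<le> \<rho> / \<bar>\<Delta> k'\<bar>" using that by (intro divide_right_mono) (auto simp: abs_le_iff)
        also have "\<dots> \<le> \<rho> / \<eta>" using \<eta> \<rho> by (intro divide_left_mono) auto
        finally have le: "\<bar>- b / \<Delta> k' - y\<bar> \<le> \<rho> / \<eta>" .
        have "- (\<rho> / \<eta>) \<le> - b / \<Delta> k' - y" using abs_le_D2[OF le] by linarith
        then show ?thesis by (rule atLeastAtMost_iff[THEN iffD2, OF conjI[OF _ abs_le_D1[OF le]]])
      qed
      then show "indicator {- \<rho>..\<rho>} (b + y * \<Delta> k') \<le> (indicator {- (\<rho> / \<eta>)..\<rho> / \<eta>} (- b / \<Delta> k' - y) :: ennreal)"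
        by (auto split: split_indicator)
    qed
    also have "\<dots> = ennreal (2 * (\<rho> / \<eta>))" using \<rho> \<eta> by (intro nn_integral_ball_indicator) simp
    finally show ?thesis by simp
  qed
  have "(\<integral>\<^sup>+t. indicator (?box I) t * indicator {- \<rho>..\<rho>} (a + (\<Sum>k\<in>I. t k * \<Delta> k)) \<partial>(\<Pi>\<^sub>M k\<in>I. lborel)) =
    (\<integral>\<^sup>+x. (\<integral>\<^sup>+y. indicator (?box I) (x(k' := y)) * indicator {- \<rho>..\<rho>} (a + (\<Sum>k\<in>I. (x(k' := y)) k * \<Delta> k)) \<partial>lborel) \<partial>(\<Pi>\<^sub>M k\<in>J. lborel))"
    unfolding J(3) by (rule product_nn_integral_insert[OF J(1,2) m[unfolded J(3)]])
  also have "\<dots> \<le> (\<integral>\<^sup>+x. indicator (?box J) x * ennreal (2 * \<rho> / \<eta>) \<partial>(\<Pi>\<^sub>M k\<in>J. lborel))"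
  proof (rule nn_integral_mono)
    fix x assume x: "x \<in> space (\<Pi>\<^sub>M k\<in>J. lborel :: real measure)"
    let ?b = "a + (\<Sum>k\<in>J. x k * \<Delta> k)"
    have s: "a + (\<Sum>k\<in>I. (x(k' := y)) k * \<Delta> k) = ?b + y * \<Delta> k'" for y
    proof -
      have "(\<Sum>k\<in>J. (x(k' := y)) k * \<Delta> k) = (\<Sum>k\<in>J. x k * \<Delta> k)"
        using J(2) by (intro sum.cong) auto
      then show ?thesis unfolding J(3) using J(1,2) by simp
    qed
    have b: "indicator (?box I) (x(k' := y)) \<le> (indicator (?box J) x :: ennreal)" for y
    proof -
      have "x \<in> ?box J" if "x(k' := y) \<in> ?box I"
        using that x J(2,3) by (auto simp: PiE_iff space_PiM fun_upd_def split: if_splits)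
      then show ?thesis by (auto split: split_indicator)
    qed
    have "(\<integral>\<^sup>+y. indicator (?box I) (x(k' := y)) * indicator {- \<rho>..\<rho>} (a + (\<Sum>k\<in>I. (x(k' := y)) k * \<Delta> k)) \<partial>lborel) \<le>
      (\<integral>\<^sup>+y. indicator (?box J) x * indicator {- \<rho>..\<rho>} (?b + y * \<Delta> k') \<partial>lborel)"
      unfolding s by (intro nn_integral_mono mult_right_mono b) auto
    also have "\<dots> = indicator (?box J) x * (\<integral>\<^sup>+y. indicator {- \<rho>..\<rho>} (?b + y * \<Delta> k') \<partial>lborel)"
      by (rule nn_integral_cmult) measurable
    also have "\<dots> \<le> indicator (?box J) x * ennreal (2 * \<rho> / \<eta>)" by (intro mult_left_mono slab) auto
    finally show "(\<integral>\<^sup>+y. indicator (?box I) (x(k' := y)) * indicator {- \<rho>..\<rho>} (a + (\<Sum>k\<in>I. (x(k' := y)) k * \<Delta> k)) \<partial>lborel) \<le>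
      indicator (?box J) x * ennreal (2 * \<rho> / \<eta>)" .
  qed
  also have "\<dots> = emeasure (\<Pi>\<^sub>M k\<in>J. lborel) (?box J) * ennreal (2 * \<rho> / \<eta>)"
    using boxm[OF J(1)] by (simp add: nn_integral_multc)
  also have "emeasure (\<Pi>\<^sub>M k\<in>J. lborel) (?box J) = ennreal ((2 * R) ^ card J)"
    using R by (subst emeasure_PiM[OF J(1)]) (auto simp: ennreal_power)
  also have "\<dots> * ennreal (2 * \<rho> / \<eta>) = ennreal ((2 * R) ^ card J * (2 * \<rho> / \<eta>))"
    using R \<rho> \<eta> by (intro ennreal_mult[symmetric]) auto
  also have "card J = card I - 1" using I by (simp add: J_def)
  finally show ?thesis .
qed

lemma space_digit_space [simp]: "space (digit_space c) = UNIV"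
  by (auto simp: digit_space_def space_PiM)

lemma sets_agree [measurable]:
  "{\<omega>'. \<forall>i<n. \<omega>' i = \<omega> i} \<in> sets (digit_space c :: (nat \<Rightarrow> real^'n) measure)"
proof -
  have "{\<omega>' \<in> space (digit_space c :: (nat \<Rightarrow> real^'n) measure). \<omega>' i = \<omega> i} \<in> sets (digit_space c)" for i
  proof -
    have "(\<lambda>\<omega>'. \<omega>' i) -` {\<omega> i} \<inter> space (digit_space c :: (nat \<Rightarrow> real^'n) measure) \<in> sets (digit_space c)"
      by (rule measurable_sets[OF measurable_digit]) simp
    then show ?thesis by (simp add: vimage_def)
  qed
  then have "{\<omega>' \<in> space (digit_space c :: (nat \<Rightarrow> real^'n) measure). \<forall>i\<in>{..<n}. \<omega>' i = \<omega> i} \<in> sets (digit_space c)"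
    by (intro sets.sets_Collect_finite_All) auto
  then show ?thesis by (simp add: Ball_def lessThan_iff)
qed

lemma agree_probability:
  assumes c: "c \<noteq> 0"
  shows "emeasure (digit_space c) {\<omega>'. \<forall>i<n. \<omega>' i = (\<omega> i :: real^'n)} \<le> ennreal ((1 / \<bar>of_int c\<bar> ^ CARD('n)) ^ n)"
proof (induction n arbitrary: \<omega>)
  case 0
  have "emeasure (digit_space c :: (nat \<Rightarrow> real^'n) measure) (space (digit_space c)) = 1"
    by (rule prob_space.emeasure_space_1[OF prob_space_digits])
  then show ?case by simp
next
  case (Suc n)
  let ?N = "of_nat (card (digits c :: (real^'n) set)) :: ennreal"
  let ?\<sigma> = "\<lambda>i. \<omega> (Suc i)"
  have N: "?N = ennreal (\<bar>of_int c\<bar> ^ CARD('n))"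
    by (simp add: card_digits ennreal_of_nat_eq_real_of_nat)
  have "emeasure (digit_space c) {\<omega>'. \<forall>i<Suc n. \<omega>' i = \<omega> i} = (\<integral>\<^sup>+\<omega>'. indicator {\<omega>'. \<forall>i<Suc n. \<omega>' i = \<omega> i} \<omega>' \<partial>digit_space c)"
    by (rule nn_integral_indicator[symmetric]) (rule sets_agree)
  also have "\<dots> = (\<Sum>v\<in>digits c. \<integral>\<^sup>+\<omega>'. indicator {\<omega>'. \<forall>i<Suc n. \<omega>' i = \<omega> i} (case_nat v \<omega>') \<partial>digit_space c) / ?N"
    by (rule nn_integral_digit_space_Suc[OF c]) (intro borel_measurable_indicator sets_agree)
  also have "\<dots> = (\<Sum>v\<in>digits c. (if v = \<omega> 0 then 1 else 0) * emeasure (digit_space c) {\<omega>'. \<forall>i<n. \<omega>' i = ?\<sigma> i}) / ?N"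
  proof -
    have "(\<integral>\<^sup>+\<omega>'. indicator {\<omega>'. \<forall>i<Suc n. \<omega>' i = \<omega> i} (case_nat v \<omega>') \<partial>digit_space c) =
      (if v = \<omega> 0 then 1 else 0) * emeasure (digit_space c) {\<omega>'. \<forall>i<n. \<omega>' i = ?\<sigma> i}" for v
    proof -
      have "(\<integral>\<^sup>+\<omega>'. indicator {\<omega>'. \<forall>i<Suc n. \<omega>' i = \<omega> i} (case_nat v \<omega>') \<partial>digit_space c) =
        (\<integral>\<^sup>+\<omega>'. (if v = \<omega> 0 then 1 else 0) * indicator {\<omega>'. \<forall>i<n. \<omega>' i = ?\<sigma> i} \<omega>' \<partial>digit_space c)"
        by (intro nn_integral_cong) (auto simp: indicator_def All_less_Suc2)
      also have "\<dots> = (if v = \<omega> 0 then 1 else 0) * (\<integral>\<^sup>+\<omega>'. indicator {\<omega>'. \<forall>i<n. \<omega>' i = ?\<sigma> i} \<omega>' \<partial>digit_space c)"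
        by (rule nn_integral_cmult) (intro borel_measurable_indicator sets_agree)
      also have "(\<integral>\<^sup>+\<omega>'. indicator {\<omega>'. \<forall>i<n. \<omega>' i = ?\<sigma> i} \<omega>' \<partial>digit_space c) = emeasure (digit_space c) {\<omega>'. \<forall>i<n. \<omega>' i = ?\<sigma> i}"
        by (rule nn_integral_indicator) (rule sets_agree)
      finally show ?thesis .
    qed
    then show ?thesis by simp
  qed
  also have "\<dots> \<le> emeasure (digit_space c) {\<omega>'. \<forall>i<n. \<omega>' i = ?\<sigma> i} / ?N"
  proof (rule divide_right_mono_ennreal)
    have "(\<Sum>v\<in>digits c. (if v = \<omega> 0 then 1 else 0) :: ennreal) \<le> 1"
      using finite_digits[of c] by (subst sum.delta) auto
    then have "(\<Sum>v\<in>digits c. (if v = \<omega> 0 then 1 else 0)) * emeasure (digit_space c) {\<omega>'. \<forall>i<n. \<omega>' i = ?\<sigma> i}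
        \<le> 1 * emeasure (digit_space c) {\<omega>'. \<forall>i<n. \<omega>' i = ?\<sigma> i}" by (intro mult_right_mono) auto
    then show "(\<Sum>v\<in>digits c. (if v = \<omega> 0 then 1 else 0) * emeasure (digit_space c) {\<omega>'. \<forall>i<n. \<omega>' i = ?\<sigma> i})
      \<le> emeasure (digit_space c) {\<omega>'. \<forall>i<n. \<omega>' i = ?\<sigma> i}" by (simp add: sum_distrib_right)
  qed
  also have "\<dots> \<le> ennreal ((1 / \<bar>of_int c\<bar> ^ CARD('n)) ^ n) / ?N"
    by (intro divide_right_mono_ennreal Suc.IH)
  also have "\<dots> = ennreal ((1 / \<bar>of_int c\<bar> ^ CARD('n)) ^ Suc n)"
    unfolding N using c by (subst divide_ennreal) (auto simp: mult.commute)
  finally show ?case .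
qed

text \<open>Dominates \<open>lam ^ (- n)\<close> whenever the sequences agree in their first \<open>n\<close> entries, and has a finite
integral if \<open>lam\<close> exceeds the inverse of the number of digits.\<close>

definition agreement_weight :: "real \<Rightarrow> (nat \<Rightarrow> 'a) \<Rightarrow> (nat \<Rightarrow> 'a) \<Rightarrow> ennreal"
  where "agreement_weight lam \<omega> \<omega>' = (\<Sum>n. ennreal ((1 / lam) ^ n) * indicator {\<omega>'. \<forall>i<n. \<omega>' i = \<omega> i} \<omega>')"

lemma agreement_weight_ge:
  assumes "\<And>i. i < n \<Longrightarrow> \<omega>' i = \<omega> i"
  shows "ennreal ((1 / lam) ^ n) \<le> agreement_weight lam \<omega> \<omega>'"
proof -
  have "ennreal ((1 / lam) ^ n) = (\<Sum>m\<in>{n}. ennreal ((1 / lam) ^ m) * indicator {\<omega>'. \<forall>i<m. \<omega>' i = \<omega> i} \<omega>')"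
    using assms by simp
  also have "\<dots> \<le> agreement_weight lam \<omega> \<omega>'"
    unfolding agreement_weight_def by (rule sum_le_suminf) auto
  finally show ?thesis .
qed

lemma agreement_weight_integral:
  assumes c: "c \<noteq> 0" and lam: "0 < lam" "1 < lam * \<bar>of_int c\<bar> ^ CARD('n)"
  shows "(\<integral>\<^sup>+\<omega>'. agreement_weight lam \<omega> \<omega>' \<partial>(digit_space c :: (nat \<Rightarrow> real^'n) measure)) \<le>
    ennreal (1 / (1 - 1 / (lam * \<bar>of_int c\<bar> ^ CARD('n))))"
proof -
  let ?N = "\<bar>of_int c\<bar> ^ CARD('n) :: real" 
  let ?q = "1 / (lam * ?N)"
  have q: "0 \<le> ?q" "?q < 1" using lam by auto
  have "(\<integral>\<^sup>+\<omega>'. agreement_weight lam \<omega> \<omega>' \<partial>(digit_space c :: (nat \<Rightarrow> real^'n) measure)) =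
    (\<Sum>n. \<integral>\<^sup>+\<omega>'. ennreal ((1 / lam) ^ n) * indicator {\<omega>'. \<forall>i<n. \<omega>' i = \<omega> i} \<omega>' \<partial>digit_space c)"
    unfolding agreement_weight_def
    by (rule nn_integral_suminf) (intro borel_measurable_times_ennreal borel_measurable_const borel_measurable_indicator sets_agree)
  also have "\<dots> = (\<Sum>n. ennreal ((1 / lam) ^ n) * emeasure (digit_space c) {\<omega>'. \<forall>i<n. \<omega>' i = \<omega> i})"
    by (intro suminf_cong nn_integral_cmult_indicator sets_agree)
  also have "\<dots> \<le> (\<Sum>n. ennreal (?q ^ n))"
  proof (intro suminf_le)
    fix n
    have "ennreal ((1 / lam) ^ n) * emeasure (digit_space c) {\<omega>'. \<forall>i<n. \<omega>' i = \<omega> i} \<le>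
        ennreal ((1 / lam) ^ n) * ennreal ((1 / ?N) ^ n)"
      by (intro mult_left_mono agree_probability c) auto
    also have "\<dots> = ennreal ((1 / lam) ^ n * (1 / ?N) ^ n)" using lam by (intro ennreal_mult[symmetric]) auto
    also have "(1 / lam) ^ n * (1 / ?N) ^ n = ?q ^ n" by (simp add: power_mult_distrib[symmetric])
    finally show "ennreal ((1 / lam) ^ n) * emeasure (digit_space c) {\<omega>'. \<forall>i<n. \<omega>' i = \<omega> i} \<le> ennreal (?q ^ n)" .
  qed auto
  also have "\<dots> = ennreal (\<Sum>n. ?q ^ n)" using q by (intro suminf_ennreal2 summable_geometric) auto
  also have "(\<Sum>n. ?q ^ n) = 1 / (1 - ?q)" using q by (intro suminf_geometric) simp
  finally show ?thesis .
qed

lemma preorbit_agree: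
  assumes "\<And>i. i < n \<Longrightarrow> \<omega> i = \<omega>' i"
  shows "preorbit c x \<omega> n = preorbit c x \<omega>' n"
  using assms by (induction n) auto

lemma fibre_split:
  fixes g :: "'n::finite torus \<Rightarrow> real"
  assumes lam: "0 \<le> lam" "lam < 1" and g: "\<And>p. \<bar>g p\<bar> \<le> G"
  shows "fibre c lam g (x, \<omega>) = lam ^ n * fibre c lam g (preorbit c x \<omega> n, \<lambda>i. \<omega> (n + i)) +
    (\<Sum>i<n. lam ^ i * g (abs_torus (preorbit c x \<omega> (Suc i))))"
proof -
  have s: "summable (\<lambda>n. lam ^ n * g (abs_torus (preorbit c x \<omega> (Suc n))))" for x \<omega>
    by (rule fibre_summable[OF lam]) (rule g)
  have "fibre c lam g (x, \<omega>) = (\<Sum>i. lam ^ (i + n) * g (abs_torus (preorbit c x \<omega> (Suc (i + n))))) +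
    (\<Sum>i<n. lam ^ i * g (abs_torus (preorbit c x \<omega> (Suc i))))"
    unfolding fibre_def fst_conv snd_conv by (rule suminf_split_initial_segment[OF s])
  also have "(\<Sum>i. lam ^ (i + n) * g (abs_torus (preorbit c x \<omega> (Suc (i + n))))) =
    (\<Sum>i. lam ^ n * (lam ^ i * g (abs_torus (preorbit c (preorbit c x \<omega> n) (\<lambda>i. \<omega> (n + i)) (Suc i)))))"
  proof (rule suminf_cong)
    fix i
    have "preorbit c x \<omega> (Suc (i + n)) = preorbit c (preorbit c x \<omega> n) (\<lambda>i. \<omega> (n + i)) (Suc i)"
      using preorbit_shift[of c x \<omega> n "Suc i"] by (simp only: add_Suc_right add.commute[of i])
    then show "lam ^ (i + n) * g (abs_torus (preorbit c x \<omega> (Suc (i + n)))) =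
      lam ^ n * (lam ^ i * g (abs_torus (preorbit c (preorbit c x \<omega> n) (\<lambda>i. \<omega> (n + i)) (Suc i))))"
      by (simp add: power_add mult_ac del: preorbit.simps)
  qed
  also have "\<dots> = lam ^ n * fibre c lam g (preorbit c x \<omega> n, \<lambda>i. \<omega> (n + i))"
    unfolding fibre_def fst_conv snd_conv by (rule suminf_mult[OF s])
  finally show ?thesis .
qed

text \<open>The common initial steps contribute equal terms, and the remaining series is a copy of \<open>fibre\<close> with
factor \<open>lam ^ n\<close>.\<close>

lemma fibre_diff_agree:
  fixes g :: "'n::finite torus \<Rightarrow> real"
  assumes lam: "0 \<le> lam" "lam < 1" and g: "\<And>p. \<bar>g p\<bar> \<le> G"
    and agree: "\<And>i. i < n \<Longrightarrow> \<omega> i = \<omega>' i"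
  shows "fibre c lam g (x, \<omega>) - fibre c lam g (x, \<omega>') = lam ^ n *
    (fibre c lam g (preorbit c x \<omega> n, \<lambda>i. \<omega> (n + i)) - fibre c lam g (preorbit c x \<omega> n, \<lambda>i. \<omega>' (n + i)))"
proof -
  have p: "preorbit c x \<omega> k = preorbit c x \<omega>' k" if "k \<le> n" for k
    using agree that by (intro preorbit_agree) auto
  have "(\<Sum>i<n. lam ^ i * g (abs_torus (preorbit c x \<omega> (Suc i)))) = (\<Sum>i<n. lam ^ i * g (abs_torus (preorbit c x \<omega>' (Suc i))))"
    by (intro sum.cong refl) (simp only: p lessThan_iff Suc_leI)
  then show ?thesis
    using fibre_split[where g = g and n = n and x = x and \<omega> = \<omega> and c = c, OF lam g]
      fibre_split[where g = g and n = n and x = x and \<omega> = \<omega>' and c = c, OF lam g] p[of n]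
    by (simp add: right_diff_distrib)
qed

lemma fibre_affine:
  fixes f :: "'n::finite torus \<Rightarrow> real"
  assumes lam: "0 \<le> lam" "lam < 1" and f: "continuous_on UNIV f"
    and \<phi>: "\<And>k. k \<in> I \<Longrightarrow> continuous_on UNIV (\<phi> k)"
  shows "fibre c lam (\<lambda>x. f x + (\<Sum>k\<in>I. t k * \<phi> k x)) z = fibre c lam f z + (\<Sum>k\<in>I. t k * fibre c lam (\<phi> k) z)"
proof -
  have s: "(\<lambda>n. lam ^ n * g (abs_torus (preorbit c (fst z) (snd z) (Suc n)))) sums fibre c lam g z"
    if g: "continuous_on UNIV g" for g :: "'n torus \<Rightarrow> real"
  proof -
    obtain G where G: "\<And>p. \<bar>g p\<bar> \<le> G" using bounded_continuous_torus[OF g] by blast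
    show ?thesis unfolding fibre_def by (rule summable_sums[OF fibre_summable[OF lam]]) (rule G)
  qed
  have "(\<lambda>n. lam ^ n * f (abs_torus (preorbit c (fst z) (snd z) (Suc n))) +
      (\<Sum>k\<in>I. t k * (lam ^ n * \<phi> k (abs_torus (preorbit c (fst z) (snd z) (Suc n))))))
    sums (fibre c lam f z + (\<Sum>k\<in>I. t k * fibre c lam (\<phi> k) z))"
    by (intro sums_add sums_sum sums_mult s f \<phi>)
  moreover have "lam ^ n * f (abs_torus (preorbit c (fst z) (snd z) (Suc n))) +
      (\<Sum>k\<in>I. t k * (lam ^ n * \<phi> k (abs_torus (preorbit c (fst z) (snd z) (Suc n))))) =
    lam ^ n * (f (abs_torus (preorbit c (fst z) (snd z) (Suc n))) + (\<Sum>k\<in>I. t k * \<phi> k (abs_torus (preorbit c (fst z) (snd z) (Suc n)))))" for n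
    by (simp add: distrib_left sum_distrib_left mult_ac del: preorbit.simps)
  ultimately show ?thesis unfolding fibre_def[of c lam "\<lambda>x. f x + (\<Sum>k\<in>I. t k * \<phi> k x)"]
    by (simp only: sums_unique[symmetric])
qed

text \<open>For negative \<open>c\<close> preorbits leave the unit cube. The bound \<open>2\<close> is preserved, since
\<open>(2 + \<bar>c\<bar> - 1) / \<bar>c\<bar> \<le> 2\<close>.\<close>

definition wide_box :: "(real^'n) set"
  where "wide_box = {x. \<forall>i. \<bar>x $ i\<bar> \<le> 2}"

lemma compact_wide_box: "compact (wide_box :: (real^'n) set)"
proof -
  have "(wide_box :: (real^'n) set) = cbox (\<chi> i. - 2) (\<chi> i. (2 :: real))"
    by (auto simp: wide_box_def mem_box_cart abs_le_iff) (smt (verit))+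
  then show ?thesis by (rule ssubst) (rule compact_cbox)
qed

lemma preorbit_wide_box:
  assumes c: "\<bar>c\<bar> \<ge> 2" and \<omega>: "\<omega> \<in> digit_seqs c" and x: "x \<in> (wide_box :: (real^'n) set)"
  shows "preorbit c x \<omega> n \<in> wide_box"
proof (induction n)
  case (Suc n)
  have "\<bar>preorbit c x \<omega> (Suc n) $ i\<bar> \<le> 2" for i
  proof -
    obtain k :: int where k: "0 \<le> k" "k < \<bar>c\<bar>" "\<omega> n $ i = of_int k"
      using \<omega> unfolding digit_seqs_def digits_def by blast
    have "of_int k \<le> (of_int (\<bar>c\<bar> - 1) :: real)" using k(2) by (simp only: of_int_le_iff)
    then have k': "0 \<le> \<omega> n $ i" "\<omega> n $ i \<le> \<bar>of_int c\<bar> - 1" using k by simp_all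
    have "\<bar>preorbit c x \<omega> n $ i\<bar> \<le> 2" using Suc by (simp add: wide_box_def)
    then have "\<bar>preorbit c x \<omega> n $ i + \<omega> n $ i\<bar> \<le> \<bar>of_int c\<bar> + 1" using k' by linarith
    also have "\<dots> \<le> 2 * \<bar>of_int c\<bar>"
    proof -
      have "(2::real) \<le> of_int \<bar>c\<bar>" using c by (metis of_int_le_iff of_int_numeral)
      then show ?thesis by simp
    qed
    finally have "\<bar>preorbit c x \<omega> n $ i + \<omega> n $ i\<bar> / \<bar>of_int c\<bar> \<le> 2" using c by (simp add: field_simps)
    then show ?thesis by (simp add: abs_mult inverse_eq_divide)
  qed
  then show ?case by (simp add: wide_box_def del: preorbit.simps)
qed (use x in simp)

lemma unit_cube_wide_box: "unit_cube \<subseteq> wide_box"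
  unfolding unit_cube_def wide_box_def by (auto simp: abs_le_iff) (smt (verit))+

locale transversal_family =
  fixes c :: int and lam \<delta> :: real and s :: nat and \<phi> :: "nat \<Rightarrow> 'n::finite torus \<Rightarrow> real"
    and f :: "'n torus \<Rightarrow> real"
  assumes c: "\<bar>c\<bar> \<ge> 2" and lam: "0 < lam" "lam < 1" and expand: "1 < lam * \<bar>of_int c\<bar> ^ CARD('n)"
    and delta: "0 < \<delta>" and cont_\<phi>: "\<And>k. k \<in> {1..s} \<Longrightarrow> continuous_on UNIV (\<phi> k)" and cont_f: "continuous_on UNIV f"
    and transversal: "\<And>x \<omega> \<omega>'. x \<in> wide_box \<Longrightarrow> \<omega> \<in> digit_seqs c \<Longrightarrow> \<omega>' \<in> digit_seqs c \<Longrightarrow> \<omega> 0 \<noteq> \<omega>' 0 \<Longrightarrow>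
      \<exists>k\<in>{1..s}. \<delta> \<le> \<bar>fibre c lam (\<phi> k) (x, \<omega>) - fibre c lam (\<phi> k) (x, \<omega>')\<bar>"
begin

lemma c_nonzero: "c \<noteq> 0" using c by auto

definition perturbed :: "(nat \<Rightarrow> real) \<Rightarrow> (real^'n) \<times> (nat \<Rightarrow> real^'n) \<Rightarrow> real"
  where "perturbed t z = fibre c lam f z + (\<Sum>k\<in>{1..s}. t k * fibre c lam (\<phi> k) z)"

abbreviation params :: "(nat \<Rightarrow> real) measure"
  where "params \<equiv> (\<Pi>\<^sub>M k\<in>{1..s}. lborel)"

abbreviation box :: "real \<Rightarrow> (nat \<Rightarrow> real) set"
  where "box R \<equiv> PiE {1..s} (\<lambda>_. {- R..R})"

lemma transversal_at_first_difference:
  assumes x: "x \<in> wide_box" and \<omega>: "\<omega> \<in> digit_seqs c" "\<omega>' \<in> digit_seqs c"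
    and agree: "\<And>i. i < n \<Longrightarrow> \<omega> i = \<omega>' i" and diff: "\<omega> n \<noteq> \<omega>' n"
  shows "\<exists>k\<in>{1..s}. lam ^ n * \<delta> \<le> \<bar>fibre c lam (\<phi> k) (x, \<omega>) - fibre c lam (\<phi> k) (x, \<omega>')\<bar>"
proof -
  have shift: "(\<lambda>i. \<omega> (n + i)) \<in> digit_seqs c" "(\<lambda>i. \<omega>' (n + i)) \<in> digit_seqs c"
    using \<omega> by (auto simp: digit_seqs_def)
  have "\<omega> (n + 0) \<noteq> \<omega>' (n + 0)" using diff by simp
  from transversal[OF preorbit_wide_box[OF c \<omega>(1) x, of n] shift this] obtain k where k: "k \<in> {1..s}" "\<delta> \<le> \<bar>fibre c lam (\<phi> k) (preorbit c x \<omega> n, \<lambda>i. \<omega> (n + i)) -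
      fibre c lam (\<phi> k) (preorbit c x \<omega> n, \<lambda>i. \<omega>' (n + i))\<bar>"
    by blast
  obtain G where G: "\<And>p. \<bar>\<phi> k p\<bar> \<le> G" using bounded_continuous_torus[OF cont_\<phi>[OF k(1)]] by blast
  have "fibre c lam (\<phi> k) (x, \<omega>) - fibre c lam (\<phi> k) (x, \<omega>') = lam ^ n *
    (fibre c lam (\<phi> k) (preorbit c x \<omega> n, \<lambda>i. \<omega> (n + i)) - fibre c lam (\<phi> k) (preorbit c x \<omega> n, \<lambda>i. \<omega>' (n + i)))"
    by (rule fibre_diff_agree[where G = G]) (use lam G agree in auto)
  then have "\<bar>fibre c lam (\<phi> k) (x, \<omega>) - fibre c lam (\<phi> k) (x, \<omega>')\<bar> = lam ^ n *
    \<bar>fibre c lam (\<phi> k) (preorbit c x \<omega> n, \<lambda>i. \<omega> (n + i)) - fibre c lam (\<phi> k) (preorbit c x \<omega> n, \<lambda>i. \<omega>' (n + i))\<bar>"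
    using lam by (simp add: abs_mult)
  then show ?thesis using k lam by (intro bexI[of _ k]) (auto intro!: mult_left_mono)
qed

text \<open>If the sequences first differ at \<open>n\<close>, the slab has a coefficient of size at least
\<open>lam ^ n * \<delta>\<close>. If they are equal, the weight exceeds every power of \<open>1 / lam\<close>.\<close>

lemma parameter_integral_le:
  assumes x: "x \<in> wide_box" and \<omega>: "\<omega> \<in> digit_seqs c" "\<omega>' \<in> digit_seqs c" and R: "R > 0" and \<rho>: "\<rho> > 0"
  shows "(\<integral>\<^sup>+t. indicator (box R) t * indicator {- \<rho>..\<rho>} (perturbed t (x, \<omega>) - perturbed t (x, \<omega>')) \<partial>params)
     \<le> ennreal ((2 * R) ^ (s - 1) * (2 * \<rho> / \<delta>)) * agreement_weight lam \<omega> \<omega>'"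
proof -
  define \<Delta> where "\<Delta> k = fibre c lam (\<phi> k) (x, \<omega>) - fibre c lam (\<phi> k) (x, \<omega>')" for k
  define a where "a = fibre c lam f (x, \<omega>) - fibre c lam f (x, \<omega>')"
  have p: "perturbed t (x, \<omega>) - perturbed t (x, \<omega>') = a + (\<Sum>k\<in>{1..s}. t k * \<Delta> k)" for t
    by (simp add: perturbed_def a_def \<Delta>_def right_diff_distrib sum_subtractf)
  show ?thesis
  proof (cases "\<omega> = \<omega>'")
    case False
    then have ex: "\<exists>n. \<omega> n \<noteq> \<omega>' n" by (auto simp: fun_eq_iff)
    define n where "n = (LEAST n. \<omega> n \<noteq> \<omega>' n)"
    have n: "\<omega> n \<noteq> \<omega>' n" unfolding n_def by (rule LeastI_ex[OF ex])
    have agree: "\<omega> i = \<omega>' i" if "i < n" for i using not_less_Least[of i] that unfolding n_def by blast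
    obtain k where k: "k \<in> {1..s}" "lam ^ n * \<delta> \<le> \<bar>\<Delta> k\<bar>"
      using transversal_at_first_difference[OF x \<omega> agree n] unfolding \<Delta>_def by blast
    have "(\<integral>\<^sup>+t. indicator (box R) t * indicator {- \<rho>..\<rho>} (a + (\<Sum>k\<in>{1..s}. t k * \<Delta> k)) \<partial>params) \<le>
      ennreal ((2 * R) ^ (card {1..s} - 1) * (2 * \<rho> / (lam ^ n * \<delta>)))"
      by (rule nn_integral_slab[where \<Delta> = \<Delta> and k' = k and \<eta> = "lam ^ n * \<delta>"]) (use k lam delta \<rho> R in auto)
    also have "(2 * R) ^ (card {1..s} - 1) * (2 * \<rho> / (lam ^ n * \<delta>)) = ((2 * R) ^ (s - 1) * (2 * \<rho> / \<delta>)) * (1 / lam) ^ n"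
      by (simp add: field_simps power_divide)
    also have "ennreal \<dots> = ennreal ((2 * R) ^ (s - 1) * (2 * \<rho> / \<delta>)) * ennreal ((1 / lam) ^ n)"
      using lam delta \<rho> R by (intro ennreal_mult) auto
    also have "\<dots> \<le> ennreal ((2 * R) ^ (s - 1) * (2 * \<rho> / \<delta>)) * agreement_weight lam \<omega> \<omega>'"
      by (intro mult_left_mono agreement_weight_ge) (auto simp: agree)
    finally show ?thesis unfolding p .
  next
    case True
    let ?C = "(2 * R) ^ (s - 1) * (2 * \<rho> / \<delta>)"
    have C: "?C > 0" using R \<rho> delta by simp
    interpret product_sigma_finite "\<lambda>_ :: nat. lborel :: real measure" ..
    have "(1 / lam) > 1" using lam by simp
    then obtain n where n: "(2 * R) ^ s / ?C < (1 / lam) ^ n" using real_arch_pow by blast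
    have "(\<integral>\<^sup>+t. indicator (box R) t * indicator {- \<rho>..\<rho>} (perturbed t (x, \<omega>) - perturbed t (x, \<omega>')) \<partial>params)
      \<le> (\<integral>\<^sup>+t. indicator (box R) t \<partial>params)"
      by (intro nn_integral_mono) (auto split: split_indicator)
    also have "\<dots> = emeasure params (box R)"
      by (intro nn_integral_indicator sets_PiM_I_finite) auto
    also have "\<dots> = ennreal ((2 * R) ^ s)"
      using R by (subst emeasure_PiM) (auto simp: ennreal_power)
    also have "\<dots> \<le> ennreal (?C * (1 / lam) ^ n)"
    proof (rule ennreal_leI)
      have "(2 * R) ^ s / ?C * ?C \<le> (1 / lam) ^ n * ?C" using n C by (intro mult_right_mono) auto
      moreover have "(2 * R) ^ s / ?C * ?C = (2 * R) ^ s" by (rule nonzero_eq_divide_eq[THEN iffD1, OF _ refl]) (use C in linarith)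
      ultimately show "(2 * R) ^ s \<le> ?C * (1 / lam) ^ n" by (simp only: mult.commute)
    qed
    also have "\<dots> = ennreal ?C * ennreal ((1 / lam) ^ n)" using C lam by (intro ennreal_mult) auto
    also have "\<dots> \<le> ennreal ?C * agreement_weight lam \<omega> \<omega>'"
      by (intro mult_left_mono agreement_weight_ge) (auto simp: True)
    finally show ?thesis .
  qed
qed

lemma measurable_fibre_phi: "k \<in> {1..s} \<Longrightarrow> fibre c lam (\<phi> k) \<in> borel_measurable (natural_space c)"
  by (intro measurable_fibre borel_measurable_continuous_onI cont_\<phi>)

lemma measurable_fibre_f: "fibre c lam f \<in> borel_measurable (natural_space c)"
  by (intro measurable_fibre borel_measurable_continuous_onI cont_f)

lemma measurable_perturbed:
  assumes "T \<in> measurable M params" "Z \<in> measurable M (natural_space c)"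
  shows "(\<lambda>v. perturbed (T v) (Z v)) \<in> borel_measurable M"
  unfolding perturbed_def
proof (intro borel_measurable_add borel_measurable_sum borel_measurable_times)
  show "(\<lambda>v. fibre c lam f (Z v)) \<in> borel_measurable M"
    by (rule measurable_compose[OF assms(2) measurable_fibre_f])
  fix k assume k: "k \<in> {1..s}"
  show "(\<lambda>v. fibre c lam (\<phi> k) (Z v)) \<in> borel_measurable M"
    by (rule measurable_compose[OF assms(2) measurable_fibre_phi[OF k]])
  have "(\<lambda>v. T v k) \<in> measurable M (lborel :: real measure)"
    by (rule measurable_compose[OF assms(1) measurable_component_singleton[OF k]])
  then show "(\<lambda>v. T v k) \<in> borel_measurable M" by simp
qed

text \<open>The factors \<open>\<rho>\<close> from the slabs and from the normalisation of the energy cancel, which leaves a bound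
that does not depend on the scale.\<close>

lemma energy_parameter_integral:
  assumes R: "R > 0" and \<rho>: "\<rho> > 0"
  shows "(\<integral>\<^sup>+t. indicator (box R) t * energy c (perturbed t) \<rho> \<partial>params) \<le>
    ennreal ((2 * R) ^ (s - 1) * (2 / \<delta>)) * ennreal (1 / (1 - 1 / (lam * \<bar>of_int c\<bar> ^ CARD('n))))"
proof -
  interpret P: prob_space "digit_space c :: (nat \<Rightarrow> real^'n) measure" by (rule prob_space_digits)
  interpret N: prob_space "natural_space c :: ((real^'n) \<times> (nat \<Rightarrow> real^'n)) measure" by (rule prob_space_natural)
  interpret PR: product_sigma_finite "\<lambda>_ :: nat. lborel :: real measure" ..
  interpret FP: finite_product_sigma_finite "\<lambda>_ :: nat. lborel :: real measure" "{1..s}" by standard auto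
  interpret TP: pair_sigma_finite params "digit_space c :: (nat \<Rightarrow> real^'n) measure" ..
  interpret TN: pair_sigma_finite params "natural_space c :: ((real^'n) \<times> (nat \<Rightarrow> real^'n)) measure" ..
  let ?k = "ennreal (1 / (2 * \<rho>))"
  let ?h = "\<lambda>t z \<omega>. indicator (box R) t * indicator {- (2 * \<rho>)..2 * \<rho>} (perturbed t z - perturbed t (fst z, \<omega>)) :: ennreal"
  have boxm [measurable]: "box R \<in> sets params" by (intro sets_PiM_I_finite) auto
  have fstm: "(\<lambda>v. fst v) \<in> measurable (natural_space c) cube_measure"
    unfolding natural_space_def by simp
  have pairm: "(\<lambda>v. (fst (Z v), W v)) \<in> measurable M (natural_space c)"
    if "Z \<in> measurable M (natural_space c)" "W \<in> measurable M (digit_space c)" for Z W and M :: "'z measure"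
    unfolding natural_space_def
    by (intro measurable_Pair measurable_compose[OF that(1) fstm] that(2))
  have hm: "(\<lambda>v. ?h (T v) (Z v) (W v)) \<in> borel_measurable M"
    if T: "T \<in> measurable M params" and Z: "Z \<in> measurable M (natural_space c)" and W: "W \<in> measurable M (digit_space c)"
    for T Z W and M :: "'z measure"
  proof (intro borel_measurable_times_ennreal)
    show "(\<lambda>v. indicator (box R) (T v) :: ennreal) \<in> borel_measurable M"
      by (rule measurable_compose[OF T borel_measurable_indicator[OF boxm]])
    have "(\<lambda>v. perturbed (T v) (Z v) - perturbed (T v) (fst (Z v), W v)) \<in> borel_measurable M"
      by (intro borel_measurable_diff measurable_perturbed T Z pairm W)
    then show "(\<lambda>v. indicator {- (2 * \<rho>)..2 * \<rho>} (perturbed (T v) (Z v) - perturbed (T v) (fst (Z v), W v)) :: ennreal) \<in> borel_measurable M"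
      by (rule measurable_compose) simp
  qed
  have inner: "(\<lambda>(t, z). \<integral>\<^sup>+\<omega>. ?h t z \<omega> \<partial>digit_space c) \<in> borel_measurable (params \<Otimes>\<^sub>M natural_space c)"
    unfolding split_beta'
    by (intro P.borel_measurable_nn_integral)
      (unfold split_beta', intro hm measurable_snd measurable_compose[OF measurable_fst measurable_fst] measurable_compose[OF measurable_fst measurable_snd])
  have "(\<integral>\<^sup>+t. indicator (box R) t * energy c (perturbed t) \<rho> \<partial>params) =
    (\<integral>\<^sup>+t. (\<integral>\<^sup>+z. (\<integral>\<^sup>+\<omega>. ?h t z \<omega> \<partial>digit_space c) \<partial>natural_space c) * ?k \<partial>params)"
  proof (rule nn_integral_cong)
    fix t :: "nat \<Rightarrow> real"
    show "indicator (box R) t * energy c (perturbed t) \<rho> =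
      (\<integral>\<^sup>+z. (\<integral>\<^sup>+\<omega>. ?h t z \<omega> \<partial>digit_space c) \<partial>natural_space c) * ?k"
      by (cases "t \<in> box R") (simp_all add: energy_def)
  qed
  also have "\<dots> = (\<integral>\<^sup>+t. (\<integral>\<^sup>+z. (\<integral>\<^sup>+\<omega>. ?h t z \<omega> \<partial>digit_space c) \<partial>natural_space c) \<partial>params) * ?k"
  proof (rule nn_integral_multc)
    show "(\<lambda>t. \<integral>\<^sup>+z. (\<integral>\<^sup>+\<omega>. ?h t z \<omega> \<partial>digit_space c) \<partial>natural_space c) \<in> borel_measurable params"
      by (rule N.borel_measurable_nn_integral[OF inner])
  qed
  finally have X: "(\<integral>\<^sup>+t. indicator (box R) t * energy c (perturbed t) \<rho> \<partial>params) =
    (\<integral>\<^sup>+t. (\<integral>\<^sup>+z. (\<integral>\<^sup>+\<omega>. ?h t z \<omega> \<partial>digit_space c) \<partial>natural_space c) \<partial>params) * ?k" .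
  have "(\<integral>\<^sup>+t. (\<integral>\<^sup>+z. (\<integral>\<^sup>+\<omega>. ?h t z \<omega> \<partial>digit_space c) \<partial>natural_space c) \<partial>params) =
    (\<integral>\<^sup>+z. (\<integral>\<^sup>+t. (\<integral>\<^sup>+\<omega>. ?h t z \<omega> \<partial>digit_space c) \<partial>params) \<partial>natural_space c)"
    by (rule TN.Fubini'[symmetric, OF inner])
  also have "\<dots> = (\<integral>\<^sup>+z. (\<integral>\<^sup>+\<omega>. (\<integral>\<^sup>+t. ?h t z \<omega> \<partial>params) \<partial>digit_space c) \<partial>natural_space c)"
  proof (rule nn_integral_cong)
    fix z :: "(real^'n) \<times> (nat \<Rightarrow> real^'n)" assume "z \<in> space (natural_space c)"
    show "(\<integral>\<^sup>+t. (\<integral>\<^sup>+\<omega>. ?h t z \<omega> \<partial>digit_space c) \<partial>params) = (\<integral>\<^sup>+\<omega>. (\<integral>\<^sup>+t. ?h t z \<omega> \<partial>params) \<partial>digit_space c)"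
    proof (rule TP.Fubini'[symmetric])
      show "(\<lambda>(t, \<omega>). ?h t z \<omega>) \<in> borel_measurable (params \<Otimes>\<^sub>M digit_space c)"
        unfolding split_beta' by (intro hm measurable_fst measurable_snd measurable_const) fact
    qed
  qed
  also have "\<dots> \<le> (\<integral>\<^sup>+z. ennreal ((2 * R) ^ (s - 1) * (2 * (2 * \<rho>) / \<delta>)) * ennreal (1 / (1 - 1 / (lam * \<bar>of_int c\<bar> ^ CARD('n))))
       \<partial>(natural_space c :: ((real^'n) \<times> (nat \<Rightarrow> real^'n)) measure))"
  proof (rule nn_integral_mono_AE)
    show "AE z in natural_space c. (\<integral>\<^sup>+\<omega>. (\<integral>\<^sup>+t. ?h t z \<omega> \<partial>params) \<partial>digit_space c) \<le>
      ennreal ((2 * R) ^ (s - 1) * (2 * (2 * \<rho>) / \<delta>)) * ennreal (1 / (1 - 1 / (lam * \<bar>of_int c\<bar> ^ CARD('n))))"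
      using AE_natural_digits[OF c_nonzero]
    proof eventually_elim
      case (elim z)
      then have z: "fst z \<in> wide_box" "snd z \<in> digit_seqs c"
        using unit_cube_wide_box by (auto simp: digit_seqs_def)
      let ?C = "ennreal ((2 * R) ^ (s - 1) * (2 * (2 * \<rho>) / \<delta>))"
      have "(\<integral>\<^sup>+\<omega>. (\<integral>\<^sup>+t. ?h t z \<omega> \<partial>params) \<partial>digit_space c) \<le> (\<integral>\<^sup>+\<omega>. ?C * agreement_weight lam (snd z) \<omega> \<partial>digit_space c)"
      proof (rule nn_integral_mono_AE)
        show "AE \<omega> in digit_space c. (\<integral>\<^sup>+t. ?h t z \<omega> \<partial>params) \<le> ?C * agreement_weight lam (snd z) \<omega>"
          using AE_digits[OF c_nonzero]
        proof eventually_elim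
          case (elim \<omega>)
          then have "\<omega> \<in> digit_seqs c" by (simp add: digit_seqs_def)
          then show ?case
            using parameter_integral_le[OF z(1) z(2) _ R, of \<omega> "2 * \<rho>"] \<rho> by simp
        qed
      qed
      also have "\<dots> = ?C * (\<integral>\<^sup>+\<omega>. agreement_weight lam (snd z) \<omega> \<partial>digit_space c)"
        unfolding agreement_weight_def
        by (intro nn_integral_cmult borel_measurable_suminf_order borel_measurable_times_ennreal borel_measurable_const
            borel_measurable_indicator sets_agree)
      also have "\<dots> \<le> ?C * ennreal (1 / (1 - 1 / (lam * \<bar>of_int c\<bar> ^ CARD('n))))"
        by (intro mult_left_mono agreement_weight_integral c_nonzero lam expand) auto
      finally show ?case .
    qed
  qed
  also have "\<dots> = ennreal ((2 * R) ^ (s - 1) * (2 * (2 * \<rho>) / \<delta>)) * ennreal (1 / (1 - 1 / (lam * \<bar>of_int c\<bar> ^ CARD('n))))"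
    by (simp only: nn_integral_const N.emeasure_space_1 mult_1_right)
  finally have "(\<integral>\<^sup>+t. indicator (box R) t * energy c (perturbed t) \<rho> \<partial>params) \<le>
    ennreal ((2 * R) ^ (s - 1) * (2 * (2 * \<rho>) / \<delta>)) * ennreal (1 / (1 - 1 / (lam * \<bar>of_int c\<bar> ^ CARD('n)))) * ?k"
    unfolding X by (intro mult_right_mono) auto
  also have "\<dots> = (ennreal ((2 * R) ^ (s - 1) * (2 * (2 * \<rho>) / \<delta>)) * ?k) * ennreal (1 / (1 - 1 / (lam * \<bar>of_int c\<bar> ^ CARD('n))))"
    by (simp only: mult_ac)
  also have "ennreal ((2 * R) ^ (s - 1) * (2 * (2 * \<rho>) / \<delta>)) * ?k = ennreal ((2 * R) ^ (s - 1) * (2 * (2 * \<rho>) / \<delta>) * (1 / (2 * \<rho>)))"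
    using R \<rho> delta by (intro ennreal_mult[symmetric]) auto
  also have "(2 * R) ^ (s - 1) * (2 * (2 * \<rho>) / \<delta>) * (1 / (2 * \<rho>)) = (2 * R) ^ (s - 1) * (2 / \<delta>)"
    using \<rho> by simp
  finally show ?thesis .
qed

text \<open>By Fatou the lower limit of the energies is integrable over every box of parameters.\<close>

lemma AE_energy_frequently_bounded:
  "AE t in params. \<exists>L<\<top>. frequently (\<lambda>m. energy c (perturbed t) (1 / real (Suc m)) \<le> L) sequentially"
proof -
  interpret P: prob_space "digit_space c :: (nat \<Rightarrow> real^'n) measure" by (rule prob_space_digits)
  interpret N: prob_space "natural_space c :: ((real^'n) \<times> (nat \<Rightarrow> real^'n)) measure" by (rule prob_space_natural)
  let ?e = "\<lambda>m t. energy c (perturbed t) (1 / real (Suc m))"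
  have boxm: "box R \<in> sets params" for R by (intro sets_PiM_I_finite) auto
  have fstm: "(\<lambda>v. fst v) \<in> measurable (natural_space c) cube_measure"
    unfolding natural_space_def by simp
  have em: "?e m \<in> borel_measurable params" for m
  proof -
    let ?M = "(params \<Otimes>\<^sub>M natural_space c) \<Otimes>\<^sub>M (digit_space c :: (nat \<Rightarrow> real^'n) measure)"
    let ?I = "{- 2 * (1 / real (Suc m))..2 * (1 / real (Suc m))}"
    have Z: "(\<lambda>v. snd (fst v)) \<in> measurable ?M (natural_space c)"
      by (rule measurable_compose[OF measurable_fst measurable_snd])
    have "(\<lambda>v. (fst (snd (fst v)), snd v)) \<in> measurable ?M (natural_space c)"
      unfolding natural_space_def[of c]
      by (intro measurable_Pair measurable_compose[OF Z[unfolded natural_space_def] measurable_fst] measurable_snd)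
    then have "(\<lambda>v. perturbed (fst (fst v)) (snd (fst v)) - perturbed (fst (fst v)) (fst (snd (fst v)), snd v)) \<in> borel_measurable ?M"
      by (intro borel_measurable_diff measurable_perturbed Z measurable_compose[OF measurable_fst measurable_fst])
    then have "(\<lambda>v. indicator ?I (perturbed (fst (fst v)) (snd (fst v)) - perturbed (fst (fst v)) (fst (snd (fst v)), snd v)) :: ennreal) \<in> borel_measurable ?M"
      by (rule measurable_compose) simp
    then have "(\<lambda>(u, \<omega>). indicator ?I (perturbed (fst u) (snd u) - perturbed (fst u) (fst (snd u), \<omega>)) :: ennreal) \<in> borel_measurable ?M"
      unfolding split_beta' .
    from P.borel_measurable_nn_integral[OF this]
    have "(\<lambda>(t, z). \<integral>\<^sup>+\<omega>. indicator ?I (perturbed t z - perturbed t (fst z, \<omega>)) \<partial>digit_space c) \<in> borel_measurable (params \<Otimes>\<^sub>M natural_space c)"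
      unfolding split_beta' .
    from N.borel_measurable_nn_integral[OF this] show ?thesis
      unfolding energy_def by (intro borel_measurable_times_ennreal borel_measurable_const)
  qed
  have "AE t in params. t \<in> box (real (Suc r)) \<longrightarrow> liminf (\<lambda>m. ?e m t) < \<top>" for r
  proof -
    let ?R = "real (Suc r)"
    let ?K = "ennreal ((2 * ?R) ^ (s - 1) * (2 / \<delta>)) * ennreal (1 / (1 - 1 / (lam * \<bar>of_int c\<bar> ^ CARD('n))))"
    have "(\<integral>\<^sup>+t. liminf (\<lambda>m. indicator (box ?R) t * ?e m t) \<partial>params) \<le>
      liminf (\<lambda>m. \<integral>\<^sup>+t. indicator (box ?R) t * ?e m t \<partial>params)"
      by (intro nn_integral_liminf borel_measurable_times_ennreal borel_measurable_indicator boxm em)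
    also have "\<dots> \<le> liminf (\<lambda>m. ?K)"
      by (intro Liminf_mono always_eventually allI energy_parameter_integral) auto
    also have "\<dots> = ?K" by (simp add: Liminf_const)
    also have "\<dots> < \<top>" by (simp add: ennreal_mult_less_top)
    finally have fin: "(\<integral>\<^sup>+t. liminf (\<lambda>m. indicator (box ?R) t * ?e m t) \<partial>params) \<noteq> \<infinity>" by simp
    have "AE t in params. liminf (\<lambda>m. indicator (box ?R) t * ?e m t) \<noteq> \<infinity>"
      by (intro nn_integral_noteq_infinite[OF _ fin] borel_measurable_liminf borel_measurable_times_ennreal borel_measurable_indicator boxm em)
    then show ?thesis
      by eventually_elim (auto simp: top.not_eq_extremum)
  qed
  then have "AE t in params. \<forall>r. t \<in> box (real (Suc r)) \<longrightarrow> liminf (\<lambda>m. ?e m t) < \<top>"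
    by (subst AE_all_countable) blast
  then show ?thesis
  proof (rule AE_mp, intro AE_I2 impI)
    fix t assume t: "t \<in> space params" and a: "\<forall>r. t \<in> box (real (Suc r)) \<longrightarrow> liminf (\<lambda>m. ?e m t) < \<top>"
    obtain r :: nat where r: "(\<Sum>k\<in>{1..s}. \<bar>t k\<bar>) < real r" using reals_Archimedean2 by blast
    have "t \<in> box (real (Suc r))"
    proof (rule PiE_I)
      fix k assume k: "k \<in> {1..s}"
      have "\<bar>t k\<bar> \<le> (\<Sum>k\<in>{1..s}. \<bar>t k\<bar>)" using k by (intro member_le_sum) auto
      then have "\<bar>t k\<bar> \<le> real (Suc r)" using r by simp
      from abs_le_D1[OF this] abs_le_D2[OF this]
      show "t k \<in> {- real (Suc r)..real (Suc r)}" by simp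
    next
      fix k assume "k \<notin> {1..s}"
      then show "t k = undefined" using t by (auto simp: space_PiM PiE_def extensional_def)
    qed
    then have lt: "liminf (\<lambda>m. ?e m t) < \<top>" using a by blast
    then obtain L where L: "liminf (\<lambda>m. ?e m t) < L" "L < \<top>" using dense by blast
    have "frequently (\<lambda>m. ?e m t \<le> L) sequentially"
    proof (rule ccontr)
      assume "\<not> ?thesis"
      then have "eventually (\<lambda>m. L \<le> ?e m t) sequentially"
        unfolding not_frequently by (rule eventually_mono) simp
      then have "L \<le> liminf (\<lambda>m. ?e m t)" by (rule Liminf_bounded)
      then show False using L(1) by simp
    qed
    then show "\<exists>L<\<top>. frequently (\<lambda>m. ?e m t \<le> L) sequentially" using L(2) by blast
  qed
qed

theorem AE_absolutely_continuous:
  "AE t in params. absolutely_continuous volume_measure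
     (solenoid_measure c lam (\<lambda>x. f x + (\<Sum>k\<in>{1..s}. t k * \<phi> k x)))"
  using AE_energy_frequently_bounded
proof eventually_elim
  case (elim t)
  let ?g = "\<lambda>x. f x + (\<Sum>k\<in>{1..s}. t k * \<phi> k x)"
  obtain L where L: "L < \<top>" "frequently (\<lambda>m. energy c (perturbed t) (1 / real (Suc m)) \<le> L) sequentially"
    using elim by blast
  have "fibre c lam ?g = perturbed t"
  proof (rule ext)
    show "fibre c lam ?g z = perturbed t z" for z
      unfolding perturbed_def by (rule fibre_affine[OF less_imp_le[OF lam(1)] lam(2) cont_f cont_\<phi>])
  qed
  moreover have "?g \<in> borel_measurable borel"
    by (intro borel_measurable_continuous_onI continuous_intros cont_f cont_\<phi>)
  ultimately show ?case
    using L by (intro absolutely_continuous_of_energy[OF c_nonzero]) auto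
qed

end

theorem corollaryC:
  fixes E :: "real^'n \<Rightarrow> real^'n" and lam :: real and C :: "real \<Rightarrow> real"
  assumes "linear_expanding E"
    and "\<exists>c::real. E = (\<lambda>x. c *\<^sub>R x)"
    and "inverse \<bar>det (matrix E)\<bar> < lam" and "lam < 1"
    and "C = (\<lambda>y. lam * y)"
  shows "\<exists>(s::nat) (\<phi> :: nat \<Rightarrow> 'n torus \<Rightarrow> real).
    (\<forall>k\<in>{1..s}. smooth_torus (\<phi> k)) \<and>
    (\<forall>f :: 'n torus \<Rightarrow> real. Ck_torus 2 f \<longrightarrow>
      (AE t in (\<Pi>\<^sub>M k\<in>{1..s}. lborel).
        absolutely_continuous volume_measure
          (SRB_measure (skew_product E C (\<lambda>x. f x + (\<Sum>k=1..s. t k * \<phi> k x))))))"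
proof -
  obtain a where a: "E = (\<lambda>x. a *\<^sub>R x)" using assms(2) by (elim exE)
  \<comment> \<open>The diagonal vector is integral, and so is its image.\<close>
  have "a \<in> \<int>"
  proof -
    have "(\<chi> i. 1) \<in> (int_vectors :: (real^'n) set)" by (simp add: int_vectors_def)
    then have "E (\<chi> i. 1) \<in> int_vectors" using assms(1) by (auto simp: linear_expanding_def)
    then show ?thesis by (simp add: a int_vectors_def)
  qed
  then obtain c :: int where ac: "a = of_int c" by (auto simp: Ints_def)
  have E: "E = (\<lambda>x. of_int c *\<^sub>R x)" by (simp add: a ac)
  have det: "det (matrix E) = of_int c ^ CARD('n)"
    unfolding E by (rule det_matrix_scaleR)
  have c0: "c \<noteq> 0"
  proof
    assume "c = 0"
    then have "E = (\<lambda>x. 0)" by (simp add: E)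
    moreover have "bij E" using assms(1) by (simp add: linear_expanding_def)
    ultimately have "(0 :: real^'n) = (\<chi> i. 1)" by (metis bij_is_inj injD)
    then show False by (simp add: vec_eq_iff)
  qed
  have N0: "0 < \<bar>real_of_int c\<bar> ^ CARD('n)" using c0 by simp
  have inv: "inverse (\<bar>real_of_int c\<bar> ^ CARD('n)) < lam" using assms(3) by (simp add: det power_abs)
  have lam: "0 < lam" "lam < 1" using inv N0 assms(4) by (auto intro: less_trans[of 0 "inverse (\<bar>real_of_int c\<bar> ^ CARD('n))"])
  have expand: "1 < lam * \<bar>of_int c\<bar> ^ CARD('n)"
    using inv N0 by (simp add: field_simps)
  have c2: "\<bar>c\<bar> \<ge> 2"
  proof (rule ccontr)
    assume "\<not> ?thesis"
    then have "\<bar>c\<bar> = 1" using c0 by linarith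
    then have "\<bar>real_of_int c\<bar> = 1" by (metis of_int_1 of_int_abs)
    then show False using expand lam by simp
  qed
  obtain s :: nat and \<phi> :: "nat \<Rightarrow> 'n torus \<Rightarrow> real" and \<delta> :: real where tr: "0 < \<delta>"
    "\<And>k. k \<in> {1..s} \<Longrightarrow> smooth_torus (\<phi> k)"
    "\<And>x \<omega> \<omega>'. x \<in> wide_box \<Longrightarrow> \<omega> \<in> digit_seqs c \<Longrightarrow> \<omega>' \<in> digit_seqs c \<Longrightarrow> \<omega> 0 \<noteq> \<omega>' 0 \<Longrightarrow>
      \<exists>k\<in>{1..s}. \<delta> \<le> \<bar>fibre c lam (\<phi> k) (x, \<omega>) - fibre c lam (\<phi> k) (x, \<omega>')\<bar>"
    using transversality[OF c2 lam compact_wide_box] by metis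
  have cont_\<phi>: "continuous_on UNIV (\<phi> k)" if "k \<in> {1..s}" for k
    using tr(2)[OF that] smooth_torus_continuous[of 0 "\<phi> k"] by (simp add: smooth_torus_def)
  show ?thesis
  proof (intro exI[of _ s] exI[of _ \<phi>] conjI ballI allI impI tr(2))
    fix f :: "'n torus \<Rightarrow> real" assume "Ck_torus 2 f"
    then have f: "continuous_on UNIV f" by (rule smooth_torus_continuous)
    interpret transversal_family c lam \<delta> s \<phi> f
      by unfold_locales (fact c2 lam expand tr cont_\<phi> f)+
    have "SRB_measure (skew_product E C (\<lambda>x. f x + (\<Sum>k=1..s. t k * \<phi> k x))) =
      solenoid_measure c lam (\<lambda>x. f x + (\<Sum>k\<in>{1..s}. t k * \<phi> k x))" for t
      unfolding E assms(5)
      by (rule SRB_measure_eq_solenoid[OF c2 less_imp_le[OF lam(1)] lam(2)])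
        (intro continuous_intros f cont_\<phi>)
    then show "AE t in (\<Pi>\<^sub>M k\<in>{1..s}. lborel). absolutely_continuous volume_measure
          (SRB_measure (skew_product E C (\<lambda>x. f x + (\<Sum>k=1..s. t k * \<phi> k x))))"
      using AE_absolutely_continuous by simp
  qed
qed

end
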